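(* Let $s_0\in(0,1)$, $s\in[s_0,1)$, and let $\bar\alpha>0$ be the exponent described in the context. Assume that $u\in C(\mathbb R^n)$ satisfies, in the viscosity sense, for all $h\in\mathbb R^n$ with $h_n\ge0$, \[ M^+_{\mathcal L_*}\{u(\cdot+h)-u\}\ge0\quad\text{and}\quad M^-_{\mathcal L_*}\{u(\cdot+h)-u\}\le0\quad\text{in }\{x_n>0\}, \] and $u=0$ in $\{x_n<0\}$. Assume that for some $\beta\in(0,1)$ and $\alpha\in(0,\bar\alpha)$ there is a constant $C$ such that \[ \bigl[u/(x_n)_+^s\bigr]_{C^\beta(B_R^+)}\le CR^\alpha\quad\text{for all }R\ge1. \] Then \[ u(x)=(x_n)_+^s\,(p\cdot x+b) \] for some $p\in\mathbb R^n$ and $b\in\mathbb R$.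
   Context: Fix ellipticity constants $0<\lambda\le\Lambda$. For $s\in(0,1)$, $\mathcal L_*=\mathcal L_*(s)$ is the class of all linear operators \[Lu(x)=(1-s)\int_{\mathbb R^n}\Bigl(\tfrac{u(x+y)+u(x-y)}{2}-u(x)\Bigr)\frac{\mu(y/|y|)}{|y|^{n+2s}}\,dy\] with $\mu\in L^\infty(S^{n-1})$, $\mu(\theta)=\mu(-\theta)$, $\lambda\le\mu\le\Lambda$. $M^+_{\mathcal L_*}u=\sup_{L\in\mathcal L_*}Lu$, $M^-_{\mathcal L_*}u=\inf_{L\in\mathcal L_*}Lu$. Notation: $B_r^+=B_r\cap\{x_n>0\}$, $B_r^-=B_r\cap\{x_n<0\}$; $[\cdot]_{C^\beta}$ is the Hölder seminorm. Viscosity inequalities: let $U$ be open and let $w:\mathbb R^n\to\mathbb R$ satisfy $\int |w|(1+|x|)^{-n-2s}dx<\infty$. If $w$ is upper semicontinuous in $U$, $M^+w\ge g$ in $U$ means: whenever $x\in U$, $N\subset U$ is an open neighborhood of $x$, $\varphi\in C^2(\overline N)$, $\varphi(x)=w(x)$ and $\varphi>w$ in $N\setminus\{x\}$, the function $v$ equal to $\varphi$ in $N$ and to $w$ outside $N$ satisfies $M^+v(x)\ge g(x)$. $M^-w\le g$ is defined symmetrically (lower semicontinuous $w$, $\varphi<w$). The exponent $\bar\alpha\in(0,s_0)$: a number depending only on $n,s_0,\lambda,\Lambda$ for which there is $C=C(n,s_0,\lambda,\Lambda)$ such that for all $s\in[s_0,1)$, $C_0\ge0$ and $u\in C(B_1)\cap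 L^\infty(\mathbb R^n)$ with $M^+_{\mathcal L_*}u\ge-C_0$ and $M^-_{\mathcal L_*}u\le C_0$ in $B_1^+$ (viscosity sense) and $u=0$ in $B_1^-$, one has $\|u/x_n^s\|_{C^{\bar\alpha}(B_{1/2}^+)}\le C(C_0+\|u\|_{L^\infty(\mathbb R^n)})$. *)

theory Defs
  imports "HOL-Analysis.Analysis" "HOL-Probability.Essential_Supremum"
begin

text \<open>
  The dimension is \<open>n = CARD('n)\<close>. Since the index type carries no order, the ``last''
  coordinate \<open>x\<^sub>n\<close> is \<open>x $ k\<close> for a distinguished index \<open>k\<close>.
\<close>

definition upper_half_space :: "'n::finite \<Rightarrow> (real ^ 'n) set" where
  "upper_half_space k = {x. x $ k > 0}"

definition lower_half_space :: "'n::finite \<Rightarrow> (real ^ 'n) set" where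
  "lower_half_space k = {x. x $ k < 0}"

definition upper_half_ball :: "'n::finite \<Rightarrow> real \<Rightarrow> (real ^ 'n) set" where
  "upper_half_ball k r = ball 0 r \<inter> upper_half_space k"

definition lower_half_ball :: "'n::finite \<Rightarrow> real \<Rightarrow> (real ^ 'n) set" where
  "lower_half_ball k r = ball 0 r \<inter> lower_half_space k"

definition holder_seminorm :: "real \<Rightarrow> (real ^ 'n) set \<Rightarrow> (real ^ 'n \<Rightarrow> real) \<Rightarrow> ennreal" where
  "holder_seminorm b S f =
    (SUP (x, y) \<in> {(x, y). x \<in> S \<and> y \<in> S \<and> x \<noteq> y}. ennreal (\<bar>f x - f y\<bar> / dist x y powr b))"

definition sup_norm :: "(real ^ 'n) set \<Rightarrow> (real ^ 'n \<Rightarrow> real) \<Rightarrow> ennreal" where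
  "sup_norm S f = (SUP x \<in> S. ennreal \<bar>f x\<bar>)"

definition holder_norm :: "real \<Rightarrow> (real ^ 'n) set \<Rightarrow> (real ^ 'n \<Rightarrow> real) \<Rightarrow> ennreal" where
  "holder_norm b S f = sup_norm S f + holder_seminorm b S f"

definition Linf_norm :: "(real ^ 'n \<Rightarrow> real) \<Rightarrow> ennreal" where
  "Linf_norm f = esssup lebesgue (\<lambda>x. ennreal \<bar>f x\<bar>)"

definition in_Linf :: "(real ^ 'n \<Rightarrow> real) \<Rightarrow> bool" where
  "in_Linf f \<longleftrightarrow> f \<in> borel_measurable lebesgue \<and> Linf_norm f < \<infinity>"

text \<open>
  Elements of \<open>L\<^sup>\<infinity>(S\<^sup>n\<^sup>-\<^sup>1)\<close> are represented by Borel functions satisfying the bounds and the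
  evenness everywhere. Every class satisfying them almost everywhere has such a representative,
  and the operator below does not depend on the choice of the representative.
\<close>

definition kernels :: "real \<Rightarrow> real \<Rightarrow> (real ^ 'n \<Rightarrow> real) set" where
  "kernels lam Lam =
    {\<mu>. \<mu> \<in> borel_measurable (restrict_space borel (sphere 0 1)) \<and>
        (\<forall>\<theta> \<in> sphere 0 1. \<mu> (- \<theta>) = \<mu> \<theta>) \<and>
        (\<forall>\<theta> \<in> sphere 0 1. lam \<le> \<mu> \<theta> \<and> \<mu> \<theta> \<le> Lam)}"

text \<open>
  The integral is the extended-real one, positive part minus negative part: a test function on an
  unbounded neighbourhood may grow so fast that the integral diverges to \<open>\<infinity>\<close> (touching from
  above) or \<open>-\<infinity>\<close> (touching from below). The two parts are never both infinite for the functions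
  occurring in the viscosity inequalities below.
\<close>

definition ext_integral :: "(real ^ 'n \<Rightarrow> real) \<Rightarrow> ereal" where
  "ext_integral f =
    enn2ereal (\<integral>\<^sup>+ y. ennreal (f y) \<partial>lebesgue) - enn2ereal (\<integral>\<^sup>+ y. ennreal (- f y) \<partial>lebesgue)"

definition stable_op ::
  "real \<Rightarrow> (real ^ 'n \<Rightarrow> real) \<Rightarrow> (real ^ 'n \<Rightarrow> real) \<Rightarrow> real ^ 'n \<Rightarrow> ereal" where
  "stable_op s \<mu> u x =
    ereal (1 - s) *
    ext_integral (\<lambda>y. ((u (x + y) + u (x - y)) / 2 - u x) *
      (\<mu> (y /\<^sub>R norm y) / norm y powr (real CARD('n) + 2 * s)))"

definition L_star ::
  "real \<Rightarrow> real \<Rightarrow> real \<Rightarrow> ((real ^ 'n \<Rightarrow> real) \<Rightarrow> real ^ 'n \<Rightarrow> ereal) set" where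
  "L_star s lam Lam = stable_op s ` kernels lam Lam"

definition M_plus :: "real \<Rightarrow> real \<Rightarrow> real \<Rightarrow> (real ^ 'n \<Rightarrow> real) \<Rightarrow> real ^ 'n \<Rightarrow> ereal" where
  "M_plus s lam Lam u x = (SUP L \<in> L_star s lam Lam. L u x)"

definition M_minus :: "real \<Rightarrow> real \<Rightarrow> real \<Rightarrow> (real ^ 'n \<Rightarrow> real) \<Rightarrow> real ^ 'n \<Rightarrow> ereal" where
  "M_minus s lam Lam u x = (INF L \<in> L_star s lam Lam. L u x)"

definition usc_on :: "(real ^ 'n) set \<Rightarrow> (real ^ 'n \<Rightarrow> real) \<Rightarrow> bool" where
  "usc_on U w \<longleftrightarrow> (\<forall>x \<in> U. \<forall>a > w x. \<forall>\<^sub>F y in at x within U. w y < a)"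

definition lsc_on :: "(real ^ 'n) set \<Rightarrow> (real ^ 'n \<Rightarrow> real) \<Rightarrow> bool" where
  "lsc_on U w \<longleftrightarrow> (\<forall>x \<in> U. \<forall>a < w x. \<forall>\<^sub>F y in at x within U. w y > a)"

text \<open>Integrability of \<open>w\<close> itself against the weight, so that \<open>w\<close> is Lebesgue measurable.\<close>

definition weighted_integrable :: "real \<Rightarrow> (real ^ 'n \<Rightarrow> real) \<Rightarrow> bool" where
  "weighted_integrable s w \<longleftrightarrow>
    integrable lebesgue (\<lambda>x. w x * (1 + norm x) powr (- real CARD('n) - 2 * s))"

text \<open>
  \<open>C\<^sup>2(closure N)\<close> for open \<open>N\<close>: twice continuously differentiable in \<open>N\<close>, all derivatives up to
  order two extending continuously to the closure (\<open>G\<close> and \<open>H\<close> are the extended gradient and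
  Hessian).
\<close>

definition C2_closure :: "(real ^ 'n) set \<Rightarrow> (real ^ 'n \<Rightarrow> real) \<Rightarrow> bool" where
  "C2_closure N \<phi> \<longleftrightarrow>
    (\<exists>(G :: real ^ 'n \<Rightarrow> real ^ 'n) (H :: real ^ 'n \<Rightarrow> real ^ 'n ^ 'n).
      (\<forall>z \<in> N. (\<phi> has_derivative (\<lambda>h. G z \<bullet> h)) (at z)) \<and>
      (\<forall>z \<in> N. (G has_derivative (\<lambda>h. H z *v h)) (at z)) \<and>
      continuous_on (closure N) \<phi> \<and> continuous_on (closure N) G \<and> continuous_on (closure N) H)"

definition visc_M_plus_ge ::
  "real \<Rightarrow> real \<Rightarrow> real \<Rightarrow> (real ^ 'n) set \<Rightarrow> (real ^ 'n \<Rightarrow> real) \<Rightarrow> (real ^ 'n \<Rightarrow> real) \<Rightarrow> bool" where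
  "visc_M_plus_ge s lam Lam U w g \<longleftrightarrow>
    weighted_integrable s w \<and> usc_on U w \<and>
    (\<forall>x N \<phi>. x \<in> U \<and> open N \<and> x \<in> N \<and> N \<subseteq> U \<and> C2_closure N \<phi> \<and>
        \<phi> x = w x \<and> (\<forall>z \<in> N - {x}. \<phi> z > w z) \<longrightarrow>
      M_plus s lam Lam (\<lambda>z. if z \<in> N then \<phi> z else w z) x \<ge> ereal (g x))"

definition visc_M_minus_le ::
  "real \<Rightarrow> real \<Rightarrow> real \<Rightarrow> (real ^ 'n) set \<Rightarrow> (real ^ 'n \<Rightarrow> real) \<Rightarrow> (real ^ 'n \<Rightarrow> real) \<Rightarrow> bool" where
  "visc_M_minus_le s lam Lam U w g \<longleftrightarrow>
    weighted_integrable s w \<and> lsc_on U w \<and>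
    (\<forall>x N \<phi>. x \<in> U \<and> open N \<and> x \<in> N \<and> N \<subseteq> U \<and> C2_closure N \<phi> \<and>
        \<phi> x = w x \<and> (\<forall>z \<in> N - {x}. \<phi> z < w z) \<longrightarrow>
      M_minus s lam Lam (\<lambda>z. if z \<in> N then \<phi> z else w z) x \<le> ereal (g x))"

text \<open>
  \<open>abar\<close> is an exponent for which the boundary Hoelder estimate for \<open>u/x\<^sub>n\<^sup>s\<close> holds, with one
  constant for all \<open>s \<in> [s\<^sub>0, 1)\<close>.
\<close>

definition boundary_exponent :: "'n::finite \<Rightarrow> real \<Rightarrow> real \<Rightarrow> real \<Rightarrow> real \<Rightarrow> bool" where
  "boundary_exponent k s0 lam Lam abar \<longleftrightarrow>
    0 < abar \<and> abar < s0 \<and>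
    (\<exists>C \<ge> 0. \<forall>s \<in> {s0..<1}. \<forall>C0 \<ge> 0. \<forall>u :: real ^ 'n \<Rightarrow> real.
      continuous_on (ball 0 1) u \<and> in_Linf u \<and>
      visc_M_plus_ge s lam Lam (upper_half_ball k 1) u (\<lambda>x. - C0) \<and>
      visc_M_minus_le s lam Lam (upper_half_ball k 1) u (\<lambda>x. C0) \<and>
      (\<forall>x \<in> lower_half_ball k 1. u x = 0) \<longrightarrow>
      holder_norm abar (upper_half_ball k (1/2)) (\<lambda>x. u x / (x $ k) powr s)
        \<le> ennreal C * (ennreal C0 + Linf_norm u))"

end

theory Submission
  imports Defs "HOL-Real_Asymp.Real_Asymp"
begin

text \<open>
  If \<open>h\<^sub>n = 0\<close>, the increment \<open>u(\<cdot> + h) - u\<close> vanishes in the lower half-space and grows at most like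
  \<open>R\<^sup>s\<^sup>+\<^sup>\<alpha>\<close>, so the boundary estimate on large balls forces it to be a multiple of \<open>(x\<^sub>n)\<^sub>+\<^sup>s\<close>. The
  coefficient is additive in \<open>h\<close>, whence \<open>u(x) = (x\<^sub>n)\<^sub>+\<^sup>s (p \<cdot> x + b) + \<phi>(x\<^sub>n)\<close> with \<open>p\<^sub>n = 0\<close> and
  \<open>\<phi>(t) = O(t\<^sup>s\<^sup>+\<^sup>\<beta>)\<close> near \<open>0\<close>.

  A normal increment of size \<open>h\<close> does not vanish for \<open>-h < x\<^sub>n < 0\<close>. Subtract from it
  \<open>(p \<cdot> x + b) ((x\<^sub>n + h)\<^sub>+\<^sup>s - (x\<^sub>n)\<^sub>+\<^sup>s)\<close> and the one-dimensional harmonic extension, by an explicit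
  Poisson kernel, of its remaining values on the strip. Every operator of the class annihilates both
  in the upper half-space: on functions of \<open>x\<^sub>n\<close> it acts as a multiple of the fractional Laplacian
  on the line, and the cross term of \<open>p \<cdot> x\<close> reduces to the same operator after an integration by
  parts. Hence \<open>\<phi>(t + h) - \<phi>(t) = c(h) t\<^sup>s\<close> for \<open>t > 0\<close>, up to the Poisson extension, which is
  \<open>O(h\<^sup>1\<^sup>+\<^sup>\<beta> t\<^sup>s\<^sup>-\<^sup>1)\<close>. As \<open>1 + \<beta> > 1\<close>, summing over many small steps shows that \<open>\<phi>\<close> is a multiple
  of \<open>t\<^sub>+\<^sup>s\<^sup>+\<^sup>1\<close>.
\<close>

section \<open>The fractional Laplacian on the line\<close>

text \<open>\<open>M_plus\<close> and \<open>M_minus\<close> are nonlinear, so a sum or difference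
  of solutions need not be a solution. A function annihilated by every single operator of the class
  can, however, be subtracted without affecting either inequality; this dictates that all
  corrections be harmonic for all kernels at once. Equations are available for increments only: the
  final answer has degree s + 1 > 2s in general, so u itself is not integrable against the weight.
  Two exponents decide the argument. Truncating at radius R costs R^(s+\<alpha>), while undoing the
  rescaling in the Hoelder estimate gains R^(-s-abar), and \<alpha> < abar. The exterior datum of a
  normal increment has size h^(s+\<beta>) on a strip of width h, and the Poisson weight y^(-s)
  integrates to h^(1-s) over that strip; the product h^(1+\<beta>) remains small after adding up
  about 1/h steps. The one-dimensional singular integrals are computed by elementary means: folding
  the values on (0, 1) onto (1, \<infinity>) turns the integrands into exact derivatives.\<close>

definition second_diff :: "(real \<Rightarrow> real) \<Rightarrow> real \<Rightarrow> real \<Rightarrow> real" where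
  "second_diff F x t = F (x + t) + F (x - t) - 2 * F x"

text \<open>Up to a positive constant the value v is that of -(-Delta)^s at x. The second difference
  is even in t, so half of the line suffices; the Bochner form records absolute convergence together
  with the value.\<close>

definition has_frac_lap :: "real \<Rightarrow> (real \<Rightarrow> real) \<Rightarrow> real \<Rightarrow> real \<Rightarrow> bool" where
  "has_frac_lap s F x v \<longleftrightarrow>
    has_bochner_integral lborel
      (\<lambda>t. indicator {0<..} t * (second_diff F x t * t powr (- 1 - 2 * s))) v"

lemma second_diff_bound:
  fixes F F' F'' :: "real \<Rightarrow> real"
  assumes F': "\<And>z. \<bar>z - x\<bar> < r \<Longrightarrow> (F has_real_derivative F' z) (at z)"
    and F'': "\<And>z. \<bar>z - x\<bar> < r \<Longrightarrow> (F' has_real_derivative F'' z) (at z)"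
    and M: "\<And>z. \<bar>z - x\<bar> < r \<Longrightarrow> \<bar>F'' z\<bar> \<le> M"
    and t: "0 < t" "t < r"
  shows "\<bar>second_diff F x t\<bar> \<le> 2 * M * t\<^sup>2"
proof -
  have "\<exists>\<xi>. 0 < \<xi> \<and> \<xi> < t \<and> (F (x + t) + F (x - t)) - (F (x + 0) + F (x - 0))
      = (t - 0) * (F' (x + \<xi>) - F' (x - \<xi>))"
  proof (rule MVT2[OF t(1)])
    fix \<tau> assume \<tau>: "0 \<le> \<tau>" "\<tau> \<le> t"
    have "((\<lambda>\<tau>. F (x + \<tau>)) has_real_derivative F' (x + \<tau>) * 1) (at \<tau>)"
      using \<tau> t by (intro DERIV_chain2[where f = F] F') (auto intro!: derivative_eq_intros)
    moreover have "((\<lambda>\<tau>. F (x - \<tau>)) has_real_derivative F' (x - \<tau>) * (- 1)) (at \<tau>)"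
      using \<tau> t by (intro DERIV_chain2[where f = F] F') (auto intro!: derivative_eq_intros)
    ultimately show "((\<lambda>\<tau>. F (x + \<tau>) + F (x - \<tau>)) has_real_derivative F' (x + \<tau>) - F' (x - \<tau>)) (at \<tau>)"
      using DERIV_add by fastforce
  qed
  then obtain \<xi> where \<xi>: "0 < \<xi>" "\<xi> < t" "second_diff F x t = t * (F' (x + \<xi>) - F' (x - \<xi>))"
    by (auto simp: second_diff_def algebra_simps)
  have "\<exists>\<eta>. x - \<xi> < \<eta> \<and> \<eta> < x + \<xi> \<and> F' (x + \<xi>) - F' (x - \<xi>) = ((x + \<xi>) - (x - \<xi>)) * F'' \<eta>"
    by (rule MVT2) (use \<xi> t in \<open>auto intro!: F''\<close>)
  then obtain \<eta> where \<eta>: "x - \<xi> < \<eta>" "\<eta> < x + \<xi>" "F' (x + \<xi>) - F' (x - \<xi>) = 2 * \<xi> * F'' \<eta>"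
    by auto
  have "\<bar>F'' \<eta>\<bar> \<le> M" using \<eta> \<xi> t by (intro M) auto
  have "\<bar>second_diff F x t\<bar> = 2 * t * (\<xi> * \<bar>F'' \<eta>\<bar>)"
    using \<xi> \<eta> t by (simp add: abs_mult)
  also have "\<dots> \<le> 2 * t * (t * M)"
    using \<xi> t \<open>\<bar>F'' \<eta>\<bar> \<le> M\<close> by (intro mult_left_mono mult_mono) auto
  finally show ?thesis by (simp add: power2_eq_square mult_ac)
qed

section \<open>Integrals of powers and primitives on the half-line\<close>

lemma set_integrable_powr_at_0:
  fixes a p :: real
  assumes "a > -1" "p > 0"
  shows "set_integrable lborel {0<..<p} (\<lambda>t. t powr a)"
proof -
  have "set_integrable lborel (einterval (ereal 0) (ereal p)) (\<lambda>t. t powr a)"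
  proof (rule interval_integral_FTC_nonneg(1)[where F = "\<lambda>t. t powr (a + 1) / (a + 1)"
        and A = 0 and B = "p powr (a + 1) / (a + 1)"])
    show "((\<lambda>t. t powr (a + 1) / (a + 1)) has_real_derivative x powr a) (at x)"
      if "ereal 0 < ereal x" for x
      using that assms by (auto intro!: derivative_eq_intros simp: powr_diff)
    show "isCont (\<lambda>t. t powr a) x" if "ereal 0 < ereal x" for x
      using that by (auto intro!: continuous_intros)
    show "(((\<lambda>t. t powr (a + 1) / (a + 1)) \<circ> real_of_ereal) \<longlongrightarrow> 0) (at_right (ereal 0))"
      unfolding ereal_tendsto_simps using assms by real_asymp
    have "isCont (\<lambda>t. t powr (a + 1) / (a + 1)) p"
      using assms by (auto intro!: continuous_intros)
    then show "(((\<lambda>t. t powr (a + 1) / (a + 1)) \<circ> real_of_ereal) \<longlongrightarrow> p powr (a + 1) / (a + 1)) (at_left (ereal p))"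
      unfolding ereal_tendsto_simps isCont_def by (rule filterlim_at_split[THEN iffD1, THEN conjunct1])
  qed (use assms in auto)
  then show ?thesis by (simp add: einterval_def greaterThanLessThan_def greaterThan_def lessThan_def Int_def)
qed

lemma set_integrable_powr_at_top:
  fixes a p :: real
  assumes "a < -1" "p > 0"
  shows "set_integrable lborel {p<..} (\<lambda>t. t powr a)"
    and "(LBINT t:{p<..}. t powr a) = p powr (a + 1) / (- a - 1)"
proof -
  have F: "((\<lambda>t. t powr (a + 1) / (a + 1)) has_real_derivative x powr a) (at x)"
      if "ereal p < ereal x" for x
    using that assms by (auto intro!: derivative_eq_intros simp: powr_diff)
  have c: "isCont (\<lambda>t. t powr a) x" if "ereal p < ereal x" for x
    using that assms by (auto intro!: continuous_intros)
  have "isCont (\<lambda>t. t powr (a + 1) / (a + 1)) p"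
    using assms by (auto intro!: continuous_intros)
  then have A: "(((\<lambda>t. t powr (a + 1) / (a + 1)) \<circ> real_of_ereal) \<longlongrightarrow> p powr (a + 1) / (a + 1)) (at_right (ereal p))"
    unfolding ereal_tendsto_simps isCont_def by (rule filterlim_at_split[THEN iffD1, THEN conjunct2])
  have B: "(((\<lambda>t. t powr (a + 1) / (a + 1)) \<circ> real_of_ereal) \<longlongrightarrow> 0) (at_left \<infinity>)"
    unfolding ereal_tendsto_simps using assms by real_asymp
  have nn: "AE x in lborel. ereal p < ereal x \<longrightarrow> ereal x < \<infinity> \<longrightarrow> 0 \<le> x powr a" by auto
  have e: "einterval (ereal p) \<infinity> = {p<..}" by (auto simp: einterval_def)
  show "set_integrable lborel {p<..} (\<lambda>t. t powr a)"
    using interval_integral_FTC_nonneg(1)[OF _ F c nn A B] e by simp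
  show "(LBINT t:{p<..}. t powr a) = p powr (a + 1) / (- a - 1)"
    using interval_integral_FTC_nonneg(2)[OF _ F c nn A B] e assms
    by (simp add: interval_lebesgue_integral_def divide_simps) (simp add: algebra_simps)
qed

lemma antiderivative_positive:
  fixes y :: "real \<Rightarrow> real"
  assumes "continuous_on {0<..} y"
  shows "\<exists>Y. \<forall>t>0. (Y has_real_derivative y t) (at t)"
proof (intro exI allI impI)
  fix t :: real assume t: "t > 0"
  \<comment> \<open>An interval containing both t and the base point 1. The primitive may diverge at
    0, so 0 cannot serve as base point.\<close>
  define a where "a = min t 1 / 2"
  define b where "b = max t 1 + 1"
  have ab: "a < t" "t < b" "a \<le> 1" "1 \<le> b" "0 < a"
    using t by (auto simp: a_def b_def min_def max_def)
  have "((\<lambda>x. LBINT v=ereal 1..ereal x. y v) has_vector_derivative y t) (at t within {a..b})"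
    using ab by (intro interval_integral_FTC2 continuous_on_subset[OF assms]) auto
  then show "((\<lambda>x. LBINT v=ereal 1..ereal x. y v) has_real_derivative y t) (at t)"
    using at_within_Icc_at[OF ab(1,2)] by (simp add: has_real_derivative_iff_has_vector_derivative)
qed

text \<open>The involution \<open>z \<mapsto> 1 / z\<close> trades the values of \<open>F\<close> on \<open>(0, 1)\<close> for values on \<open>(1, \<infinity>)\<close>: if
  \<open>Y\<close> is an antiderivative of \<open>(F (1 + t) - F 1) t\<^sup>-\<^sup>1\<^sup>-\<^sup>2\<^sup>s\<close>, then
  \<open>\<Theta> (1 / (1 - t)) + Y t - Y (t / (1 - t))\<close> is one of the integrand on \<open>0 < t < 1\<close>.\<close>

lemma has_frac_lap_mobius:
  fixes F \<Theta> :: "real \<Rightarrow> real"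
  assumes s: "0 < s" "s < 1"
    and F: "continuous_on {0<..} F" "\<And>z. z < 0 \<Longrightarrow> F z = 0"
    and M: "\<And>z. 1 < z \<Longrightarrow> z < 2 \<Longrightarrow> \<bar>F z - F 1\<bar> \<le> M * (z - 1)"
    and \<Theta>: "\<And>z. z > 1 \<Longrightarrow> (\<Theta> has_real_derivative
        (z - 1) powr (- 1 - 2 * s) * (F z - F 1 + (F (1 / z) - F 1) * z powr (2 * s - 1))) (at z)"
    and lim: "(\<Theta> \<longlongrightarrow> 0) (at_right 1)" "(\<Theta> \<longlongrightarrow> L) at_top"
    and int: "set_integrable lborel {0<..} (\<lambda>t. second_diff F 1 t * t powr (- 1 - 2 * s))"
  shows "has_frac_lap s F 1 (L - F 1 / (2 * s))"
proof -
  define f where "f = (\<lambda>t. second_diff F 1 t * t powr (- 1 - 2 * s))"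
  define y where "y = (\<lambda>t. (F (1 + t) - F 1) * t powr (- 1 - 2 * s))"
  have contF: "isCont F z" if "z > 0" for z
    using F(1) that by (simp add: continuous_on_eq_continuous_at)
  have conty: "continuous_on {0<..} y"
    unfolding y_def by (intro continuous_intros continuous_on_compose2[OF F(1)]) auto
  then have isContY: "isCont y t" if "t > 0" for t
    using that by (simp add: continuous_on_eq_continuous_at)
  from conty obtain Y where Y: "\<And>t. t > 0 \<Longrightarrow> (Y has_real_derivative y t) (at t)"
    using antiderivative_positive by blast
  have f_gt1: "f t = y t - F 1 * t powr (- 1 - 2 * s)" if "t > 1" for t
    using that F(2)[of "1 - t"] by (simp add: f_def second_diff_def y_def algebra_simps)
  \<comment> \<open>Beyond t = 1 the value \<open>F (1 - t)\<close> is 0, so y differs from the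
    integrable f only by a convergent power.\<close>
  have inty: "set_integrable lborel {1<..} y"
  proof -
    have "set_integrable lborel {1<..} f"
      by (rule set_integrable_subset[OF int[folded f_def]]) auto
    moreover have "set_integrable lborel {1<..} (\<lambda>t. F 1 * t powr (- 1 - 2 * s))"
      using set_integrable_powr_at_top(1)[of "- 1 - 2 * s" 1] s by (intro set_integrable_mult_right) auto
    ultimately have "set_integrable lborel {1<..} (\<lambda>t. f t + F 1 * t powr (- 1 - 2 * s))"
      by (rule set_integral_add)
    then show ?thesis
      by (rule set_integrable_cong[THEN iffD1, rotated 3]) (auto simp: f_gt1)
  qed
  \<comment> \<open>The limit at infinity enters because t / (1 - t) runs to infinity as t tends to
    1.\<close>
  obtain l where l: "(Y \<longlongrightarrow> l) at_top"
  proof -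
    have "set_integrable lborel {2..} y"
      by (rule set_integrable_subset[OF inty]) auto
    then have "((\<lambda>b. LBINT t:{2..b}. y t) \<longlongrightarrow> (LBINT t:{2..}. y t)) at_top"
      by (intro tendsto_set_lebesgue_integral_at_top) auto
    then have *: "((\<lambda>b. Y 2 + (LBINT t:{2..b}. y t)) \<longlongrightarrow> Y 2 + (LBINT t:{2..}. y t)) at_top"
      by (intro tendsto_intros)
    have YI: "Y b = Y 2 + (LBINT t:{2..b}. y t)" if "b \<ge> 2" for b
    proof -
      have "has_bochner_integral lborel (\<lambda>t. y t * indicator {2..b} t) (Y b - Y 2)"
        using that by (intro has_bochner_integral_FTC_Icc_real Y isContY) auto
      then show ?thesis
        by (simp add: set_lebesgue_integral_def has_bochner_integral_iff mult.commute)
    qed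
    have "eventually (\<lambda>b. Y 2 + (LBINT t:{2..b}. y t) = Y b) at_top"
      by (rule eventually_at_top_linorderI[of 2], rule YI[symmetric])
    with * have "(Y \<longlongrightarrow> Y 2 + (LBINT t:{2..}. y t)) at_top"
      by (rule Lim_transform_eventually)
    then show ?thesis by (rule that)
  qed
  have contf: "isCont f t" if "t > 0" "t \<noteq> 1" for t
  proof -
    have "isCont (\<lambda>t. F (1 - t)) t"
    proof (cases "t < 1")
      case True
      then show ?thesis by (intro isCont_o2[OF _ contF] continuous_intros) auto
    next
      case False
      then have "t > 1" using that by auto
      have "isCont (\<lambda>t::real. 0::real) t" by simp
      then show ?thesis
        by (rule isCont_cong[THEN iffD1, rotated])
           (use \<open>t > 1\<close> in \<open>auto intro!: eventually_mono[OF eventually_nhds_in_open[of "{1<..}"]] simp: F(2)\<close>)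
    qed
    moreover have "isCont (\<lambda>t. F (1 + t)) t"
      using that by (intro isCont_o2[OF _ contF] continuous_intros) auto
    ultimately show ?thesis
      unfolding f_def second_diff_def using that by (intro continuous_intros) auto
  qed
  \<comment> \<open>With z = 1 / (1 - t) one has 1 / z = 1 - t and z - 1 = t / (1 - t). The part of
    the derivative of \<open>\<Theta>\<close> containing F z is therefore cancelled by that of
    \<open>Y (t / (1 - t))\<close>; the part containing F (1 / z) becomes (F (1 - t) - F 1)
    t^(-1-2s), and Y t supplies the missing term with F (1 + t).\<close>
  define R where "R = (\<lambda>t. \<Theta> (1 / (1 - t)) + Y t - Y (t / (1 - t)))"
  have DR: "(R has_real_derivative f t) (at t)" if t: "0 < t" "t < 1" for t
  proof -
    define z where "z = 1 / (1 - t)"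
    have z: "z > 1" "1 / z = 1 - t" "z - 1 = t * z" "t / (1 - t) = t * z" "1 + t * z = z"
      using t by (auto simp: z_def field_simps)
    have zt: "1 / (1 - t) = z" by (simp add: z_def)
    have dz: "((\<lambda>t. 1 / (1 - t)) has_real_derivative z\<^sup>2) (at t)"
      using t by (auto intro!: derivative_eq_intros simp: z_def power2_eq_square)
    have dz': "((\<lambda>t. t / (1 - t)) has_real_derivative z\<^sup>2) (at t)"
      using t by (auto intro!: derivative_eq_intros simp: z_def power2_eq_square field_simps)
    have "((\<lambda>t. \<Theta> (1 / (1 - t))) has_real_derivative
        (z - 1) powr (- 1 - 2 * s) * (F z - F 1 + (F (1 / z) - F 1) * z powr (2 * s - 1)) * z\<^sup>2) (at t)"
      by (rule DERIV_chain2[where f = \<Theta>, OF _ dz], unfold zt, rule \<Theta>[OF z(1)])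
    moreover have "((\<lambda>t. Y (t / (1 - t))) has_real_derivative y (t / (1 - t)) * z\<^sup>2) (at t)"
      by (rule DERIV_chain2[where f = Y, OF _ dz'], rule Y) (use t in auto)
    ultimately have "(R has_real_derivative
        (z - 1) powr (- 1 - 2 * s) * (F z - F 1 + (F (1 / z) - F 1) * z powr (2 * s - 1)) * z\<^sup>2
        + y t - y (t / (1 - t)) * z\<^sup>2) (at t)"
      unfolding R_def by (intro DERIV_add DERIV_diff Y t)
    moreover have yz: "y (t / (1 - t)) = (F z - F 1) * (z - 1) powr (- 1 - 2 * s)"
      by (simp add: y_def z)
    moreover have pw: "(z - 1) powr (- 1 - 2 * s) * z powr (2 * s - 1) * z\<^sup>2 = t powr (- 1 - 2 * s)"
    proof -
      have "(z - 1) powr (- 1 - 2 * s) * z powr (2 * s - 1) * z powr 2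
          = t powr (- 1 - 2 * s) * (z powr (- 1 - 2 * s) * z powr (2 * s - 1) * z powr 2)"
        unfolding z(3) using t z(1) by (simp add: powr_mult)
      also have "z powr (- 1 - 2 * s) * z powr (2 * s - 1) * z powr 2 = 1"
        using z(1) by (simp flip: powr_add) (simp add: powr_minus)
      finally show ?thesis using z(1) by simp
    qed
    moreover have "f t = y t + (F (1 / z) - F 1) * t powr (- 1 - 2 * s)"
      by (simp add: f_def y_def second_diff_def z algebra_simps)
    moreover have "P * (a + b * A) * z\<^sup>2 + y t - a * P * z\<^sup>2 = y t + b * (P * A * z\<^sup>2)" for P A a b
      by (simp add: algebra_simps)
    ultimately show ?thesis
      by metis
  qed
  have R0: "(R \<longlongrightarrow> 0) (at_right 0)"
  proof -
    have "((\<lambda>t. \<Theta> (1 / (1 - t))) \<longlongrightarrow> 0) (at_right 0)"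
    proof (rule filterlim_compose[OF lim(1)])
      show "filterlim (\<lambda>t::real. 1 / (1 - t)) (at_right 1) (at_right 0)"
        by real_asymp
    qed
    \<comment> \<open>Y alone may blow up at 0, since y is only O(t^(-2s)). The two arguments differ
      by at most 2 t^2, which makes the difference of the values O(t^(2-2s)).\<close>
    moreover have "((\<lambda>t. Y t - Y (t / (1 - t))) \<longlongrightarrow> 0) (at_right 0)"
    proof (rule Lim_null_comparison)
      show "((\<lambda>t. 2 * \<bar>M\<bar> * t powr (2 - 2 * s)) \<longlongrightarrow> 0) (at_right 0)"
        using s by real_asymp
      have "norm (Y t - Y (t / (1 - t))) \<le> 2 * \<bar>M\<bar> * t powr (2 - 2 * s)" if t: "0 < t" "t < 1 / 2" for t
      proof -
        have tt: "t < t / (1 - t)" "t / (1 - t) \<le> 1" "t / (1 - t) - t \<le> 2 * t\<^sup>2"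
          using t by (auto simp: field_simps power2_eq_square)
        have "\<exists>\<xi>. t < \<xi> \<and> \<xi> < t / (1 - t) \<and> Y (t / (1 - t)) - Y t = (t / (1 - t) - t) * y \<xi>"
          by (rule MVT2) (use t tt in \<open>auto intro!: Y\<close>)
        then obtain \<xi> where \<xi>: "t < \<xi>" "\<xi> < t / (1 - t)" "Y (t / (1 - t)) - Y t = (t / (1 - t) - t) * y \<xi>"
          by blast
        have "\<bar>y \<xi>\<bar> \<le> \<bar>M\<bar> * \<xi> * \<xi> powr (- 1 - 2 * s)"
        proof -
          have "\<bar>F (1 + \<xi>) - F 1\<bar> \<le> M * \<xi>" using M[of "1 + \<xi>"] \<xi> t tt by auto
          also have "\<dots> \<le> \<bar>M\<bar> * \<xi>" using \<xi> t by (intro mult_right_mono) auto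
          finally show ?thesis unfolding y_def by (auto simp: abs_mult intro!: mult_right_mono)
        qed
        also have "\<dots> = \<bar>M\<bar> * \<xi> powr (- 2 * s)"
          using \<xi> t by (simp add: powr_diff powr_minus field_simps)
        also have "\<dots> \<le> \<bar>M\<bar> * t powr (- 2 * s)"
          using \<xi> t s by (intro mult_left_mono powr_mono2') auto
        finally have "norm (Y t - Y (t / (1 - t))) \<le> 2 * t\<^sup>2 * (\<bar>M\<bar> * t powr (- 2 * s))"
          using \<xi> tt by (subst norm_minus_commute) (auto simp: abs_mult intro!: mult_mono)
        also have "\<dots> = 2 * \<bar>M\<bar> * (t powr 2 * t powr (- 2 * s))"
          using t by simp
        also have "t powr 2 * t powr (- 2 * s) = t powr (2 - 2 * s)"
          by (simp flip: powr_add)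
        finally show ?thesis .
      qed
      then show "\<forall>\<^sub>F t in at_right 0. norm (Y t - Y (t / (1 - t))) \<le> 2 * \<bar>M\<bar> * t powr (2 - 2 * s)"
        by (intro eventually_at_rightI[of 0 "1/2"]) auto
    qed
    ultimately have "((\<lambda>t. \<Theta> (1 / (1 - t)) + (Y t - Y (t / (1 - t)))) \<longlongrightarrow> 0 + 0) (at_right 0)"
      by (rule tendsto_add)
    then show ?thesis by (simp add: R_def algebra_simps)
  qed
  have R1: "(R \<longlongrightarrow> L + Y 1 - l) (at_left 1)"
  proof -
    have "((\<lambda>t. \<Theta> (1 / (1 - t))) \<longlongrightarrow> L) (at_left 1)"
      by (rule filterlim_compose[OF lim(2)]) real_asymp
    moreover have "((\<lambda>t. Y (t / (1 - t))) \<longlongrightarrow> l) (at_left 1)"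
      by (rule filterlim_compose[OF l]) real_asymp
    moreover have "(Y \<longlongrightarrow> Y 1) (at_left 1)"
      using DERIV_isCont[OF Y[of 1]] unfolding isCont_def by (simp add: filterlim_at_split)
    ultimately show ?thesis unfolding R_def by (intro tendsto_intros)
  qed
  have int1: "(LBINT t=ereal 0..ereal 1. f t) = (L + Y 1 - l) - 0"
    by (rule interval_integral_FTC_integrable[where F = R])
      (use DR R0 R1 contf in \<open>auto simp: ereal_tendsto_simps
        has_real_derivative_iff_has_vector_derivative[symmetric]
        intro!: set_integrable_subset[OF int[folded f_def]] simp: einterval_def\<close>)
  \<comment> \<open>Here the integrand is y minus F 1 times a power. The unknown numbers Y 1 and l
    cancel against those in \<open>int1\<close>, and only the boundary term F 1 / (2s) is left
    over.\<close>
  have int2: "(LBINT t=ereal 1..\<infinity>. f t) = l - (Y 1 + F 1 / (2 * s))"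
  proof (rule interval_integral_FTC_integrable[where F = "\<lambda>t. Y t + F 1 * t powr (- 2 * s) / (2 * s)"])
    show "((\<lambda>t. Y t + F 1 * t powr (- 2 * s) / (2 * s)) has_vector_derivative f t) (at t)"
      if "ereal 1 < ereal t" for t
      unfolding has_real_derivative_iff_has_vector_derivative[symmetric]
      using that s f_gt1[of t] by (auto intro!: derivative_eq_intros Y simp: powr_diff powr_minus field_simps)
    have "isCont (\<lambda>t. Y t + F 1 * t powr (- 2 * s) / (2 * s)) 1"
      using DERIV_isCont[OF Y[of 1]] s by (intro continuous_intros) auto
    then have "((\<lambda>t. Y t + F 1 * t powr (- 2 * s) / (2 * s)) \<longlongrightarrow> Y 1 + F 1 / (2 * s)) (at_right 1)"
      unfolding isCont_def by (simp add: filterlim_at_split)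
    then show "(((\<lambda>t. Y t + F 1 * t powr (- 2 * s) / (2 * s)) \<circ> real_of_ereal) \<longlongrightarrow> Y 1 + F 1 / (2 * s))
       (at_right (ereal 1))"
      by (simp only: ereal_tendsto_simps)
    have "((\<lambda>t. F 1 * t powr (- 2 * s) / (2 * s)) \<longlongrightarrow> 0) at_top"
      using s by real_asymp
    from tendsto_add[OF l this] show "(((\<lambda>t. Y t + F 1 * t powr (- 2 * s) / (2 * s)) \<circ> real_of_ereal) \<longlongrightarrow> l) (at_left \<infinity>)"
      by (simp add: ereal_tendsto_simps)
  qed (use contf in \<open>auto intro!: set_integrable_subset[OF int[folded f_def]] simp: einterval_def\<close>)
  have e: "einterval (ereal 0) \<infinity> = {0<..}" by (auto simp: einterval_def)
  have "(LBINT t=ereal 0..\<infinity>. f t) = (LBINT t=ereal 0..ereal 1. f t) + (LBINT t=ereal 1..\<infinity>. f t)"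
    by (rule interval_integral_sum[symmetric])
       (use int e in \<open>auto simp: interval_lebesgue_integrable_def f_def min_def max_def zero_ereal_def[symmetric]\<close>)
  then have "(LBINT t:{0<..}. f t) = L - F 1 / (2 * s)"
    unfolding int1 int2 by (simp add: interval_lebesgue_integral_def e)
  with int show ?thesis
    by (simp add: has_frac_lap_def has_bochner_integral_iff set_integrable_def set_lebesgue_integral_def f_def)
qed

lemma has_frac_lap_scale:
  assumes x: "x > 0" and F: "has_frac_lap s (\<lambda>z. F (x * z)) 1 v"
  shows "has_frac_lap s F x (x powr (- 2 * s) * v)"
proof -
  have *: "indicator {0<..} (0 + x * t) * (second_diff F x (0 + x * t) * (0 + x * t) powr (- 1 - 2 * s))
      = x powr (- 1 - 2 * s) * (indicator {0<..} t * (second_diff (\<lambda>z. F (x * z)) 1 t * t powr (- 1 - 2 * s)))" for t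
    using x by (cases "t > 0") (auto simp: second_diff_def algebra_simps powr_mult zero_less_mult_iff)
  have "has_bochner_integral lborel (\<lambda>t. x powr (- 1 - 2 * s) *
      (indicator {0<..} t * (second_diff (\<lambda>z. F (x * z)) 1 t * t powr (- 1 - 2 * s)))) (x powr (- 1 - 2 * s) * v)"
    using F unfolding has_frac_lap_def by (rule has_bochner_integral_mult_right)
  also have "x powr (- 1 - 2 * s) * v = (x powr (- 2 * s) * v) /\<^sub>R \<bar>x\<bar>"
    using x by (simp add: powr_diff powr_minus field_simps)
  finally have "has_bochner_integral lborel (\<lambda>t. indicator {0<..} (0 + x * t) *
      (second_diff F x (0 + x * t) * (0 + x * t) powr (- 1 - 2 * s))) ((x powr (- 2 * s) * v) /\<^sub>R \<bar>x\<bar>)"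
    unfolding * .
  then show ?thesis
    unfolding has_frac_lap_def
    using lborel_has_bochner_integral_real_affine_iff[of x _ "x powr (- 2 * s) * v" 0] x by blast
qed

lemma has_frac_lap_cmult:
  assumes "has_frac_lap s F x v"
  shows "has_frac_lap s (\<lambda>z. c * F z) x (c * v)"
proof -
  have *: "indicator {0<..} t * (second_diff (\<lambda>z. c * F z) x t * t powr (- 1 - 2 * s))
      = c * (indicator {0<..} t * (second_diff F x t * t powr (- 1 - 2 * s)))" for t
    by (simp add: second_diff_def algebra_simps)
  show ?thesis
    unfolding has_frac_lap_def *
    by (rule has_bochner_integral_mult_right[OF assms[unfolded has_frac_lap_def]])
qed

lemma has_frac_lap_add:
  assumes "has_frac_lap s F x v" "has_frac_lap s G x w"
  shows "has_frac_lap s (\<lambda>z. F z + G z) x (v + w)"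
proof -
  have "indicator {0<..} t * (second_diff (\<lambda>z. F z + G z) x t * t powr (- 1 - 2 * s))
      = indicator {0<..} t * (second_diff F x t * t powr (- 1 - 2 * s))
        + indicator {0<..} t * (second_diff G x t * t powr (- 1 - 2 * s))" for t
    by (simp add: second_diff_def algebra_simps)
  then show ?thesis
    unfolding has_frac_lap_def using has_bochner_integral_add[OF assms[unfolded has_frac_lap_def]] by simp
qed

text \<open>The quadratic bound becomes t^(1-2s), integrable at 0 because s < 1. The far bound is
  left as a function: it is a power in some uses and has a singularity at t = x in the case of the
  Poisson kernel. The majorant is stated separately from the functions it dominates because
  superpositions need one majorant for a whole family.\<close>

lemma set_integrable_frac_dominant:
  fixes M r s :: real
  assumes "s < 1" "r > 0" and B: "set_integrable lborel {r..} (\<lambda>t. B t * t powr (- 1 - 2 * s))"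
  shows "set_integrable lborel {0<..} (\<lambda>t. (if t < r then M * t\<^sup>2 else B t) * t powr (- 1 - 2 * s))"
proof -
  have "set_integrable lborel {0<..<r} (\<lambda>t. M * t powr (1 - 2 * s))"
    using assms by (intro set_integrable_mult_right set_integrable_powr_at_0) auto
  then have "set_integrable lborel {0<..<r} (\<lambda>t. (if t < r then M * t\<^sup>2 else B t) * t powr (- 1 - 2 * s))"
  proof (rule set_integrable_cong[THEN iffD1, rotated 3])
    fix t assume "t \<in> {0<..<r}"
    then have "t powr (1 - 2 * s) = t powr 2 * t powr (- 1 - 2 * s)"
      by (simp only: powr_add[symmetric]) simp
    then show "M * t powr (1 - 2 * s) = (if t < r then M * t\<^sup>2 else B t) * t powr (- 1 - 2 * s)"
      using \<open>t \<in> {0<..<r}\<close> by simp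
  qed auto
  moreover have "set_integrable lborel {r..} (\<lambda>t. (if t < r then M * t\<^sup>2 else B t) * t powr (- 1 - 2 * s))"
    using B by (rule set_integrable_cong[THEN iffD1, rotated 3]) auto
  ultimately have "set_integrable lborel ({0<..<r} \<union> {r..}) (\<lambda>t. (if t < r then M * t\<^sup>2 else B t) * t powr (- 1 - 2 * s))"
    by (rule set_integrable_Un) auto
  also have "{0<..<r} \<union> {r..} = {0<..}" using \<open>r > 0\<close> by auto
  finally show ?thesis .
qed

lemma set_integrable_second_diff:
  fixes M r s :: real
  assumes "s < 1" "r > 0" and F[measurable]: "F \<in> borel_measurable borel"
    and near: "\<And>t. 0 < t \<Longrightarrow> t < r \<Longrightarrow> \<bar>second_diff F x t\<bar> \<le> M * t\<^sup>2"
    and far: "\<And>t. t \<ge> r \<Longrightarrow> \<bar>second_diff F x t\<bar> \<le> B t"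
    and B: "set_integrable lborel {r..} (\<lambda>t. B t * t powr (- 1 - 2 * s))"
  shows "set_integrable lborel {0<..} (\<lambda>t. second_diff F x t * t powr (- 1 - 2 * s))"
proof (rule set_integrable_bound[OF set_integrable_frac_dominant[OF assms(1,2) B, of M]])
  show "set_borel_measurable lborel {0<..} (\<lambda>t. second_diff F x t * t powr (- 1 - 2 * s))"
    unfolding set_borel_measurable_def second_diff_def by measurable
  show "AE t in lborel. t \<in> {0<..} \<longrightarrow> norm (second_diff F x t * t powr (- 1 - 2 * s))
      \<le> norm ((if t < r then M * t\<^sup>2 else B t) * t powr (- 1 - 2 * s))"
  proof (intro AE_I2 impI)
    fix t :: real assume "t \<in> {0<..}"
    then have "\<bar>second_diff F x t\<bar> \<le> \<bar>if t < r then M * t\<^sup>2 else B t\<bar>"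
      using near[of t] far[of t] by auto
    then show "norm (second_diff F x t * t powr (- 1 - 2 * s))
      \<le> norm ((if t < r then M * t\<^sup>2 else B t) * t powr (- 1 - 2 * s))"
      unfolding real_norm_def abs_mult by (rule mult_right_mono) simp
  qed
qed

section \<open>The positive part to the power s is harmonic\<close>

definition pos_powr :: "real \<Rightarrow> real \<Rightarrow> real" where
  "pos_powr s z = (max z 0) powr s"

text \<open>Since \<open>0 powr s = 0\<close> for every exponent, the function vanishes on the
  closed negative half-line also for the negative exponents that occur in its derivatives.\<close>

lemma pos_powr_pos: "z > 0 \<Longrightarrow> pos_powr s z = z powr s"
  and pos_powr_neg: "z \<le> 0 \<Longrightarrow> pos_powr s z = 0"
  and pos_powr_nonneg: "pos_powr s z \<ge> 0"
  by (auto simp: pos_powr_def max_def)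

lemma pos_powr_mono: "s \<ge> 0 \<Longrightarrow> z \<le> w \<Longrightarrow> pos_powr s z \<le> pos_powr s w"
  unfolding pos_powr_def by (intro powr_mono2) auto

lemma continuous_pos_powr: "s > 0 \<Longrightarrow> continuous_on UNIV (pos_powr s)"
  unfolding pos_powr_def by (intro continuous_on_powr' continuous_intros) auto

lemma measurable_pos_powr[measurable]: "pos_powr s \<in> borel_measurable borel"
  unfolding pos_powr_def by measurable

lemma DERIV_pos_powr:
  "z > 0 \<Longrightarrow> (pos_powr s has_real_derivative s * pos_powr (s - 1) z) (at z)"
proof -
  assume z: "z > 0"
  have "((\<lambda>z. z powr s) has_real_derivative s * z powr (s - 1)) (at z)"
    using z by (auto intro!: derivative_eq_intros)
  then have "(pos_powr s has_real_derivative s * z powr (s - 1)) (at z)"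
    by (rule has_field_derivative_transform_within_open[where S = "{0<..}"]) (use z in \<open>auto simp: pos_powr_pos\<close>)
  with z show ?thesis by (simp add: pos_powr_pos)
qed

text \<open>The base point x may be anything above x0, so that the same bound holds for all right
  translates; the companion for large t also needs an upper bound x1 for the base point.\<close>

lemma second_diff_pos_powr_near:
  assumes s: "0 < s" "s < 1" and x: "0 < x0" "x0 \<le> x" and t: "0 < t" "t < x0 / 2"
  shows "\<bar>second_diff (pos_powr s) x t\<bar> \<le> 2 * (x0 / 2) powr (s - 2) * t\<^sup>2"
proof (rule second_diff_bound[where r = "x0 / 2" and F' = "\<lambda>z. s * pos_powr (s - 1) z"
      and F'' = "\<lambda>z. s * ((s - 1) * pos_powr (s - 1 - 1) z)"])
  fix z assume "\<bar>z - x\<bar> < x0 / 2"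
  then have z: "z > x0 / 2" using x by (auto simp: abs_if field_simps split: if_splits)
  then have z0: "z > 0" using x by auto
  show "(pos_powr s has_real_derivative s * pos_powr (s - 1) z) (at z)"
    by (rule DERIV_pos_powr[OF z0])
  show "((\<lambda>z. s * pos_powr (s - 1) z) has_real_derivative s * ((s - 1) * pos_powr (s - 1 - 1) z)) (at z)"
    by (intro DERIV_cmult DERIV_pos_powr z0)
  have "\<bar>s * ((s - 1) * pos_powr (s - 1 - 1) z)\<bar> = (s * \<bar>s - 1\<bar>) * z powr (s - 2)"
    using s z0 by (simp add: abs_mult pos_powr_pos)
  also have "\<dots> \<le> 1 * (x0 / 2) powr (s - 2)"
    using s z x by (intro mult_mono powr_mono2' mult_le_one) auto
  finally show "\<bar>s * ((s - 1) * pos_powr (s - 1 - 1) z)\<bar> \<le> (x0 / 2) powr (s - 2)" by simp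
qed (use t in auto)

lemma second_diff_pos_powr_far:
  assumes s: "0 < s" "s < 1" and x: "0 < x0" "x0 \<le> x" "x \<le> x1" and t: "t \<ge> x0 / 2"
  shows "\<bar>second_diff (pos_powr s) x t\<bar> \<le> 4 * (2 * x1 / x0 + 1) powr s * t powr s"
proof -
  have "x1 \<le> (2 * x1 / x0) * t"
    using x t mult_left_mono[OF t, of "2 * x1 / x0"] by (simp add: field_simps)
  then have *: "x + t \<le> (2 * x1 / x0 + 1) * t" using x by (simp add: algebra_simps)
  have "pos_powr s (x + t) \<le> ((2 * x1 / x0 + 1) * t) powr s"
    using * x t s by (subst pos_powr_pos) (auto intro!: powr_mono2)
  also have "\<dots> = (2 * x1 / x0 + 1) powr s * t powr s"
    using x t by (intro powr_mult)
  finally have 1: "pos_powr s (x + t) \<le> (2 * x1 / x0 + 1) powr s * t powr s" .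
  have "pos_powr s (x - t) \<le> pos_powr s (x + t)" "pos_powr s x \<le> pos_powr s (x + t)"
    using s x t by (auto intro!: pos_powr_mono)
  with 1 pos_powr_nonneg[of s "x + t"] pos_powr_nonneg[of s "x - t"] pos_powr_nonneg[of s x]
  show ?thesis unfolding second_diff_def by (simp add: abs_le_iff)
qed

lemma set_integrable_powr_at_top':
  "a < - 1 \<Longrightarrow> p > 0 \<Longrightarrow> set_integrable lborel {p..} (\<lambda>t::real. t powr a)"
  by (rule set_integrable_subset[OF set_integrable_powr_at_top(1)[of a "p / 2"]]) auto

lemma set_integrable_far_powr:
  assumes "s > (0::real)" "p > 0"
  shows "set_integrable lborel {p..} (\<lambda>t. c * t powr s * t powr (- 1 - 2 * s))"
proof -
  have "c * t powr s * t powr (- 1 - 2 * s) = c * t powr (- 1 - s)" for t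
    by (simp only: mult.assoc powr_add[symmetric]) (rule arg_cong[of _ _ "\<lambda>e. c * t powr e"], simp)
  then show ?thesis
    using assms by (simp only:) (intro set_integrable_mult_right set_integrable_powr_at_top', auto)
qed

text \<open>For F = z_+^s the folded integrand is (z - 1)^(-1-2s) (z^s - 1 + z^(s-1) - z^(2s-1)),
  and the last factor splits as (z^s - 1)(1 - z^(s-1)). This function is the primitive that the
  factorization suggests.\<close>

definition mobius_prim :: "real \<Rightarrow> real \<Rightarrow> real" where
  "mobius_prim s z = (z - 1) powr (- 2 * s) * (z powr s - 1)\<^sup>2 / (2 * s)"

lemma DERIV_mobius_prim:
  assumes s: "s > 0" and z: "z > 1"
  shows "(mobius_prim s has_real_derivative (z - 1) powr (- 1 - 2 * s) *
    (z powr s - 1 + (1 / z powr s - 1) * (z powr s * z powr s / z))) (at z)"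
proof -
  have d1: "((\<lambda>z. (z - 1) powr (- 2 * s)) has_real_derivative (- 2 * s) * (z - 1) powr (- 2 * s - 1)) (at z)"
    using z DERIV_fun_powr[of "\<lambda>z. z - 1" 1 z "- 2 * s"] by (simp add: DERIV_diff[where E = 0, simplified])
  have d2: "((\<lambda>z. (z powr s - 1)\<^sup>2) has_real_derivative 2 * (z powr s - 1) * (s * z powr (s - 1))) (at z)"
  proof -
    have "((\<lambda>z. z powr s - 1) has_real_derivative s * z powr (s - 1) - 0) (at z)"
      using z by (intro DERIV_diff has_real_derivative_powr) auto
    from DERIV_power[OF this, of 2] show ?thesis by (rule DERIV_cong) simp
  qed
  have D: "(mobius_prim s has_real_derivative
      ((- 2 * s) * (z - 1) powr (- 2 * s - 1) * (z powr s - 1)\<^sup>2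
        + (z - 1) powr (- 2 * s) * (2 * (z powr s - 1) * (s * z powr (s - 1)))) / (2 * s)) (at z)"
    unfolding mobius_prim_def by (rule DERIV_cdivide, rule DERIV_cong, rule DERIV_mult[OF d1 d2]) (simp add: algebra_simps)
  define a where "a = z powr s"
  define Q where "Q = (z - 1) powr (- 1 - 2 * s)"
  have a: "a > 0" using z by (simp add: a_def)
  have 1: "(z - 1) powr (- 2 * s - 1) = Q"
    unfolding Q_def by (rule arg_cong[of _ _ "\<lambda>e. (z - 1) powr e"]) simp
  have 2: "(z - 1) powr (- 2 * s) = Q * (z - 1)"
    using z powr_add[of "z - 1" "- 1 - 2 * s" 1] by (simp add: Q_def)
  have 3: "z powr (s - 1) = a / z"
    using z by (simp add: a_def powr_diff)
  show ?thesis
    using D unfolding 1 2 3 Q_def[symmetric] a_def[symmetric]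
    by (rule DERIV_cong) (use a s z in \<open>simp add: field_simps power2_eq_square\<close>)
qed

lemma mobius_prim_lim_1:
  assumes s: "0 < s" "s < 1"
  shows "(mobius_prim s \<longlongrightarrow> 0) (at_right 1)"
  proof (rule Lim_null_comparison)
    show "((\<lambda>z. (z - 1) powr (2 - 2 * s) / (2 * s)) \<longlongrightarrow> 0) (at_right 1)"
      using s by real_asymp
    have "norm (mobius_prim s z) \<le> (z - 1) powr (2 - 2 * s) / (2 * s)" if z: "z > 1" for z
    proof -
      have "z powr s \<le> z" "1 \<le> z powr s"
        using z s powr_mono[of s 1 z] ge_one_powr_ge_zero[of z s] by auto
      then have "(z powr s - 1)\<^sup>2 \<le> (z - 1)\<^sup>2" by (intro power_mono) auto
      then have "(z - 1) powr (- 2 * s) * (z powr s - 1)\<^sup>2 \<le> (z - 1) powr (- 2 * s) * (z - 1) powr 2"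
        using z by (intro mult_left_mono) auto
      also have "\<dots> = (z - 1) powr (2 - 2 * s)"
        by (simp flip: powr_add)
      finally show ?thesis unfolding mobius_prim_def using s by (simp add: divide_right_mono)
    qed
    then show "\<forall>\<^sub>F z in at_right 1. norm (mobius_prim s z) \<le> (z - 1) powr (2 - 2 * s) / (2 * s)"
      by (intro eventually_at_rightI[of 1 2]) auto
  qed

lemma mobius_prim_lim_top:
  assumes s: "0 < s"
  shows "(mobius_prim s \<longlongrightarrow> 1 / (2 * s)) at_top"
proof -
  have "((\<lambda>z::real. (z / (z - 1)) powr (2 * s) * (1 - z powr (- s))\<^sup>2 / (2 * s)) \<longlongrightarrow> 1 powr (2 * s) * (1 - 0)\<^sup>2 / (2 * s)) at_top"
  proof (intro tendsto_intros)
    show "((\<lambda>z::real. z / (z - 1)) \<longlongrightarrow> 1) at_top" by real_asymp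
    show "((\<lambda>z::real. z powr (- s)) \<longlongrightarrow> 0) at_top" using s by real_asymp
  qed (use s in auto)
  moreover have "(z / (z - 1)) powr (2 * s) * (1 - z powr (- s))\<^sup>2 / (2 * s) = mobius_prim s z" if z: "z > 1" for z
  proof -
    have "(z powr s)\<^sup>2 = z powr (2 * s)" using z by (simp add: power2_eq_square flip: powr_add)
    moreover have "z powr s - 1 = z powr s * (1 - z powr (- s))"
      using z by (simp add: powr_minus field_simps)
    ultimately have "(z powr s - 1)\<^sup>2 = z powr (2 * s) * (1 - z powr (- s))\<^sup>2"
      by (simp add: power_mult_distrib)
    then show ?thesis
      unfolding mobius_prim_def using z s by (simp add: powr_divide powr_minus divide_simps)
  qed
  then have "\<forall>\<^sub>F z in at_top. (z / (z - 1)) powr (2 * s) * (1 - z powr (- s))\<^sup>2 / (2 * s) = mobius_prim s z"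
    by (intro eventually_at_top_linorderI[of 2]) simp
  ultimately show ?thesis
    using Lim_transform_eventually by fastforce
qed

text \<open>At the point 1 the limit 1 / (2s) of \<open>mobius_prim\<close> at infinity cancels the
  term F 1 / (2s) left by the folding. Homogeneity carries the value 0 to every other x > 0.\<close>

theorem has_frac_lap_pos_powr:
  assumes s: "0 < s" "s < 1" and x: "x > 0"
  shows "has_frac_lap s (pos_powr s) x 0"
proof -
  have "has_frac_lap s (pos_powr s) 1 (1 / (2 * s) - pos_powr s 1 / (2 * s))"
  proof (rule has_frac_lap_mobius[OF s, where \<Theta> = "mobius_prim s" and M = 1])
    show "continuous_on {0<..} (pos_powr s)"
      using continuous_pos_powr[OF s(1)] by (rule continuous_on_subset) auto
    show "\<bar>pos_powr s z - pos_powr s 1\<bar> \<le> 1 * (z - 1)" if "1 < z" "z < 2" for z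
    proof -
      have "z powr s \<le> z powr 1" "1 \<le> z powr s"
        using that s powr_mono[of s 1 z] ge_one_powr_ge_zero[of z s] by auto
      then show ?thesis using that by (simp add: pos_powr_pos)
    qed
    show "(mobius_prim s has_real_derivative (z - 1) powr (- 1 - 2 * s) * (pos_powr s z - pos_powr s 1
        + (pos_powr s (1 / z) - pos_powr s 1) * z powr (2 * s - 1))) (at z)" if z: "z > 1" for z
    proof -
      have 1: "pos_powr s z = z powr s" "pos_powr s 1 = 1" "pos_powr s (1 / z) = 1 / z powr s"
        using z by (simp_all add: pos_powr_pos powr_divide)
      have 2: "z powr (2 * s - 1) = z powr s * z powr s / z"
        using z by (simp add: powr_diff flip: powr_add)
      show ?thesis
        unfolding 1 2 by (rule DERIV_mobius_prim[OF s(1) z])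
    qed
    show "(mobius_prim s \<longlongrightarrow> 0) (at_right 1)" "(mobius_prim s \<longlongrightarrow> 1 / (2 * s)) at_top"
      using s by (auto intro: mobius_prim_lim_1 mobius_prim_lim_top)
    show "set_integrable lborel {0<..} (\<lambda>t. second_diff (pos_powr s) 1 t * t powr (- 1 - 2 * s))"
    proof (rule set_integrable_second_diff[where r = "1/2"])
      show "\<bar>second_diff (pos_powr s) 1 t\<bar> \<le> 2 * (1 / 2) powr (s - 2) * t\<^sup>2" if "0 < t" "t < 1 / 2" for t
        using second_diff_pos_powr_near[OF s, of 1 1 t] that by simp
      show "\<bar>second_diff (pos_powr s) 1 t\<bar> \<le> 4 * (2 * 1 / 1 + 1) powr s * t powr s" if "1 / 2 \<le> t" for t
        using second_diff_pos_powr_far[OF s, of 1 1 1 t] that by simp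
    qed (use s in \<open>auto intro!: set_integrable_far_powr\<close>)
  qed (auto simp: pos_powr_neg)
  then have 0: "has_frac_lap s (pos_powr s) 1 0" by (simp add: pos_powr_pos)
  have 1: "(\<lambda>z. x powr s * pos_powr s z) = (\<lambda>z. pos_powr s (x * z))"
  proof
    show "x powr s * pos_powr s z = pos_powr s (x * z)" for z
      using x by (cases "z > 0") (simp_all add: pos_powr_pos pos_powr_neg powr_mult mult_le_0_iff)
  qed
  have "has_frac_lap s (\<lambda>z. pos_powr s (x * z)) 1 0"
    using has_frac_lap_cmult[OF 0, of "x powr s"] unfolding 1 by simp
  from has_frac_lap_scale[OF x this] show ?thesis by simp
qed

section \<open>The Poisson kernel of the half-line\<close>

text \<open>Integrability up to both ends allows the primitive to be normalized by its limit at 0;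
  its limit at infinity is then the whole integral. It serves to be composed with a substitution
  that sweeps the half-line.\<close>

lemma improper_primitive:
  fixes f :: "real \<Rightarrow> real"
  assumes cont: "continuous_on {0<..} f" and int: "set_integrable lborel {0<..} f"
  obtains B where "\<And>t. t > 0 \<Longrightarrow> (B has_real_derivative f t) (at t)"
    "(B \<longlongrightarrow> 0) (at_right 0)" "(B \<longlongrightarrow> (LBINT t:{0<..}. f t)) at_top"
proof -
  obtain Y where Y: "\<And>t. t > 0 \<Longrightarrow> (Y has_real_derivative f t) (at t)"
    using antiderivative_positive[OF cont] by blast
  have FTC: "Y b - Y a = (LBINT t:{a..b}. f t)" if "0 < a" "a \<le> b" for a b
  proof -
    have "has_bochner_integral lborel (\<lambda>t. f t * indicator {a..b} t) (Y b - Y a)"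
      using that cont by (intro has_bochner_integral_FTC_Icc_real Y)
        (auto simp: continuous_on_eq_continuous_at)
    then show ?thesis
      by (simp add: set_lebesgue_integral_def has_bochner_integral_iff mult.commute)
  qed
  have i1: "set_integrable lborel {0<..1} f" and i2: "set_integrable lborel {1..} f"
    by (rule set_integrable_subset[OF int]; auto)+
  define l0 where "l0 = Y 1 - (LBINT t:{0<..1}. f t)"
  have "((\<lambda>a. LBINT t:{a..1}. f t) \<longlongrightarrow> (LBINT t:{0<..1}. f t)) (at_right 0)"
    using i1 by (intro tendsto_set_lebesgue_integral_at_right) auto
  then have "((\<lambda>a. Y 1 - (LBINT t:{a..1}. f t)) \<longlongrightarrow> l0) (at_right 0)"
    unfolding l0_def by (intro tendsto_intros)
  moreover have "\<forall>\<^sub>F a in at_right 0. Y 1 - (LBINT t:{a..1}. f t) = Y a"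
    by (rule eventually_at_rightI[of 0 1]) (use FTC[of _ 1] in force)+
  ultimately have Y0: "(Y \<longlongrightarrow> l0) (at_right 0)"
    by (rule Lim_transform_eventually)
  have "((\<lambda>b. LBINT t:{1..b}. f t) \<longlongrightarrow> (LBINT t:{1..}. f t)) at_top"
    using i2 by (intro tendsto_set_lebesgue_integral_at_top) auto
  then have "((\<lambda>b. Y 1 + (LBINT t:{1..b}. f t)) \<longlongrightarrow> Y 1 + (LBINT t:{1..}. f t)) at_top"
    by (intro tendsto_intros)
  moreover have "\<forall>\<^sub>F b in at_top. Y 1 + (LBINT t:{1..b}. f t) = Y b"
    by (rule eventually_at_top_linorderI[of 1]) (use FTC[of 1] in force)
  ultimately have Y1: "(Y \<longlongrightarrow> Y 1 + (LBINT t:{1..}. f t)) at_top"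
    by (rule Lim_transform_eventually)
  have "(LBINT t:{0<..1} \<union> {1..}. f t) = (LBINT t:{0<..1}. f t) + (LBINT t:{1..}. f t)"
    by (rule set_integral_Un_AE) (use i1 i2 in \<open>auto intro!: AE_I[of _ _ "{1}"]\<close>)
  moreover have "{0<..1} \<union> {1..} = {0::real<..}" by auto
  ultimately have sum: "(LBINT t:{0<..}. f t) = (LBINT t:{0<..1}. f t) + (LBINT t:{1..}. f t)"
    by simp
  show ?thesis
  proof (rule that[of "\<lambda>t. Y t - l0"])
    show "((\<lambda>t. Y t - l0) has_real_derivative f t) (at t)" if "t > 0" for t
      using DERIV_diff[OF Y[OF that] DERIV_const[of l0]] by simp
    show "((\<lambda>t. Y t - l0) \<longlongrightarrow> 0) (at_right 0)"
      using tendsto_diff[OF Y0 tendsto_const[of l0]] by simp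
    show "((\<lambda>t. Y t - l0) \<longlongrightarrow> (LBINT t:{0<..}. f t)) at_top"
      using tendsto_diff[OF Y1 tendsto_const[of l0]] unfolding sum l0_def by (simp add: add.commute)
  qed
qed

text \<open>Classically equal to pi / sin (pi s). The integral form is the total mass of the
  rescaled Poisson kernel, and beyond that only its positivity matters.\<close>

definition poisson_const :: "real \<Rightarrow> real" where
  "poisson_const s = (LBINT t:{0<..}. t powr (- s) / (1 + t))"

lemma set_integrable_poisson_const:
  assumes s: "0 < s" "s < 1"
  shows "set_integrable lborel {0<..} (\<lambda>t::real. t powr (- s) / (1 + t))"
proof -
  have m: "set_borel_measurable lborel A (\<lambda>t::real. t powr (- s) / (1 + t))" if "A \<in> sets borel" for A
    using that unfolding set_borel_measurable_def by measurable
  have "set_integrable lborel {0<..<1} (\<lambda>t. t powr (- s) / (1 + t))"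
  proof (rule set_integrable_bound[OF set_integrable_powr_at_0[of "- s" 1]])
    show "AE t in lborel. t \<in> {0<..<1} \<longrightarrow> norm (t powr (- s) / (1 + t)) \<le> norm (t powr (- s))"
      by (intro AE_I2) (auto simp: field_simps)
  qed (use s m in auto)
  moreover have "set_integrable lborel {1..} (\<lambda>t. t powr (- s) / (1 + t))"
  proof (rule set_integrable_bound[OF set_integrable_powr_at_top'[of "- s - 1" 1]])
    show "AE t in lborel. t \<in> {1..} \<longrightarrow> norm (t powr (- s) / (1 + t)) \<le> norm (t powr (- s - 1))"
    proof (intro AE_I2 impI)
      fix t :: real assume t: "t \<in> {1..}"
      then have "t powr (- s) / (1 + t) \<le> t powr (- s) / t" by (intro divide_left_mono) auto
      with t show "norm (t powr (- s) / (1 + t)) \<le> norm (t powr (- s - 1))"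
        by (simp add: powr_diff)
    qed
  qed (use s m in auto)
  ultimately have "set_integrable lborel ({0<..<1} \<union> {1..}) (\<lambda>t. t powr (- s) / (1 + t))"
    by (rule set_integrable_Un) auto
  also have "{0<..<1} \<union> {1..} = {0::real<..}" by auto
  finally show ?thesis .
qed

lemma poisson_const_pos:
  assumes s: "0 < s" "s < 1"
  shows "poisson_const s > 0"
proof -
  have "(LBINT t:{1..2::real}. 1 / 6) \<le> (LBINT t:{1..2::real}. t powr (- s) / (1 + t))"
  proof (rule set_integral_mono)
    show "set_integrable lborel {1..2} (\<lambda>t. t powr (- s) / (1 + t))"
      by (rule set_integrable_subset[OF set_integrable_poisson_const[OF s]]) auto
    show "1 / 6 \<le> t powr (- s) / (1 + t)" if "t \<in> {1..2}" for t :: real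
    proof -
      have "1 / 2 \<le> 1 / t" using that by (auto simp: field_simps)
      also have "1 / t = t powr (- 1)" using that by (simp add: powr_minus field_simps)
      also have "\<dots> \<le> t powr (- s)" using that s by (intro powr_mono) auto
      finally have "1 / 2 / 3 \<le> t powr (- s) / (1 + t)" using that by (intro frac_le) auto
      then show ?thesis by simp
    qed
  qed (auto simp: set_integrable_def)
  also have "\<dots> \<le> poisson_const s"
    unfolding poisson_const_def set_lebesgue_integral_def
  proof (rule integral_mono)
    show "integrable lborel (\<lambda>t. indicator {1..2} t *\<^sub>R (t powr (- s) / (1 + t)))"
      unfolding set_integrable_def[symmetric]
      by (rule set_integrable_subset[OF set_integrable_poisson_const[OF s]]) auto
  qed (use set_integrable_poisson_const[OF s] in \<open>auto simp: set_integrable_def indicator_def\<close>)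
  finally show ?thesis by (simp add: set_lebesgue_integral_def)
qed

text \<open>The Poisson kernel of the half-line with pole at the exterior point -y is (z / y)^s / (z
  + y), up to the factor 1 / \<open>poisson_const s\<close>. The factors depending on y alone are
  moved into the weight of \<open>poisson_int\<close>, which leaves a function bounded uniformly in
  y.\<close>

definition poisson_ker :: "real \<Rightarrow> real \<Rightarrow> real \<Rightarrow> real" where
  "poisson_ker s y z = pos_powr s z / (z + y)"

lemma measurable_poisson_ker[measurable]: "poisson_ker s y \<in> borel_measurable borel"
  unfolding poisson_ker_def by measurable

definition poisson_ker' :: "real \<Rightarrow> real \<Rightarrow> real \<Rightarrow> real" where
  "poisson_ker' s y z = s * pos_powr (s - 1) z / (z + y) - pos_powr s z / (z + y)\<^sup>2"

definition poisson_ker'' :: "real \<Rightarrow> real \<Rightarrow> real \<Rightarrow> real" where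
  "poisson_ker'' s y z = s * ((s - 1) * pos_powr (s - 2) z) / (z + y)
    - 2 * (s * pos_powr (s - 1) z / (z + y)\<^sup>2) + 2 * (pos_powr s z / (z + y) ^ 3)"

lemma DERIV_poisson_ker:
  assumes "z > 0" "y \<ge> 0"
  shows "(poisson_ker s y has_real_derivative poisson_ker' s y z) (at z)"
proof -
  have "((\<lambda>z. pos_powr s z / (z + y)) has_real_derivative
      (s * pos_powr (s - 1) z * (z + y) - pos_powr s z * 1) / ((z + y) * (z + y))) (at z)"
    using assms by (intro DERIV_divide DERIV_pos_powr) (auto intro!: derivative_eq_intros)
  then show ?thesis
    unfolding poisson_ker_def[abs_def] poisson_ker'_def
  proof (rule DERIV_cong)
    define w where "w = z + y"
    have "w > 0" using assms by (simp add: w_def)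
    then show "(s * pos_powr (s - 1) z * (z + y) - pos_powr s z * 1) / ((z + y) * (z + y)) =
        s * pos_powr (s - 1) z / (z + y) - pos_powr s z / (z + y)\<^sup>2"
      unfolding w_def[symmetric] by (simp add: field_simps power2_eq_square)
  qed
qed

lemma DERIV_poisson_ker':
  assumes "z > 0" "y \<ge> 0"
  shows "(poisson_ker' s y has_real_derivative poisson_ker'' s y z) (at z)"
proof -
  have sq: "((\<lambda>z. (z + y)\<^sup>2) has_real_derivative 2 * (z + y)) (at z)"
    by (auto intro!: derivative_eq_intros)
  have "((\<lambda>z. s * pos_powr (s - 1) z / (z + y) - pos_powr s z / (z + y)\<^sup>2) has_real_derivative
      (s * ((s - 1) * pos_powr (s - 1 - 1) z) * (z + y) - s * pos_powr (s - 1) z * 1) / ((z + y) * (z + y))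
      - (s * pos_powr (s - 1) z * (z + y)\<^sup>2 - pos_powr s z * (2 * (z + y))) / ((z + y)\<^sup>2 * (z + y)\<^sup>2)) (at z)"
    using assms by (intro DERIV_diff DERIV_divide DERIV_cmult DERIV_pos_powr sq) (auto intro!: derivative_eq_intros)
  moreover have "s - 1 - 1 = s - 2" by simp
  moreover have "(s * ((s - 1) * A) * (z + y) - s * B * 1) / ((z + y) * (z + y))
      - (s * B * (z + y)\<^sup>2 - C * (2 * (z + y))) / ((z + y)\<^sup>2 * (z + y)\<^sup>2) =
      s * ((s - 1) * A) / (z + y) - 2 * (s * B / (z + y)\<^sup>2) + 2 * (C / (z + y) ^ 3)" for A B C
  proof -
    define w where "w = z + y"
    have "w > 0" using assms by (simp add: w_def)
    then show ?thesis unfolding w_def[symmetric]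
      by (simp add: field_simps power2_eq_square power3_eq_cube)
  qed
  ultimately show ?thesis
    unfolding poisson_ker'_def[abs_def] poisson_ker''_def by metis
qed

text \<open>Replacing z + y by z in each denominator gives bounds independent of y, as required
  under an integral over y. The constants 2 and 5 = 1 + 2 + 2 count the terms of the two
  derivatives, the factors s and 1 - s being at most 1.\<close>

lemma poisson_ker_bounds:
  assumes s: "0 < s" "s < 1" and z: "z > 0" and y: "y \<ge> 0"
  shows "0 \<le> poisson_ker s y z" "poisson_ker s y z \<le> z powr (s - 1)"
    "\<bar>poisson_ker' s y z\<bar> \<le> 2 * z powr (s - 2)" "\<bar>poisson_ker'' s y z\<bar> \<le> 5 * z powr (s - 3)"
proof -
  define a where "a = z powr s"
  have a: "a > 0" using z by (simp add: a_def)
  have p: "pos_powr s z = a" "pos_powr (s - 1) z = a / z" "pos_powr (s - 2) z = a / z\<^sup>2"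
    "z powr (s - 1) = a / z" "z powr (s - 2) = a / z\<^sup>2" "z powr (s - 3) = a / z ^ 3"
    using z by (simp_all add: a_def pos_powr_pos powr_diff)
  have w: "a / (z + y) \<le> a / z" "a / (z + y)\<^sup>2 \<le> a / z\<^sup>2" "a / (z + y) ^ 3 \<le> a / z ^ 3"
    using z y a by (auto intro!: divide_left_mono power_mono)
  have w0: "0 \<le> a / (z + y)" "0 \<le> a / (z + y)\<^sup>2" "0 \<le> a / (z + y) ^ 3"
    using z y a by auto
  show "0 \<le> poisson_ker s y z" "poisson_ker s y z \<le> z powr (s - 1)"
    unfolding poisson_ker_def p using w w0 by auto
  have 1: "s * (a / z) / (z + y) = s * (a / (z + y)) / z" by simp
  have "s * (a / (z + y)) / z \<le> 1 * (a / z) / z"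
    using s w w0 z by (intro divide_right_mono mult_mono) auto
  moreover have "0 \<le> s * (a / (z + y)) / z"
    using s a z y by (intro divide_nonneg_pos mult_nonneg_nonneg) auto
  ultimately show "\<bar>poisson_ker' s y z\<bar> \<le> 2 * z powr (s - 2)"
    unfolding poisson_ker'_def p 1 using w(2) w0(2) by (simp add: abs_le_iff power2_eq_square)
  have 2: "s * ((s - 1) * (a / z\<^sup>2)) / (z + y) = - (s * (1 - s) * (a / (z + y)) / z\<^sup>2)"
    by (simp add: algebra_simps diff_divide_distrib)
  have "s * (1 - s) * (a / (z + y)) / z\<^sup>2 \<le> 1 * (a / z) / z\<^sup>2"
    using s w w0 z by (intro divide_right_mono mult_mono mult_le_one) auto
  moreover have "0 \<le> s * (1 - s) * (a / (z + y)) / z\<^sup>2"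
    using s a z y by (intro divide_nonneg_pos mult_nonneg_nonneg) auto
  moreover have 3: "s * (a / z) / (z + y)\<^sup>2 = s * (a / (z + y)\<^sup>2) / z" by simp
  moreover have "s * (a / (z + y)\<^sup>2) / z \<le> 1 * (a / z\<^sup>2) / z"
    using s w w0 z by (intro divide_right_mono mult_mono) auto
  moreover have "0 \<le> s * (a / (z + y)\<^sup>2) / z"
    using s a z y by (intro divide_nonneg_pos mult_nonneg_nonneg) auto
  ultimately show "\<bar>poisson_ker'' s y z\<bar> \<le> 5 * z powr (s - 3)"
    unfolding poisson_ker''_def p 2 3 using w(3) w0(3)
    by (simp add: abs_le_iff power2_eq_square power3_eq_cube)
qed

lemma second_diff_poisson_ker_near:
  assumes s: "0 < s" "s < 1" and y: "y \<ge> 0" and t: "0 < t" "t < x / 2"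
  shows "\<bar>second_diff (poisson_ker s y) x t\<bar> \<le> 10 * (x / 2) powr (s - 3) * t\<^sup>2"
proof -
  have "\<bar>second_diff (poisson_ker s y) x t\<bar> \<le> 2 * (5 * (x / 2) powr (s - 3)) * t\<^sup>2"
  proof (rule second_diff_bound[where r = "x / 2" and F' = "poisson_ker' s y" and F'' = "poisson_ker'' s y"])
    fix z assume "\<bar>z - x\<bar> < x / 2"
    then have z: "z > x / 2" by (auto simp: abs_if field_simps split: if_splits)
    then have z0: "z > 0" using t by auto
    show "(poisson_ker s y has_real_derivative poisson_ker' s y z) (at z)"
      "(poisson_ker' s y has_real_derivative poisson_ker'' s y z) (at z)"
      using z0 y by (auto intro: DERIV_poisson_ker DERIV_poisson_ker')
    have "z powr (s - 3) \<le> (x / 2) powr (s - 3)"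
      using z t s by (intro powr_mono2') auto
    then show "\<bar>poisson_ker'' s y z\<bar> \<le> 5 * (x / 2) powr (s - 3)"
      using poisson_ker_bounds(4)[OF s z0 y] by linarith
  qed (use t in auto)
  then show ?thesis by simp
qed

lemma second_diff_poisson_ker_far:
  assumes s: "0 < s" "s < 1" and y: "y \<ge> 0" and x: "x > 0" and t: "t \<ge> x / 2"
  shows "\<bar>second_diff (poisson_ker s y) x t\<bar> \<le> 3 * x powr (s - 1) + pos_powr (s - 1) (x - t)"
proof -
  have "(x + t) powr (s - 1) \<le> x powr (s - 1)"
    using x t s by (intro powr_mono2') auto
  then have "\<bar>poisson_ker s y (x + t)\<bar> \<le> x powr (s - 1)" "\<bar>poisson_ker s y x\<bar> \<le> x powr (s - 1)"
    using poisson_ker_bounds(1,2)[OF s _ y, of "x + t"] poisson_ker_bounds(1,2)[OF s x y] x t by auto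
  moreover have "\<bar>poisson_ker s y (x - t)\<bar> \<le> pos_powr (s - 1) (x - t)"
  proof (cases "x - t > 0")
    case True
    then show ?thesis using poisson_ker_bounds(1,2)[OF s True y] by (simp add: pos_powr_pos)
  next
    case False
    then show ?thesis by (simp add: poisson_ker_def pos_powr_neg)
  qed
  ultimately show ?thesis unfolding second_diff_def by linarith
qed

text \<open>At t = x the reflected argument reaches the boundary and the bound is singular of order
  s - 1 > -1, hence integrable; on t \<ge> x / 2 the power of t is bounded.\<close>

lemma set_integrable_poisson_far:
  assumes s: "0 < s" "s < 1" and x: "x > 0"
  shows "set_integrable lborel {x / 2..}
    (\<lambda>t. (3 * x powr (s - 1) + pos_powr (s - 1) (x - t)) * t powr (- 1 - 2 * s))"
proof -
  have "set_integrable lborel {x / 2..} (\<lambda>t. 3 * x powr (s - 1) * t powr (- 1 - 2 * s))"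
    using s x by (intro set_integrable_mult_right set_integrable_powr_at_top') auto
  moreover have "set_integrable lborel {x / 2..} (\<lambda>t. pos_powr (s - 1) (x - t) * t powr (- 1 - 2 * s))"
  proof (rule set_integrable_bound[where f = "\<lambda>t. (x / 2) powr (- 1 - 2 * s) * (indicator {0<..<x} (x - t) * (x - t) powr (s - 1))"])
    have "integrable lborel (\<lambda>t. indicator {0<..<x} t * t powr (s - 1))"
      using set_integrable_powr_at_0[of "s - 1" x] s x by (simp add: set_integrable_def)
    then have "integrable lborel (\<lambda>t. indicator {0<..<x} (x - t) * (x - t) powr (s - 1))"
      using lborel_integrable_real_affine[of "\<lambda>t. indicator {0<..<x} t * t powr (s - 1)" "-1" x] by simp
    then have "integrable lborel (\<lambda>t. (x / 2) powr (- 1 - 2 * s) * (indicator {0<..<x} (x - t) * (x - t) powr (s - 1)))"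
      by (rule integrable_mult_right)
    from integrable_mult_indicator[OF _ this, of "{x / 2..}"]
    show "set_integrable lborel {x / 2..} (\<lambda>t. (x / 2) powr (- 1 - 2 * s) * (indicator {0<..<x} (x - t) * (x - t) powr (s - 1)))"
      unfolding set_integrable_def by simp
    show "set_borel_measurable lborel {x / 2..} (\<lambda>t. pos_powr (s - 1) (x - t) * t powr (- 1 - 2 * s))"
      unfolding set_borel_measurable_def by measurable
    show "AE t in lborel. t \<in> {x / 2..} \<longrightarrow> norm (pos_powr (s - 1) (x - t) * t powr (- 1 - 2 * s))
        \<le> norm ((x / 2) powr (- 1 - 2 * s) * (indicator {0<..<x} (x - t) * (x - t) powr (s - 1)))"
    proof (intro AE_I2 impI)
      fix t assume t: "t \<in> {x / 2..}"
      have "t powr (- 1 - 2 * s) \<le> (x / 2) powr (- 1 - 2 * s)"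
        using t x s by (intro powr_mono2') auto
      moreover have "pos_powr (s - 1) (x - t) = indicator {0<..<x} (x - t) * (x - t) powr (s - 1)"
        using t x by (auto simp: pos_powr_pos pos_powr_neg indicator_def)
      ultimately show "norm (pos_powr (s - 1) (x - t) * t powr (- 1 - 2 * s))
        \<le> norm ((x / 2) powr (- 1 - 2 * s) * (indicator {0<..<x} (x - t) * (x - t) powr (s - 1)))"
        using pos_powr_nonneg[of "s - 1" "x - t"] by (simp add: abs_mult mult_right_mono mult.commute)
    qed
  qed
  ultimately show ?thesis
    unfolding distrib_right by (rule set_integral_add)
qed

text \<open>The value is designed to be cancelled: a datum f located at -y is met by the second
  difference at t = x + y and contributes f times (x + y)^(-1-2s). Weighting the kernel with f
  y^(-s) / \<open>poisson_const s\<close> therefore produces exactly the opposite of that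
  contribution.\<close>

theorem has_frac_lap_poisson_ker:
  assumes s: "0 < s" "s < 1" and y: "y > 0" and x: "x > 0"
  shows "has_frac_lap s (poisson_ker s y) x (- poisson_const s * y powr s * (x + y) powr (- 1 - 2 * s))"
proof -
  have int: "set_integrable lborel {0<..} (\<lambda>t. second_diff (poisson_ker s y) x t * t powr (- 1 - 2 * s))"
    if "y > 0" "x > 0" for x y
    by (rule set_integrable_second_diff[where r = "x / 2" and M = "10 * (x / 2) powr (s - 3)"
          and B = "\<lambda>t. 3 * x powr (s - 1) + pos_powr (s - 1) (x - t)"])
      (use s that in \<open>auto intro!: second_diff_poisson_ker_near second_diff_poisson_ker_far set_integrable_poisson_far\<close>)
  have unit: "has_frac_lap s (poisson_ker s y) 1 (- poisson_const s * y powr s * (1 + y) powr (- 1 - 2 * s))"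
    if y: "y > 0" for y
  proof -
    have cont: "continuous_on {0<..} (\<lambda>t::real. t powr (- s) / (1 + t))"
      by (intro continuous_intros) auto
    obtain B where B: "\<And>t. t > 0 \<Longrightarrow> (B has_real_derivative t powr (- s) / (1 + t)) (at t)"
      "(B \<longlongrightarrow> 0) (at_right 0)" "(B \<longlongrightarrow> poisson_const s) at_top"
      using improper_primitive[OF cont set_integrable_poisson_const[OF s]] unfolding poisson_const_def by blast
    \<comment> \<open>The substitution is invariant under z \<mapsto> 1 / z, vanishes at z = 1 and
      tends to infinity with z. It is chosen so that 1 + \<tau> = (z + y)(y z + 1) / ((1 + y)^2 z),
      which collects the denominators of the kernel at z and at 1 / z.\<close>
    define \<tau> where "\<tau> = (\<lambda>z. y * (z - 1)\<^sup>2 / ((1 + y)\<^sup>2 * z))"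
    define c where "c = y powr s * (1 + y) powr (- 1 - 2 * s)"
    \<comment> \<open>The first term belongs to z_+^s with the denominator frozen at z = 1; the
      second integrates what the varying denominator adds.\<close>
    define \<Theta> where "\<Theta> = (\<lambda>z. mobius_prim s z / (1 + y) - c * B (\<tau> z))"
    \<comment> \<open>As the kernel has the value 1 / (1 + y) at 1, the first and the last term
      cancel and only -c times \<open>poisson_const s\<close> remains.\<close>
    have "has_frac_lap s (poisson_ker s y) 1 ((1 / (2 * s) / (1 + y) - c * poisson_const s) - poisson_ker s y 1 / (2 * s))"
    proof (rule has_frac_lap_mobius[OF s, where \<Theta> = \<Theta> and M = 2])
      show "continuous_on {0<..} (poisson_ker s y)"
        using DERIV_isCont[OF DERIV_poisson_ker] y by (auto simp: continuous_on_eq_continuous_at)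
      show "poisson_ker s y z = 0" if "z < 0" for z
        using that by (simp add: poisson_ker_def pos_powr_neg)
      show "\<bar>poisson_ker s y z - poisson_ker s y 1\<bar> \<le> 2 * (z - 1)" if z: "1 < z" "z < 2" for z
      proof -
        have "\<exists>\<xi>>1. \<xi> < z \<and> poisson_ker s y z - poisson_ker s y 1 = (z - 1) * poisson_ker' s y \<xi>"
          by (rule MVT2) (use z y in \<open>auto intro!: DERIV_poisson_ker\<close>)
        then obtain \<xi> where \<xi>: "1 < \<xi>" "poisson_ker s y z - poisson_ker s y 1 = (z - 1) * poisson_ker' s y \<xi>" by blast
        have "\<xi> powr (s - 2) \<le> 1 powr (s - 2)" using \<xi> s by (intro powr_mono2') auto
        then have "\<bar>poisson_ker' s y \<xi>\<bar> \<le> 2"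
          using poisson_ker_bounds(3)[OF s, of \<xi> y] \<xi> y by simp
        then have "(z - 1) * \<bar>poisson_ker' s y \<xi>\<bar> \<le> (z - 1) * 2" using z by (intro mult_left_mono) auto
        then show ?thesis using z \<xi> by (simp add: abs_mult)
      qed
      show "(\<Theta> has_real_derivative (z - 1) powr (- 1 - 2 * s) * (poisson_ker s y z - poisson_ker s y 1
          + (poisson_ker s y (1 / z) - poisson_ker s y 1) * z powr (2 * s - 1))) (at z)" if z: "z > 1" for z
      proof -
        define a where "a = z powr s"
        define Q where "Q = (z - 1) powr (- 1 - 2 * s)"
        define E where "E = (z + y) * (y * z + 1)"
        have a: "a > 0" using z by (simp add: a_def)
        have E: "E > 0" using z y by (simp add: E_def add_pos_pos)
        have \<tau>0: "\<tau> z > 0" using z y by (simp add: \<tau>_def)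
        have D\<tau>: "(\<tau> has_real_derivative y * (z - 1) * (z + 1) / ((1 + y)\<^sup>2 * z\<^sup>2)) (at z)"
        proof -
          have sq: "((\<lambda>z. y * (z - 1)\<^sup>2) has_real_derivative y * (2 * (z - 1))) (at z)"
            by (auto intro!: derivative_eq_intros)
          have ln: "((\<lambda>z. (1 + y)\<^sup>2 * z) has_real_derivative (1 + y)\<^sup>2) (at z)"
            by (auto intro!: derivative_eq_intros)
          have "(\<tau> has_real_derivative (y * (2 * (z - 1)) * ((1 + y)\<^sup>2 * z) - y * (z - 1)\<^sup>2 * (1 + y)\<^sup>2)
              / (((1 + y)\<^sup>2 * z) * ((1 + y)\<^sup>2 * z))) (at z)"
            unfolding \<tau>_def by (rule DERIV_divide[OF sq ln]) (use y z in auto)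
          moreover have "(y * (2 * (z - 1)) * (u * z) - y * (z - 1)\<^sup>2 * u) / ((u * z) * (u * z))
              = y * (z - 1) * (z + 1) / (u * z\<^sup>2)" if "u > 0" for u
            using that z by (simp add: divide_simps) (simp add: algebra_simps power2_eq_square)
          ultimately show ?thesis using y by simp
        qed
        have DB: "((\<lambda>z. B (\<tau> z)) has_real_derivative
            \<tau> z powr (- s) / (1 + \<tau> z) * (y * (z - 1) * (z + 1) / ((1 + y)\<^sup>2 * z\<^sup>2))) (at z)"
          by (rule DERIV_chain2[OF B(1)[OF \<tau>0] D\<tau>])
        have D: "(\<Theta> has_real_derivative
            Q * (a - 1 + (1 / a - 1) * (a * a / z)) / (1 + y)
            - c * (\<tau> z powr (- s) / (1 + \<tau> z) * (y * (z - 1) * (z + 1) / ((1 + y)\<^sup>2 * z\<^sup>2)))) (at z)"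
          unfolding \<Theta>_def Q_def a_def
          by (intro DERIV_diff DERIV_cdivide DERIV_mobius_prim s z DERIV_cmult DB)
        have Q: "(z - 1) powr (- 2 * s) = Q * (z - 1)"
          using z powr_add[of "z - 1" "- 1 - 2 * s" 1] by (simp add: Q_def)
        have c\<tau>: "c * \<tau> z powr (- s) = Q * (z - 1) * a / (1 + y)"
        proof -
          have "((z - 1)\<^sup>2) powr (- s) = (z - 1) powr (- 2 * s)"
            using z by (simp add: powr_powr flip: powr_numeral)
          moreover have "((1 + y)\<^sup>2) powr (- s) = (1 + y) powr (- 2 * s)"
            using y by (simp add: powr_powr flip: powr_numeral)
          ultimately have e1: "\<tau> z powr (- s) = y powr (- s) * (Q * (z - 1)) / ((1 + y) powr (- 2 * s) * z powr (- s))"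
            unfolding \<tau>_def using y z by (simp add: powr_mult powr_divide Q[simplified])
          have "- 1 - 2 * s = - 2 * s + (- 1)" by simp
          then have e2: "(1 + y) powr (- 1 - 2 * s) = (1 + y) powr (- 2 * s) / (1 + y)"
            using y by (simp only: powr_add) (simp add: powr_minus divide_inverse)
          have e3: "y powr s * y powr (- s) = 1" using y by (simp add: powr_minus)
          have e4: "1 / z powr (- s) = a" by (simp add: a_def powr_minus divide_inverse)
          have gen: "P1 * (P2 / w) * (P3 * P4 / (P2 * P5)) = (P1 * P3) * (P4 * (1 / P5)) / w"
            if "P2 \<noteq> 0" for P1 P2 P3 P4 P5 w :: real
            using that by (simp add: ac_simps)
          have "c * \<tau> z powr (- s) = (y powr s * y powr (- s)) * (Q * (z - 1) * (1 / z powr (- s))) / (1 + y)"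
            unfolding c_def e1 e2 by (rule gen) (use y in simp)
          then show ?thesis unfolding e3 e4 by simp
        qed
        have \<tau>1: "1 / (1 + \<tau> z) = (1 + y)\<^sup>2 * z / E"
        proof -
          have "(1 + y)\<^sup>2 * z + y * (z - 1)\<^sup>2 = E" by (simp add: E_def power2_eq_square algebra_simps)
          moreover have "1 + \<tau> z = ((1 + y)\<^sup>2 * z + y * (z - 1)\<^sup>2) / ((1 + y)\<^sup>2 * z)"
            using y z unfolding \<tau>_def by (simp add: add_divide_distrib)
          ultimately show ?thesis by simp
        qed
        have "c * (\<tau> z powr (- s) / (1 + \<tau> z) * (y * (z - 1) * (z + 1) / ((1 + y)\<^sup>2 * z\<^sup>2)))
            = (c * \<tau> z powr (- s)) * (1 / (1 + \<tau> z)) * (y * (z - 1) * (z + 1) / ((1 + y)\<^sup>2 * z\<^sup>2))" by simp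
        also have "\<dots> = Q * (y * a * (z - 1)\<^sup>2 * (z + 1) / ((1 + y) * E * z))"
          unfolding c\<tau> \<tau>1 using y z E by (simp add: divide_simps) (simp add: algebra_simps power2_eq_square)
        finally have 1: "c * (\<tau> z powr (- s) / (1 + \<tau> z) * (y * (z - 1) * (z + 1) / ((1 + y)\<^sup>2 * z\<^sup>2)))
            = Q * (y * a * (z - 1)\<^sup>2 * (z + 1) / ((1 + y) * E * z))" .
        have 2: "poisson_ker s y z = a / (z + y)" "poisson_ker s y 1 = 1 / (1 + y)"
          "poisson_ker s y (1 / z) = z / (a * (y * z + 1))" "z powr (2 * s - 1) = a * a / z"
        proof -
          have h1: "pos_powr s (1 / z) = 1 / a" using z by (simp add: pos_powr_pos a_def powr_divide)
          then show "poisson_ker s y (1 / z) = z / (a * (y * z + 1))"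
            unfolding poisson_ker_def h1 using z y a by (simp add: divide_simps)
          show "z powr (2 * s - 1) = a * a / z"
            using z by (simp add: a_def powr_diff flip: powr_add)
        qed (use z in \<open>simp_all add: poisson_ker_def pos_powr_pos a_def\<close>)
        have yz: "y * z + 1 > 0" using y z by (simp add: add_pos_pos)
        \<comment> \<open>The identity E = z (1 + y)^2 + y (z - 1)^2 separates the sum of the kernel
          values into the part integrated by \<open>mobius_prim\<close> and the part that is the
          derivative of B(\<tau>).\<close>
        have 3: "a / (z + y) + a / (y * z + 1) = (a + a / z) / (1 + y) - y * a * (z - 1)\<^sup>2 * (z + 1) / ((1 + y) * E * z)"
        proof -
          have "a / (z + y) + a / (y * z + 1) = a * ((z + 1) * (1 + y)) / E"
            using z y E yz unfolding E_def by (simp add: divide_simps) (simp add: algebra_simps)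
          also have "\<dots> = a * (z + 1) * (E - y * (z - 1)\<^sup>2) / ((1 + y) * E * z)"
          proof -
            have "E - y * (z - 1)\<^sup>2 = z * (1 + y)\<^sup>2" by (simp add: E_def power2_eq_square algebra_simps)
            then show ?thesis using z y E by (simp add: power2_eq_square)
          qed
          also have "\<dots> = (a + a / z) / (1 + y) - y * a * (z - 1)\<^sup>2 * (z + 1) / ((1 + y) * E * z)"
            using z y E by (simp add: divide_simps) (simp add: algebra_simps)
          finally show ?thesis .
        qed
        have "a - 1 + (1 / a - 1) * (a * a / z) = a + a / z - 1 - a * a / z"
          using a z by (simp add: field_simps)
        then have "(a - 1 + (1 / a - 1) * (a * a / z)) / (1 + y) - y * a * (z - 1)\<^sup>2 * (z + 1) / ((1 + y) * E * z)
          = a / (z + y) + a / (y * z + 1) - (1 + a * a / z) / (1 + y)"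
          unfolding 3 by (simp add: diff_divide_distrib add_divide_distrib)
        also have "\<dots> = a / (z + y) - 1 / (1 + y) + (z / (a * (y * z + 1)) - 1 / (1 + y)) * (a * a / z)"
          using a z by (simp add: left_diff_distrib add_divide_distrib diff_divide_distrib)
        finally have 4: "(a - 1 + (1 / a - 1) * (a * a / z)) / (1 + y) - y * a * (z - 1)\<^sup>2 * (z + 1) / ((1 + y) * E * z)
          = a / (z + y) - 1 / (1 + y) + (z / (a * (y * z + 1)) - 1 / (1 + y)) * (a * a / z)" .
        show ?thesis
          unfolding 2 Q_def[symmetric] 4[symmetric]
          using D unfolding 1 by (simp add: right_diff_distrib)
      qed
      have "filterlim \<tau> (at_right 0) (at_right 1)"
        unfolding \<tau>_def using y by real_asymp
      from filterlim_compose[OF B(2) this] have "((\<lambda>z. B (\<tau> z)) \<longlongrightarrow> 0) (at_right 1)" .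
      from tendsto_diff[OF tendsto_divide[OF mobius_prim_lim_1[OF s] tendsto_const[of "1 + y"]] tendsto_mult_left[OF this, of c]] y
      show "(\<Theta> \<longlongrightarrow> 0) (at_right 1)" unfolding \<Theta>_def by simp
      have "filterlim \<tau> at_top at_top"
        unfolding \<tau>_def using y by real_asymp
      from filterlim_compose[OF B(3) this] have "((\<lambda>z. B (\<tau> z)) \<longlongrightarrow> poisson_const s) at_top" .
      from tendsto_diff[OF tendsto_divide[OF mobius_prim_lim_top[OF s(1)] tendsto_const[of "1 + y"]] tendsto_mult_left[OF this, of c]] y
      show "(\<Theta> \<longlongrightarrow> 1 / (2 * s) / (1 + y) - c * poisson_const s) at_top" unfolding \<Theta>_def by simp
    qed (rule int[OF y], simp)
    then show ?thesis using y by (simp add: c_def poisson_ker_def pos_powr_pos ac_simps)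
  qed
  \<comment> \<open>The kernel is homogeneous of degree s - 1 in (y, z) jointly, so a general x is
    reached from 1 by replacing y with y / x.\<close>
  have 1: "(\<lambda>z. x powr (s - 1) * poisson_ker s (y / x) z) = (\<lambda>z. poisson_ker s y (x * z))"
  proof
    show "x powr (s - 1) * poisson_ker s (y / x) z = poisson_ker s y (x * z)" for z
    proof (cases "z > 0")
      case True
      then show ?thesis using x y
        by (simp add: poisson_ker_def pos_powr_pos powr_mult powr_diff field_simps)
    next
      case False
      then show ?thesis using x by (simp add: poisson_ker_def pos_powr_neg mult_le_0_iff)
    qed
  qed
  have "has_frac_lap s (\<lambda>z. poisson_ker s y (x * z)) 1
      (x powr (s - 1) * (- poisson_const s * (y / x) powr s * (1 + y / x) powr (- 1 - 2 * s)))"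
    using has_frac_lap_cmult[OF unit[of "y / x"], of "x powr (s - 1)"] x y unfolding 1 by simp
  note has_frac_lap_scale[OF x this]
  moreover have "x powr (- 2 * s) * (x powr (s - 1) * (- poisson_const s * (y / x) powr s * (1 + y / x) powr (- 1 - 2 * s)))
    = - poisson_const s * y powr s * (x + y) powr (- 1 - 2 * s)"
  proof -
    have "1 + y / x = (x + y) / x" using x by (simp add: field_simps)
    then have "(1 + y / x) powr (- 1 - 2 * s) = (x + y) powr (- 1 - 2 * s) / x powr (- 1 - 2 * s)"
      using x y by (simp add: powr_divide)
    moreover have "(y / x) powr s = y powr s / x powr s" using x y by (simp add: powr_divide)
    moreover have "x powr (- 2 * s) * x powr (s - 1) = x powr s * x powr (- 1 - 2 * s)"
      by (simp only: powr_add[symmetric]) (rule arg_cong[of _ _ "\<lambda>e. x powr e"], simp)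
    moreover have "p1 * (p2 * (- C * (Y / p3) * (W / p4))) = - C * Y * W"
      if "p1 * p2 = p3 * p4" "p3 \<noteq> 0" "p4 \<noteq> 0" for p1 p2 p3 p4 C Y W :: real
    proof -
      have "p1 * (p2 * (- C * (Y / p3) * (W / p4))) = (p1 * p2) * (- C * Y * W) / (p3 * p4)" by simp
      then show ?thesis using that by simp
    qed
    ultimately show ?thesis using x by simp
  qed
  ultimately show ?thesis by (simp only:)
qed

text \<open>Fubini for the integrals in y and t: the majorant D does not depend on y, so |w| times D
  is an integrable product. Integrability of \<open>w y * F y z\<close> is required at every real z
  because the second difference samples F on both sides of x at all distances.\<close>

lemma has_frac_lap_superpose:
  fixes F :: "real \<Rightarrow> real \<Rightarrow> real" and w :: "real \<Rightarrow> real"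
  assumes F[measurable]: "(\<lambda>(y, z). F y z) \<in> borel_measurable (borel \<Otimes>\<^sub>M borel)"
    and S: "S \<in> sets borel" and w: "set_integrable lborel S w"
    and A: "\<And>y. y \<in> S \<Longrightarrow> has_frac_lap s (F y) x (A y)"
    and dom: "\<And>y t. y \<in> S \<Longrightarrow> t > 0 \<Longrightarrow> \<bar>second_diff (F y) x t\<bar> \<le> D t"
    and D: "set_integrable lborel {0<..} (\<lambda>t. D t * t powr (- 1 - 2 * s))"
    and int: "\<And>z. set_integrable lborel S (\<lambda>y. w y * F y z)"
  shows "has_frac_lap s (\<lambda>z. LBINT y:S. w y * F y z) x (LBINT y:S. w y * A y)"
proof -
  define W where "W = (\<lambda>y. indicator S y * w y)"
  define d where "d = (\<lambda>t. indicator {0<..} t * (D t * t powr (- 1 - 2 * s)))"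
  define f where "f = (\<lambda>y t. W y * (indicator {0<..} t * (second_diff (F y) x t * t powr (- 1 - 2 * s))))"
  have W: "integrable lborel W" using w by (simp add: W_def set_integrable_def)
  then have W'[measurable]: "W \<in> borel_measurable borel" using borel_measurable_integrable[OF W] by simp
  have d: "integrable lborel d" using D by (simp add: d_def set_integrable_def)
  have Fy[measurable]: "F y \<in> borel_measurable borel" for y
    using measurable_compose[OF measurable_Pair1' F, of y] by simp
  have bd: "\<bar>f y t\<bar> \<le> \<bar>W y\<bar> * \<bar>d t\<bar>" for y t
  proof (cases "y \<in> S \<and> t > 0")
    case True
    then have "\<bar>second_diff (F y) x t\<bar> * t powr (- 1 - 2 * s) \<le> \<bar>D t\<bar> * t powr (- 1 - 2 * s)"
      using dom[of y t] by (intro mult_right_mono) auto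
    then show ?thesis using True by (auto simp: f_def d_def abs_mult intro!: mult_left_mono)
  qed (auto simp: f_def W_def d_def)
  have mf: "(\<lambda>(y, t). f y t) \<in> borel_measurable (lborel \<Otimes>\<^sub>M lborel)"
    unfolding f_def second_diff_def by measurable
  have fy: "integrable lborel (f y)" for y
  proof (rule Bochner_Integration.integrable_bound[OF integrable_mult_right[OF d, of "\<bar>W y\<bar>"]])
    show "f y \<in> borel_measurable lborel" unfolding f_def second_diff_def by measurable
    show "AE t in lborel. norm (f y t) \<le> norm (\<bar>W y\<bar> * d t)"
      using bd by (auto simp: abs_mult)
  qed
  have f: "integrable (lborel \<Otimes>\<^sub>M lborel) (\<lambda>(y, t). f y t)"
  proof (rule lborel_pair.Fubini_integrable[OF mf])
    have *: "(\<lambda>(y, t). norm (f y t)) \<in> borel_measurable (lborel \<Otimes>\<^sub>M lborel)"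
      using mf by measurable
    show "integrable lborel (\<lambda>y. LBINT t. norm (case (y, t) of (y, t) \<Rightarrow> f y t))"
    proof (rule Bochner_Integration.integrable_bound[OF integrable_mult_left[OF W, of "LBINT t. \<bar>d t\<bar>"]])
      show "(\<lambda>y. LBINT t. norm (case (y, t) of (y, t) \<Rightarrow> f y t)) \<in> borel_measurable lborel"
        using * by (intro lborel.borel_measurable_lebesgue_integral) (simp add: case_prod_beta')
      have "(LBINT t. \<bar>f y t\<bar>) \<le> (LBINT t. \<bar>W y\<bar> * \<bar>d t\<bar>)" for y
        using fy[of y] d bd by (intro integral_mono integrable_mult_right integrable_abs) auto
      moreover have "0 \<le> (LBINT t. \<bar>f y t\<bar>)" "0 \<le> (LBINT t. \<bar>d t\<bar>)" for y by simp_all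
      ultimately show "AE y in lborel. norm (LBINT t. norm (case (y, t) of (y, t) \<Rightarrow> f y t)) \<le> norm (W y * (LBINT t. \<bar>d t\<bar>))"
        by (intro AE_I2) (simp add: abs_mult)
    qed
    show "AE y in lborel. integrable lborel (\<lambda>t. case (y, t) of (y, t) \<Rightarrow> f y t)"
      using fy by simp
  qed
  have 1: "(LBINT y. f y t) = indicator {0<..} t * (second_diff (\<lambda>z. LBINT y:S. w y * F y z) x t * t powr (- 1 - 2 * s))" for t
  proof -
    have i: "has_bochner_integral lborel (\<lambda>y. W y * F y z) (LBINT y:S. w y * F y z)" for z
      using int[of z] by (simp add: has_bochner_integral_iff set_integrable_def set_lebesgue_integral_def W_def mult.assoc)
    have "has_bochner_integral lborel (\<lambda>y. W y * F y (x + t) + W y * F y (x - t) - 2 * (W y * F y x))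
        (second_diff (\<lambda>z. LBINT y:S. w y * F y z) x t)"
      unfolding second_diff_def
      by (intro has_bochner_integral_diff has_bochner_integral_add has_bochner_integral_mult_right i)
    then have "has_bochner_integral lborel (\<lambda>y. (W y * F y (x + t) + W y * F y (x - t) - 2 * (W y * F y x)) * (indicator {0<..} t * t powr (- 1 - 2 * s)))
        (second_diff (\<lambda>z. LBINT y:S. w y * F y z) x t * (indicator {0<..} t * t powr (- 1 - 2 * s)))"
      by (rule has_bochner_integral_mult_left)
    moreover have "(W y * F y (x + t) + W y * F y (x - t) - 2 * (W y * F y x)) * (indicator {0<..} t * t powr (- 1 - 2 * s)) = f y t" for y
      by (simp add: f_def second_diff_def algebra_simps)
    ultimately have "has_bochner_integral lborel (\<lambda>y. f y t)
        (second_diff (\<lambda>z. LBINT y:S. w y * F y z) x t * (indicator {0<..} t * t powr (- 1 - 2 * s)))"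
      by (simp only:)
    then show ?thesis by (simp only: has_bochner_integral_iff) (simp add: ac_simps)
  qed
  have 2: "(LBINT t. f y t) = indicator S y * (w y * A y)" for y
  proof (cases "y \<in> S")
    case True
    then show ?thesis using A[OF True]
      by (simp add: f_def W_def has_frac_lap_def has_bochner_integral_iff)
  qed (simp add: f_def W_def)
  have "(LBINT t. LBINT y. f y t) = (LBINT y. LBINT t. f y t)"
    by (rule lborel_pair.Fubini_integral[OF f])
  moreover have "integrable lborel (\<lambda>t. LBINT y. f y t)"
    by (rule lborel_pair.integrable_snd[OF f])
  ultimately show ?thesis
    unfolding has_frac_lap_def has_bochner_integral_iff 1 2
    by (simp add: set_lebesgue_integral_def)
qed

text \<open>A uniform bound on the second derivative gives a Taylor remainder of at most M t^2 for
  every y. Integrated against |w| it is still O(t^2), which is differentiability with an explicit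
  error.\<close>

lemma DERIV_superpose:
  fixes F F' F'' :: "real \<Rightarrow> real \<Rightarrow> real" and w :: "real \<Rightarrow> real"
  assumes r: "r > 0" and w: "set_integrable lborel S w"
    and F': "\<And>y z. y \<in> S \<Longrightarrow> \<bar>z - x\<bar> < r \<Longrightarrow> (F y has_real_derivative F' y z) (at z)"
    and F'': "\<And>y z. y \<in> S \<Longrightarrow> \<bar>z - x\<bar> < r \<Longrightarrow> (F' y has_real_derivative F'' y z) (at z)"
    and M: "\<And>y z. y \<in> S \<Longrightarrow> \<bar>z - x\<bar> < r \<Longrightarrow> \<bar>F'' y z\<bar> \<le> M"
    and int: "\<And>z. \<bar>z - x\<bar> < r \<Longrightarrow> set_integrable lborel S (\<lambda>y. w y * F y z)"
    and int': "set_integrable lborel S (\<lambda>y. w y * F' y x)"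
  shows "((\<lambda>z. LBINT y:S. w y * F y z) has_real_derivative (LBINT y:S. w y * F' y x)) (at x)"
proof -
  define G where "G = (\<lambda>z. LBINT y:S. w y * F y z)"
  define D where "D = (LBINT y:S. w y * F' y x)"
  define I where "I = (LBINT y:S. \<bar>w y\<bar>)"
  have taylor: "\<bar>F y (x + t) - F y x - t * F' y x\<bar> \<le> M * t\<^sup>2" if y: "y \<in> S" and t: "\<bar>t\<bar> < r" "t \<noteq> 0" for y t
  proof -
    obtain \<xi> where \<xi>: "\<bar>\<xi>\<bar> < \<bar>t\<bar>" "F y (x + t) - F y x = t * F' y (x + \<xi>)"
    proof (cases "t > 0")
      case True
      have "\<exists>\<eta>>x. \<eta> < x + t \<and> F y (x + t) - F y x = (x + t - x) * F' y \<eta>"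
        by (rule MVT2) (use True t y in \<open>auto intro!: F'\<close>)
      then obtain \<eta> where "x < \<eta>" "\<eta> < x + t" "F y (x + t) - F y x = t * F' y \<eta>" by auto
      then show ?thesis by (intro that[of "\<eta> - x"]) auto
    next
      case False
      have "\<exists>\<eta>>x + t. \<eta> < x \<and> F y x - F y (x + t) = (x - (x + t)) * F' y \<eta>"
        by (rule MVT2) (use False t y in \<open>auto intro!: F'\<close>)
      then obtain \<eta> where "x + t < \<eta>" "\<eta> < x" "F y (x + t) - F y x = t * F' y \<eta>" by auto
      then show ?thesis by (intro that[of "\<eta> - x"]) auto
    qed
    have "\<bar>F' y (x + \<xi>) - F' y x\<bar> \<le> M * \<bar>\<xi>\<bar>"
    proof -
      have "norm (F' y (x + \<xi>) - F' y x) \<le> M * norm (x + \<xi> - x)"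
      proof (rule field_differentiable_bound[where S = "ball x r" and f' = "F'' y"])
        fix z assume "z \<in> ball x r"
        then have z: "\<bar>z - x\<bar> < r" by (simp add: dist_real_def abs_minus_commute)
        show "(F' y has_field_derivative F'' y z) (at z within ball x r)"
          by (rule has_field_derivative_at_within[OF F''[OF y z]])
        show "norm (F'' y z) \<le> M" using M[OF y z] by simp
      qed (use t \<xi> r in \<open>auto simp: dist_real_def\<close>)
      then show ?thesis by simp
    qed
    moreover have "M \<ge> 0" using M[OF y, of x] r by auto
    ultimately have "\<bar>F' y (x + \<xi>) - F' y x\<bar> \<le> M * \<bar>t\<bar>"
      using \<xi>(1) by (smt (verit) mult_left_mono)
    then have "\<bar>t\<bar> * \<bar>F' y (x + \<xi>) - F' y x\<bar> \<le> \<bar>t\<bar> * (M * \<bar>t\<bar>)" by (intro mult_left_mono) auto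
    moreover have "F y (x + t) - F y x - t * F' y x = t * (F' y (x + \<xi>) - F' y x)"
      using \<xi>(2) by (simp add: algebra_simps)
    moreover have "\<bar>t\<bar> * (M * \<bar>t\<bar>) = M * t\<^sup>2" by (simp add: power2_eq_square mult_ac)
    ultimately show ?thesis by (simp add: abs_mult)
  qed
  have bound: "\<bar>(G (x + t) - G x) / t - D\<bar> \<le> M * I * \<bar>t\<bar>" if t: "\<bar>t\<bar> < r" "t \<noteq> 0" for t
  proof -
    define R where "R = (\<lambda>y. indicator S y * (w y * F y (x + t)) - indicator S y * (w y * F y x) - t * (indicator S y * (w y * F' y x)))"
    have R: "has_bochner_integral lborel R (G (x + t) - G x - t * D)"
      unfolding R_def
      by (intro has_bochner_integral_diff has_bochner_integral_mult_right)
         (use int[of "x + t"] int[of x] int' t r in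
           \<open>auto simp: has_bochner_integral_iff set_integrable_def set_lebesgue_integral_def G_def D_def\<close>)
    have "\<bar>R y\<bar> \<le> M * t\<^sup>2 * (indicator S y * \<bar>w y\<bar>)" for y
    proof (cases "y \<in> S")
      case True
      have "\<bar>R y\<bar> = \<bar>w y\<bar> * \<bar>F y (x + t) - F y x - t * F' y x\<bar>"
        using True by (simp add: R_def algebra_simps flip: abs_mult)
      also have "\<dots> \<le> \<bar>w y\<bar> * (M * t\<^sup>2)" by (intro mult_left_mono taylor True t) auto
      finally show ?thesis using True by (simp add: mult_ac)
    qed (simp add: R_def)
    moreover have aw: "integrable lborel (\<lambda>y. indicator S y * \<bar>w y\<bar>)"
      using set_integrable_abs[OF w] by (simp add: set_integrable_def)
    ultimately have "(LBINT y. \<bar>R y\<bar>) \<le> (LBINT y. M * t\<^sup>2 * (indicator S y * \<bar>w y\<bar>))"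
      using R by (intro integral_mono integrable_abs integrable_mult_right) (auto simp: has_bochner_integral_iff)
    also have "\<dots> = M * t\<^sup>2 * I"
      by (simp add: I_def set_lebesgue_integral_def)
    finally have "\<bar>G (x + t) - G x - t * D\<bar> \<le> M * t\<^sup>2 * I"
      using R integral_abs_bound[of lborel R] by (simp add: has_bochner_integral_iff)
    then have "\<bar>G (x + t) - G x - t * D\<bar> / \<bar>t\<bar> \<le> M * t\<^sup>2 * I / \<bar>t\<bar>" by (intro divide_right_mono) auto
    moreover have "M * t\<^sup>2 * I / \<bar>t\<bar> = M * I * \<bar>t\<bar>" using t(2) by (simp add: field_simps power2_eq_square abs_if)
    moreover have "(G (x + t) - G x) / t - D = (G (x + t) - G x - t * D) / t" using t(2) by (simp add: field_simps)
    ultimately show ?thesis by simp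
  qed
  have "((\<lambda>t. (G (x + t) - G x) / t - D) \<longlongrightarrow> 0) (at 0)"
  proof (rule Lim_null_comparison)
    show "((\<lambda>t. M * I * \<bar>t\<bar>) \<longlongrightarrow> 0) (at 0)" by (auto intro!: tendsto_eq_intros)
    show "\<forall>\<^sub>F t in at 0. norm ((G (x + t) - G x) / t - D) \<le> M * I * \<bar>t\<bar>"
      using bound r by (auto simp: eventually_at intro!: exI[of _ r])
  qed
  then have "((\<lambda>t. (G (x + t) - G x) / t) \<longlongrightarrow> D) (at 0)" by (simp add: LIM_zero_iff)
  then show ?thesis unfolding G_def[symmetric] D_def[symmetric] by (simp add: DERIV_def)
qed

definition c2_pos :: "(real \<Rightarrow> real) \<Rightarrow> bool" where
  "c2_pos F \<longleftrightarrow> (\<exists>F' F''. (\<forall>z>0. (F has_real_derivative F' z) (at z)) \<and>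
     (\<forall>z>0. (F' has_real_derivative F'' z) (at z)) \<and> continuous_on {0<..} F'')"

lemma c2_posI:
  assumes "\<And>z. z > 0 \<Longrightarrow> (F has_real_derivative F' z) (at z)"
    "\<And>z. z > 0 \<Longrightarrow> (F' has_real_derivative F'' z) (at z)"
    "\<And>z. z > 0 \<Longrightarrow> isCont F'' z"
  shows "c2_pos F"
  unfolding c2_pos_def using assms by (intro exI[of _ F'] exI[of _ F'']) (auto simp: continuous_on_eq_continuous_at)

lemma c2_pos_pos_powr: "h \<ge> 0 \<Longrightarrow> c2_pos (\<lambda>z. pos_powr s (z + h))"
proof (rule c2_posI)
  fix z :: real assume "h \<ge> 0" "z > 0"
  then have zh: "z + h > 0" by simp
  have D: "((\<lambda>z. pos_powr a (z + h)) has_real_derivative a * pos_powr (a - 1) (z + h)) (at z)" for a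
    using DERIV_shift[of "pos_powr a" "a * pos_powr (a - 1) (z + h)" z h] DERIV_pos_powr[OF zh] by simp
  show "((\<lambda>z. pos_powr s (z + h)) has_real_derivative s * pos_powr (s - 1) (z + h)) (at z)" by (rule D)
  show "((\<lambda>z. s * pos_powr (s - 1) (z + h)) has_real_derivative s * ((s - 1) * pos_powr (s - 1 - 1) (z + h))) (at z)"
    by (intro DERIV_cmult D)
  show "isCont (\<lambda>z. s * ((s - 1) * pos_powr (s - 1 - 1) (z + h))) z"
    using DERIV_isCont[OF D[of "s - 1 - 1"]] by (intro continuous_intros)
qed

lemma c2_pos_add: "c2_pos F \<Longrightarrow> c2_pos G \<Longrightarrow> c2_pos (\<lambda>z. F z + G z)"
proof -
  assume "c2_pos F" "c2_pos G"
  then obtain F' F'' G' G'' where "\<forall>z>0. (F has_real_derivative F' z) (at z)"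
     "\<forall>z>0. (F' has_real_derivative F'' z) (at z)" "continuous_on {0<..} F''"
     "\<forall>z>0. (G has_real_derivative G' z) (at z)"
     "\<forall>z>0. (G' has_real_derivative G'' z) (at z)" "continuous_on {0<..} G''"
    unfolding c2_pos_def by blast
  then show ?thesis
    by (intro c2_posI[of _ "\<lambda>z. F' z + G' z" "\<lambda>z. F'' z + G'' z"] DERIV_add)
       (auto simp: continuous_on_eq_continuous_at intro!: continuous_intros)
qed

lemma c2_pos_mult: "c2_pos F \<Longrightarrow> c2_pos G \<Longrightarrow> c2_pos (\<lambda>z. F z * G z)"
proof -
  assume "c2_pos F" "c2_pos G"
  then obtain F' F'' G' G'' where D: "\<And>z. z > 0 \<Longrightarrow> (F has_real_derivative F' z) (at z)"
     "\<And>z. z > 0 \<Longrightarrow> (F' has_real_derivative F'' z) (at z)" "continuous_on {0<..} F''"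
     "\<And>z. z > 0 \<Longrightarrow> (G has_real_derivative G' z) (at z)"
     "\<And>z. z > 0 \<Longrightarrow> (G' has_real_derivative G'' z) (at z)" "continuous_on {0<..} G''"
    unfolding c2_pos_def by blast
  show ?thesis
  proof (rule c2_posI)
    fix z :: real assume z: "z > 0"
    show "((\<lambda>z. F z * G z) has_real_derivative F' z * G z + G' z * F z) (at z)"
      by (intro DERIV_mult D z)
    show "((\<lambda>z. F' z * G z + G' z * F z) has_real_derivative
        (F'' z * G z + G' z * F' z) + (G'' z * F z + F' z * G' z)) (at z)"
      by (intro DERIV_mult DERIV_add D z)
    show "isCont (\<lambda>z. (F'' z * G z + G' z * F' z) + (G'' z * F z + F' z * G' z)) z"
      using D(3,6) DERIV_isCont[OF D(1)[OF z]] DERIV_isCont[OF D(2)[OF z]]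
        DERIV_isCont[OF D(4)[OF z]] DERIV_isCont[OF D(5)[OF z]] z
      by (intro continuous_intros) (auto simp: continuous_on_eq_continuous_at)
  qed
qed

lemma c2_pos_const: "c2_pos (\<lambda>z. c)"
  by (rule c2_posI[of _ "\<lambda>z. 0" "\<lambda>z. 0"]) auto

lemma c2_pos_cong: "c2_pos F \<Longrightarrow> (\<And>z. z > 0 \<Longrightarrow> F z = G z) \<Longrightarrow> c2_pos G"
proof -
  assume "c2_pos F" and eq: "\<And>z. z > 0 \<Longrightarrow> F z = G z"
  then obtain F' F'' where D: "\<And>z. z > 0 \<Longrightarrow> (F has_real_derivative F' z) (at z)"
     "\<And>z. z > 0 \<Longrightarrow> (F' has_real_derivative F'' z) (at z)" "continuous_on {0<..} F''"
    unfolding c2_pos_def by blast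
  show ?thesis
  proof (rule c2_posI)
    fix z :: real assume z: "z > 0"
    show "(G has_real_derivative F' z) (at z)"
      by (rule has_field_derivative_transform_within_open[OF D(1)[OF z], of "{0<..}"]) (use z eq in auto)
    show "(F' has_real_derivative F'' z) (at z)" by (rule D(2)[OF z])
    show "isCont F'' z" using D(3) z by (simp add: continuous_on_eq_continuous_at)
  qed
qed

lemma second_diff_pos_powr_dominant:
  assumes s: "0 < s" "s < 1" and x: "x > 0" and h: "0 \<le> \<tau>" "\<tau> \<le> h" and t: "t > 0"
  shows "\<bar>second_diff (\<lambda>z. pos_powr s (z + \<tau>)) x t\<bar>
    \<le> (if t < x / 2 then 2 * (x / 2) powr (s - 2) * t\<^sup>2 else 4 * (2 * (x + h) / x + 1) powr s * t powr s)"
proof -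
  have "second_diff (\<lambda>z. pos_powr s (z + \<tau>)) x t = second_diff (pos_powr s) (x + \<tau>) t"
    by (simp add: second_diff_def algebra_simps)
  then show ?thesis
    using second_diff_pos_powr_near[OF s, of x "x + \<tau>" t] second_diff_pos_powr_far[OF s, of x "x + \<tau>" "x + h" t]
      x h t by auto
qed

lemma has_frac_lap_shift:
  assumes "has_frac_lap s F (x + \<tau>) v"
  shows "has_frac_lap s (\<lambda>z. F (z + \<tau>)) x v"
proof -
  have "second_diff (\<lambda>z. F (z + \<tau>)) x t = second_diff F (x + \<tau>) t" for t
    by (simp add: second_diff_def algebra_simps)
  then show ?thesis using assms by (simp add: has_frac_lap_def)
qed

lemma set_integral_powr_at_0:
  fixes a p :: real
  assumes "a > -1" "p > 0"
  shows "(LBINT t:{0<..<p}. t powr a) = p powr (a + 1) / (a + 1)"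
proof -
  have e: "einterval (ereal 0) (ereal p) = {0<..<p}" by (auto simp: einterval_def)
  have "(LBINT t=ereal 0..ereal p. t powr a) = p powr (a + 1) / (a + 1) - 0"
  proof (rule interval_integral_FTC_integrable[where F = "\<lambda>t. t powr (a + 1) / (a + 1)"])
    show "((\<lambda>t. t powr (a + 1) / (a + 1)) has_vector_derivative x powr a) (at x)"
      if "ereal 0 < ereal x" for x
      using that assms unfolding has_real_derivative_iff_has_vector_derivative[symmetric]
      by (auto intro!: derivative_eq_intros simp: powr_diff)
    show "isCont (\<lambda>t. t powr a) x" if "ereal 0 < ereal x" for x
      using that by (auto intro!: continuous_intros)
    show "(((\<lambda>t. t powr (a + 1) / (a + 1)) \<circ> real_of_ereal) \<longlongrightarrow> 0) (at_right (ereal 0))"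
      unfolding ereal_tendsto_simps using assms by real_asymp
    have "isCont (\<lambda>t. t powr (a + 1) / (a + 1)) p"
      using assms by (auto intro!: continuous_intros)
    then show "(((\<lambda>t. t powr (a + 1) / (a + 1)) \<circ> real_of_ereal) \<longlongrightarrow> p powr (a + 1) / (a + 1)) (at_left (ereal p))"
      unfolding ereal_tendsto_simps isCont_def by (rule filterlim_at_split[THEN iffD1, THEN conjunct1])
    show "set_integrable lborel (einterval (ereal 0) (ereal p)) (\<lambda>t. t powr a)"
      unfolding e using assms by (rule set_integrable_powr_at_0)
  qed (use assms in auto)
  then show ?thesis using assms e by (simp add: interval_lebesgue_integral_def)
qed

text \<open>On \<open>z > 0\<close> this is the harmonic extension of the exterior datum equal to \<open>f (- z)\<close> for
  \<open>-h < z < 0\<close> and to \<open>0\<close> for \<open>z \<le> -h\<close>.\<close>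

definition poisson_int :: "real \<Rightarrow> real \<Rightarrow> (real \<Rightarrow> real) \<Rightarrow> real \<Rightarrow> real" where
  "poisson_int s h f z = (LBINT y:{0<..<h}. (f y * y powr (- s) / poisson_const s) * poisson_ker s y z)"

context
  fixes s h M :: real and f :: "real \<Rightarrow> real"
  assumes s: "0 < s" "s < 1" and h: "h > 0"
    and f[measurable]: "f \<in> borel_measurable borel"
    and M: "\<And>y. 0 < y \<Longrightarrow> y < h \<Longrightarrow> \<bar>f y\<bar> \<le> M"
begin

lemma poisson_weight_integrable:
  "set_integrable lborel {0<..<h} (\<lambda>y. f y * y powr (- s) / poisson_const s)"
proof (rule set_integrable_bound)
  show "set_integrable lborel {0<..<h} (\<lambda>y. M / poisson_const s * y powr (- s))"
    using s h by (intro set_integrable_mult_right set_integrable_powr_at_0) auto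
  show "set_borel_measurable lborel {0<..<h} (\<lambda>y. f y * y powr (- s) / poisson_const s)"
    unfolding set_borel_measurable_def by measurable
  show "AE y in lborel. y \<in> {0<..<h} \<longrightarrow> norm (f y * y powr (- s) / poisson_const s) \<le> norm (M / poisson_const s * y powr (- s))"
  proof (intro AE_I2 impI)
    fix y assume "y \<in> {0<..<h}"
    then have "\<bar>f y\<bar> \<le> \<bar>M\<bar>" using M[of y] by auto
    then show "norm (f y * y powr (- s) / poisson_const s) \<le> norm (M / poisson_const s * y powr (- s))"
      using poisson_const_pos[OF s] by (simp add: abs_mult divide_right_mono mult_right_mono)
  qed
qed

lemma poisson_integrand_integrable:
  assumes K[measurable]: "(\<lambda>y. K y) \<in> borel_measurable borel" and B: "\<And>y. 0 < y \<Longrightarrow> y < h \<Longrightarrow> \<bar>K y\<bar> \<le> B"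
  shows "set_integrable lborel {0<..<h} (\<lambda>y. (f y * y powr (- s) / poisson_const s) * K y)"
proof (rule set_integrable_bound)
  show "set_integrable lborel {0<..<h} (\<lambda>y. (f y * y powr (- s) / poisson_const s) * B)"
    using poisson_weight_integrable by (rule set_integrable_mult_left)
  show "set_borel_measurable lborel {0<..<h} (\<lambda>y. (f y * y powr (- s) / poisson_const s) * K y)"
    unfolding set_borel_measurable_def by measurable
  show "AE y in lborel. y \<in> {0<..<h} \<longrightarrow> norm ((f y * y powr (- s) / poisson_const s) * K y)
      \<le> norm ((f y * y powr (- s) / poisson_const s) * B)"
  proof (intro AE_I2 impI)
    fix y assume "y \<in> {0<..<h}"
    then have "\<bar>K y\<bar> \<le> \<bar>B\<bar>" using B[of y] by auto
    then show "norm ((f y * y powr (- s) / poisson_const s) * K y)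
      \<le> norm ((f y * y powr (- s) / poisson_const s) * B)"
      unfolding norm_mult by (intro mult_left_mono) auto
  qed
qed

lemma measurable_poisson_ker_fst[measurable]: "(\<lambda>y. poisson_ker s y z) \<in> borel_measurable borel"
  unfolding poisson_ker_def by measurable

lemma poisson_ker_integrable:
  "set_integrable lborel {0<..<h} (\<lambda>y. (f y * y powr (- s) / poisson_const s) * poisson_ker s y z)"
proof (rule poisson_integrand_integrable)
  show "\<bar>poisson_ker s y z\<bar> \<le> pos_powr (s - 1) z" if "0 < y" for y
  proof (cases "z > 0")
    case True
    then show ?thesis using poisson_ker_bounds(1,2)[OF s True, of y] that by (simp add: pos_powr_pos)
  qed (simp add: poisson_ker_def pos_powr_neg)
qed simp

lemma poisson_int_nonpos: "z \<le> 0 \<Longrightarrow> poisson_int s h f z = 0"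
  by (simp add: poisson_int_def poisson_ker_def pos_powr_neg set_lebesgue_integral_def)

lemma has_frac_lap_poisson_int:
  assumes x: "x > 0"
  shows "has_frac_lap s (poisson_int s h f) x (- (LBINT y:{0<..<h}. f y * (x + y) powr (- 1 - 2 * s)))"
proof -
  have "has_frac_lap s (\<lambda>z. LBINT y:{0<..<h}. (f y * y powr (- s) / poisson_const s) * poisson_ker s y z) x
      (LBINT y:{0<..<h}. (f y * y powr (- s) / poisson_const s) * (- poisson_const s * y powr s * (x + y) powr (- 1 - 2 * s)))"
  proof (rule has_frac_lap_superpose)
    show "(\<lambda>(y, z). poisson_ker s y z) \<in> borel_measurable (borel \<Otimes>\<^sub>M borel)"
      unfolding poisson_ker_def by measurable
    show "set_integrable lborel {0<..} (\<lambda>t. (if t < x / 2 then 10 * (x / 2) powr (s - 3) * t\<^sup>2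
        else 3 * x powr (s - 1) + pos_powr (s - 1) (x - t)) * t powr (- 1 - 2 * s))"
      using s x by (intro set_integrable_frac_dominant set_integrable_poisson_far) auto
    show "\<bar>second_diff (poisson_ker s y) x t\<bar> \<le> (if t < x / 2 then 10 * (x / 2) powr (s - 3) * t\<^sup>2
        else 3 * x powr (s - 1) + pos_powr (s - 1) (x - t))" if "y \<in> {0<..<h}" "t > 0" for y t
      using that x s second_diff_poisson_ker_near[OF s, of y t x] second_diff_poisson_ker_far[OF s, of y x t] by auto
    show "has_frac_lap s (poisson_ker s y) x (- poisson_const s * y powr s * (x + y) powr (- 1 - 2 * s))"
      if "y \<in> {0<..<h}" for y
      using that x s by (intro has_frac_lap_poisson_ker) auto
  qed (use poisson_weight_integrable poisson_ker_integrable in auto)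
  also have "(LBINT y:{0<..<h}. (f y * y powr (- s) / poisson_const s) * (- poisson_const s * y powr s * (x + y) powr (- 1 - 2 * s)))
      = (LBINT y:{0<..<h}. - (f y * (x + y) powr (- 1 - 2 * s)))"
    by (rule set_lebesgue_integral_cong) (use poisson_const_pos[OF s] in \<open>auto simp: powr_minus\<close>)
  also have "\<dots> = - (LBINT y:{0<..<h}. f y * (x + y) powr (- 1 - 2 * s))"
    by (simp add: set_lebesgue_integral_def)
  finally show ?thesis by (simp add: poisson_int_def[abs_def])
qed

text \<open>The factor z^s comes out of the integral. What remains is the integral of (z + y)^(-1)
  against a fixed weight, and differentiation merely raises the exponent: the derivative of
  \<open>R m\<close> is -m times \<open>R (Suc m)\<close>.\<close>

lemma c2_pos_poisson_int: "c2_pos (poisson_int s h f)"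
proof -
  define R where "R = (\<lambda>m z. LBINT y:{0<..<h}. (f y * y powr (- s) / poisson_const s) * inverse (z + y) ^ m)"
  have bd: "\<bar>inverse (z + y) ^ m\<bar> \<le> inverse r ^ m" if "z > r" "r > 0" "y > 0" for z y r :: real and m :: nat
    unfolding power_abs using that by (intro power_mono) (auto intro!: le_imp_inverse_le)
  have D: "(R m has_real_derivative - real m * R (Suc m) x) (at x)" if x: "x > 0" for m x
  proof -
    have Dinv: "((\<lambda>z. inverse (z + y) ^ n) has_real_derivative - real n * inverse (z + y) ^ Suc n) (at z)"
      if "z > 0" "y > 0" for z y :: real and n
    proof -
      have "((\<lambda>z. inverse (z + y)) has_real_derivative - (inverse (z + y) * 1 * inverse (z + y))) (at z)"
        using that by (intro DERIV_inverse') (auto intro!: derivative_eq_intros)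
      from DERIV_power[OF this, of n] show ?thesis
        by (rule DERIV_cong) (cases n, auto simp: algebra_simps)
    qed
    have "((\<lambda>z. LBINT y:{0<..<h}. (f y * y powr (- s) / poisson_const s) * inverse (z + y) ^ m) has_real_derivative
       (LBINT y:{0<..<h}. (f y * y powr (- s) / poisson_const s) * (- real m * inverse (x + y) ^ Suc m))) (at x)"
    proof (rule DERIV_superpose[where r = "x / 2" and M = "real m * (real (Suc m) * inverse (x / 2) ^ Suc (Suc m))"
          and F'' = "\<lambda>y z. - real m * (- real (Suc m) * inverse (z + y) ^ Suc (Suc m))"])
      fix y z assume y: "y \<in> {0<..<h}" and "\<bar>z - x\<bar> < x / 2"
      then have z: "z > x / 2" "z > 0" using x by (auto simp: abs_if field_simps split: if_splits)
      show "((\<lambda>z. inverse (z + y) ^ m) has_real_derivative - real m * inverse (z + y) ^ Suc m) (at z)"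
        using y z by (intro Dinv) auto
      show "((\<lambda>z. - real m * inverse (z + y) ^ Suc m) has_real_derivative
          - real m * (- real (Suc m) * inverse (z + y) ^ Suc (Suc m))) (at z)"
        using y z by (intro DERIV_cmult Dinv) auto
      show "\<bar>- real m * (- real (Suc m) * inverse (z + y) ^ Suc (Suc m))\<bar> \<le> real m * (real (Suc m) * inverse (x / 2) ^ Suc (Suc m))"
        using bd[of "x / 2" z y "Suc (Suc m)"] z y x unfolding abs_mult
        by (intro mult_mono mult_nonneg_nonneg) auto
    next
      fix z assume "\<bar>z - x\<bar> < x / 2"
      then have z: "z > x / 2" using x by (auto simp: abs_if field_simps split: if_splits)
      show "set_integrable lborel {0<..<h} (\<lambda>y. (f y * y powr (- s) / poisson_const s) * inverse (z + y) ^ m)"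
        by (rule poisson_integrand_integrable[where B = "inverse (x / 2) ^ m"]) (use bd[of "x / 2" z] z x in auto)
    next
      show "set_integrable lborel {0<..<h} (\<lambda>y. (f y * y powr (- s) / poisson_const s) * (- real m * inverse (x + y) ^ Suc m))"
      proof (rule poisson_integrand_integrable[where B = "real m * inverse (x / 2) ^ Suc m"])
        show "\<bar>- real m * inverse (x + y) ^ Suc m\<bar> \<le> real m * inverse (x / 2) ^ Suc m" if "0 < y" for y
          using bd[of "x / 2" x y "Suc m"] x that unfolding abs_mult by (intro mult_mono) auto
      qed simp
    qed (use x poisson_weight_integrable in auto)
    also have "(LBINT y:{0<..<h}. (f y * y powr (- s) / poisson_const s) * (- real m * inverse (x + y) ^ Suc m))
        = (LBINT y:{0<..<h}. - real m * ((f y * y powr (- s) / poisson_const s) * inverse (x + y) ^ Suc m))"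
      by (rule set_lebesgue_integral_cong) auto
    also have "\<dots> = - real m * R (Suc m) x" unfolding R_def by (rule set_integral_mult_right)
    finally show ?thesis by (simp add: R_def[abs_def])
  qed
  have "c2_pos (R 1)"
  proof (rule c2_posI)
    fix z :: real assume z: "z > 0"
    show "(R 1 has_real_derivative - real 1 * R (Suc 1) z) (at z)" by (rule D[OF z])
    show "((\<lambda>z. - real 1 * R (Suc 1) z) has_real_derivative - real 1 * (- real (Suc 1) * R (Suc (Suc 1)) z)) (at z)"
      by (intro DERIV_cmult D z)
    show "isCont (\<lambda>z. - real 1 * (- real (Suc 1) * R (Suc (Suc 1)) z)) z"
      using DERIV_isCont[OF D[OF z, of "Suc (Suc 1)"]] by (intro continuous_intros)
  qed
  from c2_pos_mult[OF c2_pos_pos_powr[of 0 s] this] have "c2_pos (\<lambda>z. pos_powr s z * R 1 z)" by simp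
  moreover have "pos_powr s z * R 1 z = poisson_int s h f z" for z
    unfolding R_def poisson_int_def set_integral_mult_right[symmetric]
    by (rule set_lebesgue_integral_cong) (auto simp: poisson_ker_def divide_inverse)
  ultimately show ?thesis by simp
qed

text \<open>Bound the kernel by x^(s-1) and integrate the weight: y^(-s) over (0, h) gives h^(1-s) /
  (1 - s).\<close>

lemma poisson_int_bound:
  assumes x: "x > 0"
  shows "\<bar>poisson_int s h f x\<bar> \<le> M * h powr (1 - s) / (poisson_const s * (1 - s)) * x powr (s - 1)"
proof -
  have i: "set_integrable lborel {0<..<h} (\<lambda>y. M * x powr (s - 1) / poisson_const s * y powr (- s))"
    using s h by (intro set_integrable_mult_right set_integrable_powr_at_0) auto
  have "\<bar>poisson_int s h f x\<bar> \<le> (LBINT y:{0<..<h}. \<bar>(f y * y powr (- s) / poisson_const s) * poisson_ker s y x\<bar>)"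
    unfolding poisson_int_def using set_integral_norm_bound[OF poisson_ker_integrable] by simp
  also have "\<dots> \<le> (LBINT y:{0<..<h}. M * x powr (s - 1) / poisson_const s * y powr (- s))"
  proof (rule set_integral_mono[OF set_integrable_abs[OF poisson_ker_integrable] i])
    fix y assume y: "y \<in> {0<..<h}"
    have "\<bar>f y\<bar> * \<bar>poisson_ker s y x\<bar> \<le> M * x powr (s - 1)"
      using M[of y] y poisson_ker_bounds(1,2)[OF s x, of y] by (intro mult_mono) auto
    then have "(\<bar>f y\<bar> * \<bar>poisson_ker s y x\<bar>) * (y powr (- s) / poisson_const s) \<le> (M * x powr (s - 1)) * (y powr (- s) / poisson_const s)"
      using poisson_const_pos[OF s] by (intro mult_right_mono) auto
    then show "\<bar>(f y * y powr (- s) / poisson_const s) * poisson_ker s y x\<bar> \<le> M * x powr (s - 1) / poisson_const s * y powr (- s)"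
      using poisson_const_pos[OF s] by (simp add: abs_mult ac_simps)
  qed
  also have "\<dots> = M * x powr (s - 1) / poisson_const s * (h powr (1 - s) / (1 - s))"
    using set_integral_powr_at_0[of "- s" h] s h by (simp add: algebra_simps)
  finally show ?thesis by (simp add: ac_simps)
qed

text \<open>The substitution y = x \<tau> turns kernel and weight into the fixed probability density
  proportional to \<tau>^(-s) / (1 + \<tau>), while f is evaluated at x \<tau>. As x tends to 0 the
  cutoff x \<tau> < h disappears, and dominated convergence gives the boundary value.\<close>

lemma poisson_int_limit:
  assumes f0: "(f \<longlongrightarrow> f0) (at_right 0)"
  shows "(poisson_int s h f \<longlongrightarrow> f0) (at_right 0)"
proof -
  define q where "q = (\<lambda>\<tau>::real. indicator {0<..} \<tau> * (\<tau> powr (- s) / (1 + \<tau>)))"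
  have q: "integrable lborel q" "integral\<^sup>L lborel q = poisson_const s"
    using set_integrable_poisson_const[OF s]
    by (auto simp: q_def set_integrable_def poisson_const_def set_lebesgue_integral_def)
  define g where "g = (\<lambda>x \<tau>. indicator {0<..<h} (x * \<tau>) * f (x * \<tau>) / poisson_const s * q \<tau>)"
  have eq: "poisson_int s h f x = integral\<^sup>L lborel (g x)" if x: "x > 0" for x
  proof -
    have "poisson_int s h f x = \<bar>x\<bar> *\<^sub>R (LBINT \<tau>. indicator {0<..<h} (0 + x * \<tau>) *\<^sub>R
       ((f (0 + x * \<tau>) * (0 + x * \<tau>) powr (- s) / poisson_const s) * poisson_ker s (0 + x * \<tau>) x))"
      unfolding poisson_int_def set_lebesgue_integral_def
      by (rule lborel_integral_real_affine) (use x in auto)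
    also have "\<dots> = (LBINT \<tau>. x * (indicator {0<..<h} (0 + x * \<tau>) *\<^sub>R
       ((f (0 + x * \<tau>) * (0 + x * \<tau>) powr (- s) / poisson_const s) * poisson_ker s (0 + x * \<tau>) x)))"
      using x by simp
    also have "\<dots> = integral\<^sup>L lborel (g x)"
    proof (rule Bochner_Integration.integral_cong[OF refl])
      fix \<tau> :: real
      show "x * (indicator {0<..<h} (0 + x * \<tau>) *\<^sub>R
       ((f (0 + x * \<tau>) * (0 + x * \<tau>) powr (- s) / poisson_const s) * poisson_ker s (0 + x * \<tau>) x)) = g x \<tau>"
      proof (cases "x * \<tau> \<in> {0<..<h}")
        case True
        then have \<tau>: "\<tau> > 0" using x by (auto simp: zero_less_mult_iff)
        have "x + x * \<tau> = x * (1 + \<tau>)" by (simp add: algebra_simps)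
        then have "x * ((x * \<tau>) powr (- s) * poisson_ker s (x * \<tau>) x) = \<tau> powr (- s) / (1 + \<tau>)"
          using x \<tau> by (simp add: poisson_ker_def pos_powr_pos powr_mult powr_minus)
        moreover have "x * ((f (x * \<tau>) * (x * \<tau>) powr (- s) / poisson_const s) * poisson_ker s (x * \<tau>) x)
            = f (x * \<tau>) / poisson_const s * (x * ((x * \<tau>) powr (- s) * poisson_ker s (x * \<tau>) x))" by simp
        ultimately show ?thesis using True \<tau> by (simp add: g_def q_def)
      qed (simp add: g_def)
    qed
    finally show ?thesis .
  qed
  show ?thesis
    unfolding tendsto_at_iff_sequentially
  proof (intro allI impI)
    fix X :: "nat \<Rightarrow> real" assume "\<forall>i. X i \<in> {0<..} - {0}" and X0: "X \<longlonglongrightarrow> 0"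
    then have X: "X i > 0" for i by auto
    have "(\<lambda>i. integral\<^sup>L lborel (g (X i))) \<longlonglongrightarrow> integral\<^sup>L lborel (\<lambda>\<tau>. f0 / poisson_const s * q \<tau>)"
    proof (rule integral_dominated_convergence[where w = "\<lambda>\<tau>. \<bar>M\<bar> / poisson_const s * q \<tau>"])
      show "(\<lambda>\<tau>. f0 / poisson_const s * q \<tau>) \<in> borel_measurable lborel"
        using q(1) by auto
      show "integrable lborel (\<lambda>\<tau>. \<bar>M\<bar> / poisson_const s * q \<tau>)" using q(1) by simp
      have [measurable]: "q \<in> borel_measurable borel" using q(1) by auto
      show "g (X i) \<in> borel_measurable lborel" for i
        unfolding g_def by measurable
      show "AE \<tau> in lborel. (\<lambda>i. g (X i) \<tau>) \<longlonglongrightarrow> f0 / poisson_const s * q \<tau>"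
      proof (intro AE_I2)
        fix \<tau> :: real
        show "(\<lambda>i. g (X i) \<tau>) \<longlonglongrightarrow> f0 / poisson_const s * q \<tau>"
        proof (cases "\<tau> > 0")
          case True
          have lim: "(\<lambda>i. X i * \<tau>) \<longlonglongrightarrow> 0" using tendsto_mult_left_zero[OF X0] by simp
          then have at0: "filterlim (\<lambda>i. X i * \<tau>) (at_right 0) sequentially"
            using X True by (auto simp: filterlim_at X[THEN less_imp_neq, symmetric])
          have "(\<lambda>i. f (X i * \<tau>) / poisson_const s * q \<tau>) \<longlonglongrightarrow> f0 / poisson_const s * q \<tau>"
            using poisson_const_pos[OF s] by (intro tendsto_intros filterlim_compose[OF f0 at0]) auto
          moreover have "\<forall>\<^sub>F i in sequentially. X i * \<tau> < h"
            using lim h by (simp add: order_tendsto_iff)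
          then have "\<forall>\<^sub>F i in sequentially. f (X i * \<tau>) / poisson_const s * q \<tau> = g (X i) \<tau>"
            by eventually_elim (use X True in \<open>simp add: g_def\<close>)
          ultimately show ?thesis by (rule Lim_transform_eventually)
        qed (simp add: g_def q_def)
      qed
      show "AE \<tau> in lborel. norm (g (X i) \<tau>) \<le> \<bar>M\<bar> / poisson_const s * q \<tau>" for i
      proof (intro AE_I2)
        fix \<tau> :: real
        have q0: "q \<tau> \<ge> 0" by (auto simp: q_def indicator_def)
        have "\<bar>indicator {0<..<h} (X i * \<tau>) * f (X i * \<tau>)\<bar> \<le> \<bar>M\<bar>"
          using M[of "X i * \<tau>"] by (auto simp: indicator_def)
        then have "\<bar>indicator {0<..<h} (X i * \<tau>) * f (X i * \<tau>)\<bar> / poisson_const s * q \<tau> \<le> \<bar>M\<bar> / poisson_const s * q \<tau>"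
          using poisson_const_pos[OF s] q0 by (intro mult_right_mono divide_right_mono) auto
        then show "norm (g (X i) \<tau>) \<le> \<bar>M\<bar> / poisson_const s * q \<tau>"
          using poisson_const_pos[OF s] q0 by (simp add: g_def abs_mult)
      qed
    qed
    then show "(poisson_int s h f \<circ> X) \<longlonglongrightarrow> f0"
      using poisson_const_pos[OF s] by (simp add: o_def eq[OF X] q(2))
  qed
qed

end

text \<open>The exterior values on (-h, 0) enter the second difference at t = x + y and contribute
  the integral v; the Poisson integral, extended by 0, was shown to contribute -v. Further left
  \<phi> (z + h) is 0.\<close>

lemma has_frac_lap_poisson_extension:
  assumes s: "0 < s" "s < 1" and h: "h > 0" and \<phi>: "continuous_on UNIV \<phi>" "\<And>z. z \<le> 0 \<Longrightarrow> \<phi> z = 0"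
    and x: "x > 0"
  shows "has_frac_lap s (\<lambda>z. if z \<le> 0 then \<phi> (z + h) else poisson_int s h (\<lambda>y. \<phi> (h - y)) z) x 0"
proof -
  have [measurable]: "\<phi> \<in> borel_measurable borel" using \<phi>(1) by (rule borel_measurable_continuous_onI)
  have "compact (\<phi> ` {0..h})" using \<phi>(1) by (intro compact_continuous_image) (auto intro: continuous_on_subset)
  then obtain M where M: "\<And>y. 0 \<le> y \<Longrightarrow> y \<le> h \<Longrightarrow> \<bar>\<phi> y\<bar> \<le> M"
    by (metis atLeastAtMost_iff bounded_iff compact_imp_bounded imageI real_norm_def)
  define f where "f = (\<lambda>y. \<phi> (h - y))"
  define v where "v = (LBINT y:{0<..<h}. f y * (x + y) powr (- 1 - 2 * s))"
  have fm[measurable]: "f \<in> borel_measurable borel" unfolding f_def by measurable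
  have fM: "\<bar>f y\<bar> \<le> M" if "0 < y" "y < h" for y using M[of "h - y"] that by (simp add: f_def)
  have P: "has_frac_lap s (poisson_int s h f) x (- v)"
    unfolding v_def by (rule has_frac_lap_poisson_int[OF s h fm fM x])
  have "has_bochner_integral lborel (\<lambda>y. indicator {0<..<h} y * (f y * (x + y) powr (- 1 - 2 * s))) v"
  proof -
    have "set_integrable lborel {0<..<h} (\<lambda>y. f y * (x + y) powr (- 1 - 2 * s))"
    proof (rule set_integrable_bound[where f = "\<lambda>y. M * x powr (- 1 - 2 * s)"])
      show "set_borel_measurable lborel {0<..<h} (\<lambda>y. f y * (x + y) powr (- 1 - 2 * s))"
        unfolding set_borel_measurable_def by measurable
      show "AE y in lborel. y \<in> {0<..<h} \<longrightarrow> norm (f y * (x + y) powr (- 1 - 2 * s)) \<le> norm (M * x powr (- 1 - 2 * s))"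
      proof (intro AE_I2 impI)
        fix y assume y: "y \<in> {0<..<h}"
        have "(x + y) powr (- 1 - 2 * s) \<le> x powr (- 1 - 2 * s)" using x y s by (intro powr_mono2') auto
        then show "norm (f y * (x + y) powr (- 1 - 2 * s)) \<le> norm (M * x powr (- 1 - 2 * s))"
          using fM[of y] y unfolding norm_mult by (intro mult_mono) auto
      qed
      show "set_integrable lborel {0<..<h} (\<lambda>y. M * x powr (- 1 - 2 * s))"
        unfolding set_integrable_def using h by (intro integrable_scaleR_left integrable_real_indicator) auto
    qed
    then show ?thesis by (simp add: has_bochner_integral_iff set_integrable_def v_def set_lebesgue_integral_def)
  qed
  then have "has_bochner_integral lborel (\<lambda>t. indicator {0<..<h} (- x + 1 * t) * (f (- x + 1 * t) * (x + (- x + 1 * t)) powr (- 1 - 2 * s))) (v /\<^sub>R \<bar>1\<bar>)"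
    using lborel_has_bochner_integral_real_affine_iff[of 1 "\<lambda>y. indicator {0<..<h} y * (f y * (x + y) powr (- 1 - 2 * s))" v "- x"] by simp
  then have H: "has_bochner_integral lborel (\<lambda>t. indicator {0<..<h} (t - x) * (f (t - x) * t powr (- 1 - 2 * s))) v"
    by simp
  have "has_bochner_integral lborel (\<lambda>t. indicator {0<..} t * (second_diff (poisson_int s h f) x t * t powr (- 1 - 2 * s))
      + indicator {0<..<h} (t - x) * (f (t - x) * t powr (- 1 - 2 * s))) (- v + v)"
    using P[unfolded has_frac_lap_def] H by (rule has_bochner_integral_add)
  \<comment> \<open>At t = x the argument x - t is 0, where the extension has the value \<phi> h and
    the sum on the left need not agree. This single point is a null set.\<close>
  moreover have "indicator {0<..} t * (second_diff (poisson_int s h f) x t * t powr (- 1 - 2 * s))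
      + indicator {0<..<h} (t - x) * (f (t - x) * t powr (- 1 - 2 * s))
      = indicator {0<..} t * (second_diff (\<lambda>z. if z \<le> 0 then \<phi> (z + h) else poisson_int s h (\<lambda>y. \<phi> (h - y)) z) x t * t powr (- 1 - 2 * s))"
    if "t \<noteq> x" for t
  proof (cases "t > 0")
    case True
    have P0: "poisson_int s h f (x - t) = 0" if "x - t \<le> 0"
      using poisson_int_nonpos[OF s h fm fM that] by simp
    have e: "x - t + h = h - (t - x)" by simp
    have z: "\<phi> (h - (t - x)) = 0" if "t - x \<ge> h" using that by (intro \<phi>(2)) simp
    consider "t < x" | "x < t" "t < x + h" | "t \<ge> x + h" using \<open>t \<noteq> x\<close> by linarith
    then show ?thesis
    proof cases
      case 1
      then show ?thesis using True x by (simp add: second_diff_def f_def[symmetric])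
    next
      case 2
      then show ?thesis using True x P0 by (simp add: second_diff_def f_def[symmetric] e) (simp add: f_def algebra_simps)
    next
      case 3
      then show ?thesis using True x P0 z h by (simp add: second_diff_def f_def[symmetric] e)
    qed
  qed (use x in auto)
  then have "AE t in lborel. indicator {0<..} t * (second_diff (poisson_int s h f) x t * t powr (- 1 - 2 * s))
      + indicator {0<..<h} (t - x) * (f (t - x) * t powr (- 1 - 2 * s))
      = indicator {0<..} t * (second_diff (\<lambda>z. if z \<le> 0 then \<phi> (z + h) else poisson_int s h (\<lambda>y. \<phi> (h - y)) z) x t * t powr (- 1 - 2 * s))"
    using AE_lborel_singleton[of x] by (auto elim!: eventually_mono)
  moreover have [measurable]: "(\<lambda>z. poisson_int s h (\<lambda>y. \<phi> (h - y)) z) \<in> borel_measurable borel"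
    unfolding poisson_int_def set_lebesgue_integral_def poisson_ker_def by measurable
  moreover have [measurable]: "poisson_int s h f \<in> borel_measurable borel"
    unfolding poisson_int_def set_lebesgue_integral_def poisson_ker_def by measurable
  ultimately show ?thesis
    unfolding has_frac_lap_def second_diff_def
    by (subst (asm) has_bochner_integral_cong_AE) (auto intro: borel_measurable_has_bochner_integral)
qed

lemma DERIV_pos_powr_primitive:
  assumes s: "s > 0"
  shows "((\<lambda>z. pos_powr (s + 1) z / (s + 1)) has_real_derivative pos_powr s z) (at z)"
proof -
  consider "z > 0" | "z < 0" | "z = 0" by linarith
  then show ?thesis
  proof cases
    case 1
    then show ?thesis
      using DERIV_cdivide[OF DERIV_pos_powr[OF 1, of "s + 1"], of "s + 1"] s by simp
  next
    case 2
    have "((\<lambda>z::real. 0::real) has_real_derivative 0) (at z)" by simp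
    then have "((\<lambda>z. pos_powr (s + 1) z / (s + 1)) has_real_derivative 0) (at z)"
      by (rule has_field_derivative_transform_within_open[where S = "{..<0}"]) (use 2 in \<open>auto simp: pos_powr_neg\<close>)
    then show ?thesis using 2 by (simp add: pos_powr_neg)
  next
    case 3
    have "((\<lambda>t. pos_powr (s + 1) t / (s + 1) / t) \<longlongrightarrow> 0) (at 0)"
    proof (rule Lim_null_comparison)
      show "((\<lambda>t. \<bar>t\<bar> powr s) \<longlongrightarrow> 0) (at 0)"
        using s by (auto intro!: tendsto_eq_intros)
      have "\<bar>pos_powr (s + 1) t / (s + 1) / t\<bar> \<le> \<bar>t\<bar> powr s" for t
      proof (cases "t > 0")
        case True
        have "pos_powr (s + 1) t / (s + 1) / t = t powr s / (s + 1)"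
          using True s by (simp add: pos_powr_pos powr_add)
        also have "\<dots> \<le> t powr s / 1" using s True by (intro divide_left_mono) auto
        finally show ?thesis using True s pos_powr_nonneg[of "s + 1" t] by simp
      qed (simp add: pos_powr_neg)
      then show "\<forall>\<^sub>F t in at 0. norm (pos_powr (s + 1) t / (s + 1) / t) \<le> \<bar>t\<bar> powr s" by simp
    qed
    then show ?thesis using 3 by (simp add: DERIV_def pos_powr_neg)
  qed
qed

section \<open>Increments of the power function and their odd integral\<close>

definition pos_powr_diff :: "real \<Rightarrow> real \<Rightarrow> real \<Rightarrow> real" where
  "pos_powr_diff s h z = pos_powr s (z + h) - pos_powr s z"

lemma c2_pos_pos_powr_diff: "h \<ge> 0 \<Longrightarrow> c2_pos (pos_powr_diff s h)"
proof -
  assume h: "h \<ge> 0"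
  have "c2_pos (\<lambda>z. pos_powr s (z + h) + (- 1) * pos_powr s (z + 0))"
    by (intro c2_pos_add c2_pos_mult c2_pos_const c2_pos_pos_powr h order.refl)
  then show ?thesis by (simp add: pos_powr_diff_def[abs_def])
qed

lemma measurable_pos_powr_diff[measurable]: "pos_powr_diff s h \<in> borel_measurable borel"
  unfolding pos_powr_diff_def by measurable

lemma pos_powr_diff_bounds:
  assumes s: "0 < s" "s < 1" and h: "h > 0"
  shows "0 \<le> pos_powr_diff s h z" "z > 0 \<Longrightarrow> pos_powr_diff s h z \<le> h * z powr (s - 1)"
    "z \<le> x \<Longrightarrow> x \<ge> 0 \<Longrightarrow> pos_powr_diff s h z \<le> (x + h) powr s" "z \<le> - h \<Longrightarrow> pos_powr_diff s h z = 0"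
proof -
  show "0 \<le> pos_powr_diff s h z"
    unfolding pos_powr_diff_def using pos_powr_mono[of s z "z + h"] s h by simp
  show "pos_powr_diff s h z \<le> h * z powr (s - 1)" if z: "z > 0"
  proof -
    have "\<exists>\<xi>>z. \<xi> < z + h \<and> pos_powr s (z + h) - pos_powr s z = (z + h - z) * (s * pos_powr (s - 1) \<xi>)"
      by (rule MVT2) (use h z in \<open>auto intro!: DERIV_pos_powr\<close>)
    then obtain \<xi> where \<xi>: "\<xi> > z" "pos_powr_diff s h z = h * (s * pos_powr (s - 1) \<xi>)"
      by (auto simp: pos_powr_diff_def)
    have "pos_powr (s - 1) \<xi> \<le> z powr (s - 1)"
      using \<xi>(1) z s by (subst pos_powr_pos) (auto intro!: powr_mono2')
    then have "s * pos_powr (s - 1) \<xi> \<le> 1 * z powr (s - 1)"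
      using s pos_powr_nonneg by (intro mult_mono) auto
    then show ?thesis using \<xi> h by (simp add: mult_left_mono)
  qed
  show "pos_powr_diff s h z \<le> (x + h) powr s" if "z \<le> x" "x \<ge> 0"
  proof -
    have "pos_powr s (z + h) \<le> pos_powr s (x + h)" using that s by (intro pos_powr_mono) auto
    then show ?thesis
      unfolding pos_powr_diff_def using pos_powr_nonneg[of s z] that h by (simp add: pos_powr_pos)
  qed
  show "pos_powr_diff s h z = 0" if "z \<le> - h"
    using that h by (simp add: pos_powr_diff_def pos_powr_neg)
qed

lemma has_frac_lap_pos_powr_diff:
  assumes "0 < s" "s < 1" "h > 0" "x > 0"
  shows "has_frac_lap s (pos_powr_diff s h) x 0"
proof -
  have "has_frac_lap s (\<lambda>z. pos_powr s (z + h)) x 0"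
    using assms by (intro has_frac_lap_shift has_frac_lap_pos_powr) auto
  from has_bochner_integral_diff[OF this[unfolded has_frac_lap_def] has_frac_lap_pos_powr[OF assms(1,2,4), unfolded has_frac_lap_def]]
  show ?thesis
    unfolding has_frac_lap_def
    by (rule has_bochner_integral_cong[THEN iffD1, rotated 3])
       (auto simp: second_diff_def pos_powr_diff_def right_diff_distrib left_diff_distrib distrib_left distrib_right)
qed

text \<open>The integral is, after integration by parts, the fractional Laplacian of an antiderivative
  of \<^term>\<open>pos_powr_diff s h\<close>, which is a superposition of translates of \<^term>\<open>pos_powr s\<close>.\<close>

lemma odd_integral_pos_powr_diff:
  assumes s: "0 < s" "s < 1" and h: "h > 0" and x: "x > 0"
  shows "has_bochner_integral lborel (\<lambda>t. indicator {0<..} t *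
    ((pos_powr_diff s h (x + t) - pos_powr_diff s h (x - t)) * t powr (- 2 * s))) 0"
proof -
  define G where "G = (\<lambda>z. pos_powr (s + 1) z / (s + 1))"
  have G: "(G has_real_derivative pos_powr s z) (at z)" for z
    unfolding G_def using s by (intro DERIV_pos_powr_primitive) simp
  \<comment> \<open>An antiderivative of the increment, written as a superposition of translates
    with constant weight 1 so that it inherits fractional Laplacian 0.\<close>
  define E where "E = (\<lambda>z. LBINT \<tau>:{0..h}. 1 * pos_powr s (z + \<tau>))"
  have contg: "isCont (pos_powr s) z" for z
    using continuous_pos_powr[OF s(1)] by (simp add: continuous_on_eq_continuous_at)
  have GE: "has_bochner_integral lborel (\<lambda>\<tau>. pos_powr s (z + \<tau>) * indicator {0..h} \<tau>) (G (z + h) - G (z + 0))" for z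
  proof (rule has_bochner_integral_FTC_Icc_real)
    show "((\<lambda>\<tau>. G (z + \<tau>)) has_real_derivative pos_powr s (z + \<tau>)) (at \<tau>)" for \<tau>
      using DERIV_shift[of G "pos_powr s (z + \<tau>)" \<tau> z] G by (simp add: add.commute)
    show "isCont (\<lambda>\<tau>. pos_powr s (z + \<tau>)) \<tau>" for \<tau>
      by (intro isCont_o2[OF _ contg] continuous_intros)
  qed (use h in auto)
  have EG: "E z = G (z + h) - G z" for z
    using GE[of z] by (simp add: E_def has_bochner_integral_iff set_lebesgue_integral_def mult.commute)
  have DE: "(E has_real_derivative pos_powr_diff s h z) (at z)" for z
    unfolding EG pos_powr_diff_def
    using DERIV_diff[OF DERIV_shift[THEN iffD1, OF G[of "z + h"]] G[of z]] .
  have "has_frac_lap s E x (LBINT \<tau>:{0..h}. 1 * 0)"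
    unfolding E_def
  proof (rule has_frac_lap_superpose)
    show "set_integrable lborel {0<..} (\<lambda>t. (if t < x / 2 then 2 * (x / 2) powr (s - 2) * t\<^sup>2
        else 4 * (2 * (x + h) / x + 1) powr s * t powr s) * t powr (- 1 - 2 * s))"
      using s x by (intro set_integrable_frac_dominant set_integrable_far_powr) auto
    show "set_integrable lborel {0..h} (\<lambda>\<tau>. 1 * pos_powr s (z + \<tau>))" for z
      using GE[of z] by (simp add: has_bochner_integral_iff set_integrable_def mult.commute)
    show "has_frac_lap s (\<lambda>z. pos_powr s (z + \<tau>)) x 0" if "\<tau> \<in> {0..h}" for \<tau>
      using that s x by (intro has_frac_lap_shift has_frac_lap_pos_powr) auto
    show "set_integrable lborel {0..h} (\<lambda>\<tau>. 1::real)"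
      unfolding set_integrable_def using h by (intro integrable_scaleR_left integrable_real_indicator) auto
  qed (use second_diff_pos_powr_dominant[OF s x] in auto)
  then have E0: "has_frac_lap s E x 0" by (simp add: set_lebesgue_integral_def)
  define d where "d = (\<lambda>t. pos_powr_diff s h (x + t) - pos_powr_diff s h (x - t))"
  define D where "D = second_diff E x"
  have DD: "(D has_real_derivative d t) (at t)" for t
  proof -
    have "((\<lambda>t. E (x + t)) has_real_derivative pos_powr_diff s h (x + t) * 1) (at t)"
      by (rule DERIV_chain2[OF DE]) (auto intro!: derivative_eq_intros)
    moreover have "((\<lambda>t. E (x - t)) has_real_derivative pos_powr_diff s h (x - t) * (- 1)) (at t)"
      by (rule DERIV_chain2[OF DE]) (auto intro!: derivative_eq_intros)
    ultimately have "((\<lambda>t. E (x + t) + E (x - t) - 2 * E x) has_real_derivative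
        pos_powr_diff s h (x + t) * 1 + pos_powr_diff s h (x - t) * (- 1) - 0) (at t)"
      by (intro DERIV_add DERIV_diff DERIV_const)
    then show ?thesis by (simp add: D_def second_diff_def[abs_def] d_def)
  qed
  have contd: "isCont d t" for t
    unfolding d_def pos_powr_diff_def by (intro continuous_intros isCont_o2[OF _ contg])
  have near: "\<bar>d t\<bar> \<le> 2 * (x / 2) powr (s - 1) * t" if t: "0 < t" "t < x / 2" for t
  proof -
    have "\<exists>\<xi>>x - t. \<xi> < x + t \<and> pos_powr_diff s h (x + t) - pos_powr_diff s h (x - t)
        = (x + t - (x - t)) * (s * pos_powr (s - 1) (\<xi> + h) - s * pos_powr (s - 1) \<xi>)"
    proof (rule MVT2)
      fix \<xi> assume "x - t \<le> \<xi>"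
      then have \<xi>: "\<xi> > 0" using t x by auto
      have "((\<lambda>z. pos_powr s (z + h)) has_real_derivative s * pos_powr (s - 1) (\<xi> + h)) (at \<xi>)"
        using DERIV_shift[THEN iffD1, OF DERIV_pos_powr[of "\<xi> + h" s]] \<xi> h by simp
      from DERIV_diff[OF this DERIV_pos_powr[OF \<xi>]]
      show "(pos_powr_diff s h has_real_derivative s * pos_powr (s - 1) (\<xi> + h) - s * pos_powr (s - 1) \<xi>) (at \<xi>)"
        by (simp add: pos_powr_diff_def[abs_def])
    qed (use t in auto)
    then obtain \<xi> where \<xi>: "\<xi> > x - t" "d t = 2 * t * (s * pos_powr (s - 1) (\<xi> + h) - s * pos_powr (s - 1) \<xi>)"
      by (auto simp: d_def)
    have \<xi>2: "\<xi> > x / 2" "\<xi> > 0" using \<xi>(1) t x by auto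
    have "pos_powr (s - 1) \<xi> \<le> (x / 2) powr (s - 1)" "pos_powr (s - 1) (\<xi> + h) \<le> (x / 2) powr (s - 1)"
      using \<xi>2 s h x by (auto simp: pos_powr_pos intro!: powr_mono2')
    moreover have "0 \<le> s * a \<and> s * a \<le> b" if "a \<le> b" "0 \<le> a" for a b
      using mult_mono[of s 1 a b] that s by auto
    ultimately have "0 \<le> s * pos_powr (s - 1) \<xi> \<and> s * pos_powr (s - 1) \<xi> \<le> (x / 2) powr (s - 1)"
      "0 \<le> s * pos_powr (s - 1) (\<xi> + h) \<and> s * pos_powr (s - 1) (\<xi> + h) \<le> (x / 2) powr (s - 1)"
      by (simp_all add: pos_powr_nonneg)
    then have "\<bar>s * pos_powr (s - 1) (\<xi> + h) - s * pos_powr (s - 1) \<xi>\<bar> \<le> (x / 2) powr (s - 1)" by linarith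
    then have "2 * t * \<bar>s * pos_powr (s - 1) (\<xi> + h) - s * pos_powr (s - 1) \<xi>\<bar> \<le> 2 * t * (x / 2) powr (s - 1)"
      using t by (intro mult_left_mono) auto
    then show ?thesis using \<xi>(2) t by (simp add: abs_mult mult_ac)
  qed
  \<comment> \<open>The summand h comes from the right-hand point and x + h from the left-hand one:
    the latter contributes only for t < x + h, where (x + h)^s \<le> (x + h) t^(s-1).\<close>
  have far: "\<bar>d t\<bar> \<le> (2 * h + x) * t powr (s - 1)" if t: "t \<ge> x / 2" for t
  proof -
    have t0: "t > 0" using t x by simp
    have "pos_powr_diff s h (x + t) \<le> h * (x + t) powr (s - 1)"
      using pos_powr_diff_bounds(2)[OF s h, of "x + t"] x t0 by simp
    also have "\<dots> \<le> h * t powr (s - 1)" using h x t0 s by (intro mult_left_mono powr_mono2') auto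
    finally have 1: "pos_powr_diff s h (x + t) \<le> h * t powr (s - 1)" .
    have 2: "pos_powr_diff s h (x - t) \<le> (x + h) * t powr (s - 1)"
    proof (cases "t \<ge> x + h")
      case True
      then show ?thesis using pos_powr_diff_bounds(4)[OF s h, of "x - t"] x h by simp
    next
      case False
      have "pos_powr_diff s h (x - t) \<le> (x + h) powr s"
        by (rule pos_powr_diff_bounds(3)[OF s h]) (use t0 x in auto)
      also have "(x + h) powr s = (x + h) * (x + h) powr (s - 1)"
        using x h by (simp add: powr_diff)
      also have "\<dots> \<le> (x + h) * t powr (s - 1)"
        using False t0 x h s by (intro mult_left_mono powr_mono2') auto
      finally show ?thesis .
    qed
    have "0 \<le> h * t powr (s - 1)" "0 \<le> (x + h) * t powr (s - 1)" using h x by auto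
    then show ?thesis
      using 1 2 pos_powr_diff_bounds(1)[OF s h, of "x + t"] pos_powr_diff_bounds(1)[OF s h, of "x - t"]
      unfolding d_def by (simp add: abs_le_iff algebra_simps)
  qed
  have intd: "set_integrable lborel {0<..} (\<lambda>t. d t * t powr (- 2 * s))"
  proof (rule set_integrable_bound)
    show "set_integrable lborel {0<..} (\<lambda>t. (if t < x / 2 then 2 * (x / 2) powr (s - 1) * t\<^sup>2
        else (2 * h + x) * t powr s) * t powr (- 1 - 2 * s))"
      using s x by (intro set_integrable_frac_dominant set_integrable_far_powr) auto
    have [measurable]: "d \<in> borel_measurable borel" unfolding d_def by measurable
    show "set_borel_measurable lborel {0<..} (\<lambda>t. d t * t powr (- 2 * s))"
      unfolding set_borel_measurable_def by measurable
    show "AE t in lborel. t \<in> {0<..} \<longrightarrow> norm (d t * t powr (- 2 * s)) \<le>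
      norm ((if t < x / 2 then 2 * (x / 2) powr (s - 1) * t\<^sup>2 else (2 * h + x) * t powr s) * t powr (- 1 - 2 * s))"
    proof (intro AE_I2 impI)
      fix t :: real assume "t \<in> {0<..}"
      then have t: "t > 0" by simp
      have p: "t powr (- 2 * s) = t * t powr (- 1 - 2 * s)"
        using t powr_add[of t 1 "- 1 - 2 * s"] by simp
      have q: "t powr s = t powr (s - 1) * t" using t by (simp add: powr_diff)
      have "\<bar>d t * t\<bar> \<le> \<bar>if t < x / 2 then 2 * (x / 2) powr (s - 1) * t\<^sup>2 else (2 * h + x) * t powr s\<bar>"
      proof (cases "t < x / 2")
        case True
        have "\<bar>d t\<bar> * t \<le> 2 * (x / 2) powr (s - 1) * t * t"
          using near[OF t True] t by (intro mult_right_mono) auto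
        then show ?thesis using True t by (simp add: abs_mult power2_eq_square mult.assoc)
      next
        case False
        have "\<bar>d t\<bar> * t \<le> (2 * h + x) * t powr (s - 1) * t"
          using far[of t] False t by (intro mult_right_mono) auto
        then show ?thesis using False t x h unfolding q by (simp add: abs_mult mult.assoc)
      qed
      then have "\<bar>d t * t\<bar> * t powr (- 1 - 2 * s) \<le> \<bar>if t < x / 2 then 2 * (x / 2) powr (s - 1) * t\<^sup>2 else (2 * h + x) * t powr s\<bar> * t powr (- 1 - 2 * s)"
        by (rule mult_right_mono) simp
      then show "norm (d t * t powr (- 2 * s)) \<le>
        norm ((if t < x / 2 then 2 * (x / 2) powr (s - 1) * t\<^sup>2 else (2 * h + x) * t powr s) * t powr (- 1 - 2 * s))"
        unfolding p real_norm_def abs_mult by simp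
    qed
  qed
  have intD: "set_integrable lborel {0<..} (\<lambda>t. D t * t powr (- 1 - 2 * s))"
    and LD: "(LBINT t:{0<..}. D t * t powr (- 1 - 2 * s)) = 0"
    using E0 by (auto simp: has_frac_lap_def has_bochner_integral_iff set_integrable_def set_lebesgue_integral_def D_def)
  \<comment> \<open>This is the derivative of D t t^(-2s). The boundary terms vanish, since D is
    O(t^2) at 0 and O(t^s) at infinity, so the integral of d t^(-2s) equals 2s times that of D
    t^(-1-2s), which is 0.\<close>
  define f where "f = (\<lambda>t. d t * t powr (- 2 * s) + (- 2 * s) * (D t * t powr (- 1 - 2 * s)))"
  have intf: "set_integrable lborel {0<..} f"
    unfolding f_def using intd intD by (intro set_integral_add set_integrable_mult_right)
  have e: "einterval (ereal 0) \<infinity> = {0<..}" by (auto simp: einterval_def)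
  have "(LBINT t=ereal 0..\<infinity>. f t) = 0 - 0"
  proof (rule interval_integral_FTC_integrable[where F = "\<lambda>t. D t * t powr (- 2 * s)"])
    show "((\<lambda>t. D t * t powr (- 2 * s)) has_vector_derivative f t) (at t)" if "ereal 0 < ereal t" for t
    proof -
      have t: "t > 0" using that by simp
      have "((\<lambda>t. t powr (- 2 * s)) has_real_derivative (- 2 * s) * t powr (- 2 * s - 1)) (at t)"
        using t by (rule has_real_derivative_powr)
      from DERIV_mult[OF DD[of t] this]
      have "((\<lambda>t. D t * t powr (- 2 * s)) has_real_derivative f t) (at t)"
      proof (rule DERIV_cong)
        have "- 2 * s - 1 = - 1 - 2 * s" by simp
        then have "t powr (- 2 * s - 1) = t powr (- 1 - 2 * s)" by (simp only:)
        then show "d t * t powr (- 2 * s) + (- 2 * s) * t powr (- 2 * s - 1) * D t = f t"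
          unfolding f_def by (simp only: mult_ac)
      qed
      then show ?thesis by (simp add: has_real_derivative_iff_has_vector_derivative)
    qed
    show "isCont f t" if "ereal 0 < ereal t" for t
      unfolding f_def using that contd DERIV_isCont[OF DD] by (intro continuous_intros) auto
    have "((\<lambda>t. D t * t powr (- 2 * s)) \<longlongrightarrow> 0) (at_right 0)"
    proof (rule Lim_null_comparison)
      show "((\<lambda>t. 2 * (x / 2) powr (s - 1) * t powr (2 - 2 * s)) \<longlongrightarrow> 0) (at_right 0)"
        using s by real_asymp
      have "norm (D t * t powr (- 2 * s)) \<le> 2 * (x / 2) powr (s - 1) * t powr (2 - 2 * s)" if t: "0 < t" "t < x / 2" for t
      proof -
        have "\<exists>\<xi>>0. \<xi> < t \<and> D t - D 0 = (t - 0) * d \<xi>"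
          by (rule MVT2[OF t(1)]) (rule DD)
        then obtain \<xi> where \<xi>: "0 < \<xi>" "\<xi> < t" "D t = t * d \<xi>"
          by (auto simp: D_def second_diff_def)
        have "\<bar>d \<xi>\<bar> \<le> 2 * (x / 2) powr (s - 1) * \<xi>" using near[of \<xi>] \<xi> t by auto
        also have "\<dots> \<le> 2 * (x / 2) powr (s - 1) * t" using \<xi> by (intro mult_left_mono) auto
        finally have "\<bar>D t\<bar> \<le> t * (2 * (x / 2) powr (s - 1) * t)"
          using \<xi> t by (simp add: abs_mult)
        then have "\<bar>D t\<bar> * t powr (- 2 * s) \<le> t * (2 * (x / 2) powr (s - 1) * t) * t powr (- 2 * s)"
          by (rule mult_right_mono) simp
        also have "t * (2 * (x / 2) powr (s - 1) * t) * t powr (- 2 * s) = 2 * (x / 2) powr (s - 1) * (t powr 2 * t powr (- 2 * s))"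
          using t by (simp add: power2_eq_square)
        also have "t powr 2 * t powr (- 2 * s) = t powr (2 - 2 * s)" by (simp flip: powr_add)
        finally show ?thesis by (simp add: abs_mult)
      qed
      then show "\<forall>\<^sub>F t in at_right 0. norm (D t * t powr (- 2 * s)) \<le> 2 * (x / 2) powr (s - 1) * t powr (2 - 2 * s)"
        using x by (intro eventually_at_rightI[of 0 "x / 2"]) auto
    qed
    then show "(((\<lambda>t. D t * t powr (- 2 * s)) \<circ> real_of_ereal) \<longlongrightarrow> 0) (at_right (ereal 0))"
      by (simp only: ereal_tendsto_simps)
    have "((\<lambda>t. D t * t powr (- 2 * s)) \<longlongrightarrow> 0) at_top"
    proof (rule Lim_null_comparison)
      show "((\<lambda>t. 4 * h * 2 powr s * t powr (- s)) \<longlongrightarrow> 0) at_top"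
        using s by real_asymp
      have Eb: "0 \<le> E z \<and> E z \<le> h * pos_powr s (z + h)" for z
      proof -
        have "\<exists>\<xi>>z. \<xi> < z + h \<and> G (z + h) - G z = (z + h - z) * pos_powr s \<xi>"
          by (rule MVT2) (use h G in auto)
        then obtain \<xi> where \<xi>: "\<xi> > z" "\<xi> < z + h" "E z = h * pos_powr s \<xi>" by (auto simp: EG)
        have "pos_powr s \<xi> \<le> pos_powr s (z + h)" using \<xi> s by (intro pos_powr_mono) auto
        then show ?thesis using \<xi> h pos_powr_nonneg by (auto intro: mult_left_mono)
      qed
      have "norm (D t * t powr (- 2 * s)) \<le> 4 * h * 2 powr s * t powr (- s)" if t: "t \<ge> x + h" for t
      proof -
        have t0: "t > 0" using t x h by simp
        have p: "pos_powr s (z + h) \<le> 2 powr s * t powr s" if "z \<le> x + t" for z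
        proof -
          have "pos_powr s (z + h) \<le> pos_powr s (2 * t)" using that t s by (intro pos_powr_mono) auto
          then show ?thesis using t0 by (simp add: pos_powr_pos powr_mult)
        qed
        have "E z \<le> h * (2 powr s * t powr s)" if "z \<le> x + t" for z
          using Eb[of z] mult_left_mono[OF p[OF that], of h] h by linarith
        from this[of "x + t"] this[of "x - t"] this[of x] Eb[of "x + t"] Eb[of "x - t"] Eb[of x] t0
        have "\<bar>D t\<bar> \<le> 4 * (h * (2 powr s * t powr s))"
          unfolding D_def second_diff_def by (simp add: abs_le_iff)
        then have "\<bar>D t\<bar> * t powr (- 2 * s) \<le> 4 * (h * (2 powr s * t powr s)) * t powr (- 2 * s)"
          by (rule mult_right_mono) simp
        also have "\<dots> = 4 * h * 2 powr s * (t powr s * t powr (- 2 * s))" by simp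
        also have "t powr s * t powr (- 2 * s) = t powr (- s)" by (simp flip: powr_add)
        finally show ?thesis by (simp add: abs_mult)
      qed
      then show "\<forall>\<^sub>F t in at_top. norm (D t * t powr (- 2 * s)) \<le> 4 * h * 2 powr s * t powr (- s)"
        by (intro eventually_at_top_linorderI[of "x + h"]) auto
    qed
    then show "(((\<lambda>t. D t * t powr (- 2 * s)) \<circ> real_of_ereal) \<longlongrightarrow> 0) (at_left \<infinity>)"
      by (simp only: ereal_tendsto_simps)
  qed (use intf e in auto)
  then have "(LBINT t:{0<..}. f t) = 0" by (simp add: interval_lebesgue_integral_def e)
  moreover have "(LBINT t:{0<..}. f t) = (LBINT t:{0<..}. d t * t powr (- 2 * s)) + (- 2 * s) * (LBINT t:{0<..}. D t * t powr (- 1 - 2 * s))"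
    unfolding f_def set_integral_add(2)[OF intd set_integrable_mult_right[OF intD]] set_integral_mult_right ..
  ultimately have "(LBINT t:{0<..}. d t * t powr (- 2 * s)) = 0" using LD by simp
  with intd show ?thesis
    by (simp add: has_bochner_integral_iff set_integrable_def set_lebesgue_integral_def d_def)
qed

section \<open>Stable operators and viscosity inequalities\<close>

lemma integrable_nonneg_bound:
  fixes f g :: "'a \<Rightarrow> real"
  assumes "integrable M g" "f \<in> borel_measurable M" "\<And>x. 0 \<le> f x" "\<And>x. f x \<le> g x"
  shows "integrable M f"
  using assms(1,2)
proof (rule Bochner_Integration.integrable_bound)
  have "norm (f x) \<le> norm (g x)" for x using assms(3,4)[of x] by simp
  then show "AE x in M. norm (f x) \<le> norm (g x)" by simp
qed

lemma integrable_weight_real: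
  fixes \<epsilon> :: real
  assumes "\<epsilon> > 0"
  shows "integrable lborel (\<lambda>t::real. (1 + \<bar>t\<bar>) powr (- 1 - \<epsilon>))"
proof (rule integrable_nonneg_bound)
  have i: "integrable lborel (\<lambda>t::real. indicator {1..} t * t powr (- 1 - \<epsilon>))"
    using set_integrable_powr_at_top'[of "- 1 - \<epsilon>" 1] assms by (simp add: set_integrable_def)
  have "integrable lborel (\<lambda>t::real. indicator {1..} (0 + (- 1) * t) * (0 + (- 1) * t) powr (- 1 - \<epsilon>))"
    using i by (rule lborel_integrable_real_affine) simp
  then have i': "integrable lborel (\<lambda>t::real. indicator {1..} (- t) * (- t) powr (- 1 - \<epsilon>))" by simp
  show "integrable lborel (\<lambda>t::real. indicator {-1..1} t + (indicator {1..} t * t powr (- 1 - \<epsilon>)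
      + indicator {1..} (- t) * (- t) powr (- 1 - \<epsilon>)))"
    by (intro Bochner_Integration.integrable_add i i' integrable_real_indicator) auto
  show "(1 + \<bar>t\<bar>) powr (- 1 - \<epsilon>) \<le> indicator {-1..1} t + (indicator {1..} t * t powr (- 1 - \<epsilon>)
      + indicator {1..} (- t) * (- t) powr (- 1 - \<epsilon>))" for t :: real
  proof -
    consider "t \<in> {-1..1}" | "t > 1" | "t < -1" by fastforce
    then show ?thesis
    proof cases
      case 1
      have "(1 + \<bar>t\<bar>) powr (- 1 - \<epsilon>) \<le> 1 powr (- 1 - \<epsilon>)" using assms by (intro powr_mono2') auto
      then have "(1 + \<bar>t\<bar>) powr (- 1 - \<epsilon>) \<le> 1" by simp
      moreover have "0 \<le> indicator {1..} t * t powr (- 1 - \<epsilon>) + indicator {1..} (- t) * (- t) powr (- 1 - \<epsilon>)"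
        by (intro add_nonneg_nonneg mult_nonneg_nonneg) auto
      moreover have "indicator {-1..1} t = (1 :: real)" using 1 by simp
      ultimately show ?thesis by linarith
    next
      case 2
      then have "(1 + \<bar>t\<bar>) powr (- 1 - \<epsilon>) \<le> t powr (- 1 - \<epsilon>)" using assms by (intro powr_mono2') auto
      then show ?thesis using 2 by (auto simp: indicator_def)
    next
      case 3
      then have "(1 + \<bar>t\<bar>) powr (- 1 - \<epsilon>) \<le> (- t) powr (- 1 - \<epsilon>)" using assms by (intro powr_mono2') auto
      then show ?thesis using 3 by (auto simp: indicator_def)
    qed
  qed
qed auto

text \<open>A product over the coordinates integrates by Tonelli to a power of a one-dimensional
  integral. All n-dimensional decay estimates below are reduced to this weight, without polar
  coordinates.\<close>

lemma integrable_weight_prod: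
  fixes \<epsilon> :: real
  assumes "\<epsilon> > 0"
  shows "integrable lborel (\<lambda>x::'a::euclidean_space. \<Prod>b\<in>Basis. (1 + \<bar>x \<bullet> b\<bar>) powr (- 1 - \<epsilon>))"
proof (rule integrableI_nonneg)
  have "integral\<^sup>N lborel (\<lambda>x::'a. ennreal (\<Prod>b\<in>Basis. (1 + \<bar>x \<bullet> b\<bar>) powr (- 1 - \<epsilon>)))
      = integral\<^sup>N lborel (\<lambda>x::'a. (\<Prod>b\<in>Basis. ennreal ((1 + \<bar>x \<bullet> b\<bar>) powr (- 1 - \<epsilon>))))"
    by (simp add: prod_ennreal)
  also have "\<dots> = (\<Prod>b\<in>(Basis::'a set). \<integral>\<^sup>+ t. ennreal ((1 + \<bar>t\<bar>) powr (- 1 - \<epsilon>)) \<partial>lborel)"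
    by (rule nn_integral_lborel_prod[where f = "\<lambda>b t. ennreal ((1 + \<bar>t\<bar>) powr (- 1 - \<epsilon>))"]) auto
  also have "\<dots> < \<infinity>"
    by (simp add: nn_integral_eq_integral[OF integrable_weight_real[OF assms]] ennreal_power)
  finally show "integral\<^sup>N lborel (\<lambda>x::'a. ennreal (\<Prod>b\<in>Basis. (1 + \<bar>x \<bullet> b\<bar>) powr (- 1 - \<epsilon>))) < \<infinity>" .
qed (auto intro!: prod_nonneg)

text \<open>Distribute the exponent n + \<sigma> equally over the n coordinates as 1 + \<sigma> / n,
  and in each factor replace the norm by the smaller coordinate.\<close>

lemma integrable_weight:
  fixes \<sigma> :: real
  assumes "\<sigma> > 0"
  shows "integrable lborel (\<lambda>x::real ^ 'n. (1 + norm x) powr (- real CARD('n) - \<sigma>))"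
proof (rule integrable_nonneg_bound)
  define \<epsilon> where "\<epsilon> = \<sigma> / real CARD('n)"
  have \<epsilon>: "\<epsilon> > 0" using assms by (simp add: \<epsilon>_def)
  show "integrable lborel (\<lambda>x::real ^ 'n. \<Prod>b\<in>Basis. (1 + \<bar>x \<bullet> b\<bar>) powr (- 1 - \<epsilon>))"
    by (rule integrable_weight_prod[OF \<epsilon>])
  show "(1 + norm x) powr (- real CARD('n) - \<sigma>) \<le> (\<Prod>b\<in>Basis. (1 + \<bar>x \<bullet> b\<bar>) powr (- 1 - \<epsilon>))" for x :: "real ^ 'n"
  proof -
    have "(1 + norm x) powr (- real CARD('n) - \<sigma>) = (1 + norm x) powr ((- 1 - \<epsilon>) * real (card (Basis :: (real ^ 'n) set)))"
      by (rule arg_cong[of _ _ "\<lambda>e. (1 + norm x) powr e"]) (simp add: \<epsilon>_def field_simps)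
    also have "\<dots> = (\<Prod>b\<in>(Basis :: (real ^ 'n) set). (1 + norm x) powr (- 1 - \<epsilon>))"
      using add_pos_nonneg[OF zero_less_one norm_ge_zero[of x]] by (simp add: powr_powr[symmetric] powr_realpow)
    also have "\<dots> \<le> (\<Prod>b\<in>Basis. (1 + \<bar>x \<bullet> b\<bar>) powr (- 1 - \<epsilon>))"
      using \<epsilon> by (intro prod_mono conjI powr_mono2') (auto simp: Basis_le_norm)
    finally show ?thesis .
  qed
qed auto

lemma integrable_tail:
  fixes \<sigma> :: real
  assumes "\<sigma> > 0"
  shows "integrable lborel (\<lambda>x::real ^ 'n. indicator {x. norm x \<ge> 1} x * norm x powr (- real CARD('n) - \<sigma>))"
proof (rule integrable_nonneg_bound)
  define e where "e = - real CARD('n) - \<sigma>"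
  show "integrable lborel (\<lambda>x::real ^ 'n. (1 / 2) powr e * (1 + norm x) powr e)"
    using integrable_weight[OF assms, where 'n = 'n] by (intro integrable_mult_right) (simp add: e_def)
  show "indicator {x. norm x \<ge> 1} x * norm x powr e \<le> (1 / 2) powr e * (1 + norm x) powr e" for x :: "real ^ 'n"
  proof (cases "norm x \<ge> 1")
    case True
    have "norm x powr e \<le> (1 / 2 * (1 + norm x)) powr e"
      using True assms by (intro powr_mono2') (auto simp: e_def)
    also have "\<dots> = (1 / 2) powr e * (1 + norm x) powr e" by (rule powr_mult)
    finally show ?thesis using True by simp
  qed auto
qed auto

text \<open>The factor norm y costs one power of decay, and for s \<le> 1/2 the norm alone would no
  longer decay fast enough; the division by the k-th coordinate has to make up for it. With n
  \<epsilon> = s the inequality 1 - n - 2s \<le> -\<epsilon> - (1 + \<epsilon>)(n - 1) leaves a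
  factor N^(-\<epsilon>) for the coordinate k and N^(-1-\<epsilon>) for every other one.\<close>

lemma integrable_cross_tail:
  fixes s :: real and k :: "'n::finite"
  assumes s: "s > 0"
  shows "integrable lborel (\<lambda>y::real ^ 'n. indicator {y. \<bar>y $ k\<bar> > 1} y *
    (norm y / \<bar>y $ k\<bar> * norm y powr (- real CARD('n) - 2 * s)))"
proof (rule integrable_nonneg_bound)
  define n where "n = real CARD('n)"
  define \<epsilon> where "\<epsilon> = s / n"
  have n: "n \<ge> 1" by (simp add: n_def Suc_leI)
  have \<epsilon>: "\<epsilon> > 0" "n * \<epsilon> = s" using s n by (auto simp: \<epsilon>_def)
  define c where "c = (1 / 2 :: real) powr (- 1 - \<epsilon>)"
  show "integrable lborel (\<lambda>x::real ^ 'n. c ^ CARD('n) * (\<Prod>b\<in>Basis. (1 + \<bar>x \<bullet> b\<bar>) powr (- 1 - \<epsilon>)))"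
    by (rule integrable_mult_right[OF integrable_weight_prod[OF \<epsilon>(1)]])
  show "indicator {y. \<bar>y $ k\<bar> > 1} y * (norm y / \<bar>y $ k\<bar> * norm y powr (- n - 2 * s))
      \<le> c ^ CARD('n) * (\<Prod>b\<in>Basis. (1 + \<bar>y \<bullet> b\<bar>) powr (- 1 - \<epsilon>))" for y :: "real ^ 'n"
  proof (cases "\<bar>y $ k\<bar> > 1")
    case True
    define N where "N = norm y"
    have N: "N \<ge> \<bar>y $ k\<bar>" "N > 1" using True component_le_norm_cart[of y k] by (auto simp: N_def)
    \<comment> \<open>Halving makes each a b at most N, as N > 1, and makes the k-th one at most the
      k-th coordinate itself, which exceeds 1 in absolute value.\<close>
    define a where "a = (\<lambda>b. 1 / 2 * (1 + \<bar>y \<bullet> b\<bar>))"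
    have a: "0 < a b" "b \<in> Basis \<Longrightarrow> a b \<le> N" for b
      using N Basis_le_norm[of b y] by (auto simp: a_def N_def)
    have kB: "axis k 1 \<in> (Basis :: (real ^ 'n) set)" by (simp add: axis_in_Basis_iff)
    have yk: "y \<bullet> axis k 1 = y $ k" by (simp add: inner_axis)
    have ak: "a (axis k 1) \<le> \<bar>y $ k\<bar>" using True by (simp add: a_def yk)
    have "N powr 1 * N powr (- n - 2 * s) = N powr (1 - n - 2 * s)"
      by (subst powr_add[symmetric]) (rule arg_cong[of _ _ "\<lambda>e. N powr e"], simp)
    also have "\<dots> \<le> N powr (- \<epsilon> + (- 1 - \<epsilon>) * (n - 1))"
      using N s \<epsilon> by (intro powr_mono) (auto simp: algebra_simps)
    also have "\<dots> = N powr (- \<epsilon>) * (\<Prod>b\<in>Basis - {axis k 1 :: real ^ 'n}. N powr (- 1 - \<epsilon>))"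
    proof -
      have "card (Basis - {axis k 1 :: real ^ 'n}) = CARD('n) - 1"
        using kB by (simp add: card_Diff_singleton)
      moreover have "N powr ((- 1 - \<epsilon>) * (n - 1)) = (N powr (- 1 - \<epsilon>)) ^ (CARD('n) - 1)"
      proof -
        have "n - 1 = real (CARD('n) - 1)" by (simp add: n_def of_nat_diff Suc_leI)
        then show ?thesis using N by (simp only: powr_powr[symmetric]) (subst powr_realpow, auto)
      qed
      ultimately show ?thesis by (simp only: powr_add prod_constant)
    qed
    finally have inner: "N powr 1 * N powr (- n - 2 * s) \<le> \<dots>" .
    have "N / \<bar>y $ k\<bar> * N powr (- n - 2 * s) = (1 / \<bar>y $ k\<bar>) * (N powr 1 * N powr (- n - 2 * s))"
      using N by simp
    also have "\<dots> \<le> (1 / \<bar>y $ k\<bar>) * (N powr (- \<epsilon>) * (\<Prod>b\<in>Basis - {axis k 1 :: real ^ 'n}. N powr (- 1 - \<epsilon>)))"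
      using inner by (rule mult_left_mono) simp
    also have "\<dots> \<le> (1 / a (axis k 1)) * (a (axis k 1) powr (- \<epsilon>) * (\<Prod>b\<in>Basis - {axis k 1}. a b powr (- 1 - \<epsilon>)))"
      using ak a kB \<epsilon> by (intro mult_mono prod_mono conjI powr_mono2' frac_le mult_nonneg_nonneg prod_nonneg) (auto simp: less_imp_le)
    also have "\<dots> = a (axis k 1) powr (- 1 - \<epsilon>) * (\<Prod>b\<in>Basis - {axis k 1}. a b powr (- 1 - \<epsilon>))"
      using a[of "axis k 1"] by (simp add: powr_diff powr_minus divide_inverse)
    also have "\<dots> = (\<Prod>b\<in>Basis. a b powr (- 1 - \<epsilon>))"
      by (subst prod.remove[OF _ kB]) simp_all
    also have "\<dots> = (\<Prod>b\<in>Basis. c * (1 + \<bar>y \<bullet> b\<bar>) powr (- 1 - \<epsilon>))"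
      unfolding a_def c_def by (intro prod.cong refl powr_mult)
    also have "\<dots> = c ^ CARD('n) * (\<Prod>b\<in>Basis. (1 + \<bar>y \<bullet> b\<bar>) powr (- 1 - \<epsilon>))"
      by (simp add: prod.distrib)
    finally show ?thesis using True by (simp add: N_def)
  next
    case False
    then show ?thesis by (auto simp: c_def intro!: mult_nonneg_nonneg prod_nonneg)
  qed
qed auto

section \<open>Push-forward of homogeneous kernels to the half-line\<close>

lemma nn_integral_lborel_scale:
  fixes f :: "real ^ 'n \<Rightarrow> ennreal"
  assumes [measurable]: "f \<in> borel_measurable borel" and r: "r > 0"
  shows "(\<integral>\<^sup>+ y. f y \<partial>lborel) = ennreal (r ^ CARD('n)) * (\<integral>\<^sup>+ y. f (r *\<^sub>R y) \<partial>lborel)"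
proof -
  have "(\<integral>\<^sup>+ y. f y \<partial>lborel) = (\<integral>\<^sup>+ y. f y \<partial>density (distr lborel borel (\<lambda>x. 0 + r *\<^sub>R x)) (\<lambda>x. ennreal (\<bar>r\<bar> ^ DIM(real ^ 'n))))"
    using lborel_affine[of r "0 :: real ^ 'n"] r by simp
  also have "\<dots> = ennreal (r ^ CARD('n)) * (\<integral>\<^sup>+ y. f (r *\<^sub>R y) \<partial>lborel)"
    using r by (simp add: nn_integral_density nn_integral_distr nn_integral_cmult)
  finally show ?thesis .
qed

text \<open>A measure on the half-line that scales like \<open>t\<^sup>-\<^sup>1\<^sup>-\<^sup>2\<^sup>s dt\<close> is a multiple of it.\<close>

lemma nn_integral_homogeneous:
  fixes K :: "real ^ 'n \<Rightarrow> real" and T :: "real ^ 'n \<Rightarrow> real" and f :: "real \<Rightarrow> ennreal"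
  assumes s: "s > 0"
    and K[measurable]: "K \<in> borel_measurable borel" and K0: "\<And>y. K y \<ge> 0"
    and Kh: "\<And>r y. r > 0 \<Longrightarrow> K (r *\<^sub>R y) = r powr (- real CARD('n) - 2 * s) * K y"
    and T[measurable]: "T \<in> borel_measurable borel"
    and Th: "\<And>r y. r > 0 \<Longrightarrow> T (r *\<^sub>R y) = r * T y"
    and m: "(\<integral>\<^sup>+ y. indicator {y. T y > 1} y * ennreal (K y) \<partial>lborel) = ennreal m" "m \<ge> 0"
    and f[measurable]: "f \<in> borel_measurable borel"
  shows "(\<integral>\<^sup>+ y. indicator {y. T y > 0} y * (ennreal (K y) * f (T y)) \<partial>lborel)
    = (\<integral>\<^sup>+ t. indicator {0<..} t * (ennreal (2 * s * m * t powr (- 1 - 2 * s)) * f t) \<partial>lborel)"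
proof -
  \<comment> \<open>With this constant the integral of c t^(-1-2s) over (a, \<infinity>) is m
    a^(-2s), the mass that homogeneity assigns to the set where T exceeds a.\<close>
  define c where "c = 2 * s * m"
  have c: "c \<ge> 0" using s m by (simp add: c_def)
  have tail: "(\<integral>\<^sup>+ y. indicator {y. T y > a} y * ennreal (K y) \<partial>lborel) = ennreal (m * a powr (- 2 * s))" if a: "a > 0" for a
  proof -
    have "(\<integral>\<^sup>+ y. indicator {y. T y > a} y * ennreal (K y) \<partial>lborel)
        = ennreal (a ^ CARD('n)) * (\<integral>\<^sup>+ y. indicator {y. T y > a} (a *\<^sub>R y) * ennreal (K (a *\<^sub>R y)) \<partial>lborel)"
      by (rule nn_integral_lborel_scale[OF _ a]) measurable
    also have "(\<lambda>y. indicator {y. T y > a} (a *\<^sub>R y) * ennreal (K (a *\<^sub>R y)))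
        = (\<lambda>y. ennreal (a powr (- real CARD('n) - 2 * s)) * (indicator {y. T y > 1} y * ennreal (K y)))"
      using a K0 by (auto simp: fun_eq_iff Kh Th indicator_def ennreal_mult' mult.commute)
    also have "(\<integral>\<^sup>+ y. ennreal (a powr (- real CARD('n) - 2 * s)) * (indicator {y. T y > 1} y * ennreal (K y)) \<partial>lborel)
        = ennreal (a powr (- real CARD('n) - 2 * s)) * ennreal m"
      by (subst nn_integral_cmult) (use m in auto)
    also have "ennreal (a ^ CARD('n)) * \<dots> = ennreal (a powr real CARD('n) * a powr (- real CARD('n) - 2 * s) * m)"
      using a m by (simp add: powr_realpow ennreal_mult'' mult.assoc)
    also have "a powr real CARD('n) * a powr (- real CARD('n) - 2 * s) = a powr (- 2 * s)"
      by (subst powr_add[symmetric]) (rule arg_cong[of _ _ "\<lambda>e. a powr e"], simp)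
    finally show ?thesis by (simp add: mult.commute)
  qed
  have tail1: "(\<integral>\<^sup>+ t. indicator {a<..} t * ennreal (c * t powr (- 1 - 2 * s)) \<partial>lborel) = ennreal (m * a powr (- 2 * s))"
    if a: "a > 0" for a
  proof -
    have i: "set_integrable lborel {a<..} (\<lambda>t. c * t powr (- 1 - 2 * s))"
      using s a by (intro set_integrable_mult_right set_integrable_powr_at_top) auto
    have "(\<integral>\<^sup>+ t. indicator {a<..} t * ennreal (c * t powr (- 1 - 2 * s)) \<partial>lborel)
        = (\<integral>\<^sup>+ t. ennreal (indicator {a<..} t * (c * t powr (- 1 - 2 * s))) \<partial>lborel)"
      by (intro nn_integral_cong) (auto simp: indicator_def)
    also have "\<dots> = ennreal (LBINT t. indicator {a<..} t * (c * t powr (- 1 - 2 * s)))"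
      using i c by (intro nn_integral_eq_integral) (auto simp: set_integrable_def)
    also have "(LBINT t. indicator {a<..} t * (c * t powr (- 1 - 2 * s))) = c * (a powr (- 2 * s) / (2 * s))"
      using set_integrable_powr_at_top(2)[of "- 1 - 2 * s" a] s a
      by (simp add: set_lebesgue_integral_def mult.left_commute)
    also have "\<dots> = m * a powr (- 2 * s)" using s by (simp add: c_def)
    finally show ?thesis .
  qed
  \<comment> \<open>Both measures may have infinite mass near 0. Cut off at \<epsilon> they are
    finite and agree on all rays, hence are equal; the cutoff is removed by monotone convergence
    along 1 / (n + 1).\<close>
  have eps: "(\<integral>\<^sup>+ y. indicator {y. T y > \<epsilon>} y * (ennreal (K y) * f (T y)) \<partial>lborel)
      = (\<integral>\<^sup>+ t. indicator {\<epsilon><..} t * (ennreal (c * t powr (- 1 - 2 * s)) * f t) \<partial>lborel)" if \<epsilon>: "\<epsilon> > 0" for \<epsilon>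
  proof -
    define N where "N = distr (density lborel (\<lambda>y. indicator {y. T y > \<epsilon>} y * ennreal (K y))) borel T"
    define M where "M = density lborel (\<lambda>t. indicator {\<epsilon><..} t * ennreal (c * t powr (- 1 - 2 * s)))"
    have N: "emeasure N {a<..} = ennreal (m * (max a \<epsilon>) powr (- 2 * s))" for a
    proof -
      have [measurable]: "T -` {a<..} \<in> sets borel"
        using measurable_sets[OF T, of "{a<..}"] by simp
      have "emeasure N {a<..} = (\<integral>\<^sup>+ y. (indicator {y. T y > \<epsilon>} y * ennreal (K y)) * indicator (T -` {a<..}) y \<partial>lborel)"
        unfolding N_def by (subst emeasure_distr) (auto simp: emeasure_density)
      also have "\<dots> = (\<integral>\<^sup>+ y. indicator {y. T y > max a \<epsilon>} y * ennreal (K y) \<partial>lborel)"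
        by (intro nn_integral_cong) (auto simp: indicator_def)
      finally show ?thesis using tail[of "max a \<epsilon>"] \<epsilon> by simp
    qed
    have M: "emeasure M {a<..} = ennreal (m * (max a \<epsilon>) powr (- 2 * s))" for a
    proof -
      have "emeasure M {a<..} = (\<integral>\<^sup>+ t. (indicator {\<epsilon><..} t * ennreal (c * t powr (- 1 - 2 * s))) * indicator {a<..} t \<partial>lborel)"
        unfolding M_def by (simp add: emeasure_density)
      also have "\<dots> = (\<integral>\<^sup>+ t. indicator {max a \<epsilon><..} t * ennreal (c * t powr (- 1 - 2 * s)) \<partial>lborel)"
        by (intro nn_integral_cong) (auto simp: indicator_def)
      finally show ?thesis using tail1[of "max a \<epsilon>"] \<epsilon> by simp
    qed
    have "N = M" by (rule measure_eqI_lessThan) (auto simp: N M, auto simp: N_def M_def)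
    then have "(\<integral>\<^sup>+ t. f t \<partial>N) = (\<integral>\<^sup>+ t. f t \<partial>M)" by simp
    then show ?thesis
      unfolding N_def M_def by (simp add: nn_integral_distr nn_integral_density mult.assoc)
  qed
  have sup: "(\<integral>\<^sup>+ z. indicator {z. S z > 0} z * g z \<partial>lborel) = (SUP n. \<integral>\<^sup>+ z. indicator {z. S z > inverse (real (Suc n))} z * g z \<partial>lborel)"
    if [measurable]: "S \<in> borel_measurable borel" "g \<in> borel_measurable borel" for S :: "'b::euclidean_space \<Rightarrow> real" and g
  proof -
    have "(\<integral>\<^sup>+ z. (SUP n. indicator {z. S z > inverse (real (Suc n))} z * g z) \<partial>lborel)
        = (SUP n. \<integral>\<^sup>+ z. indicator {z. S z > inverse (real (Suc n))} z * g z \<partial>lborel)"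
    proof (rule nn_integral_monotone_convergence_SUP)
      show "incseq (\<lambda>n z. indicator {z. S z > inverse (real (Suc n))} z * g z)"
      proof (intro incseq_SucI le_funI mult_right_mono)
        fix n z
        have "inverse (real (Suc (Suc n))) \<le> inverse (real (Suc n))" by (intro le_imp_inverse_le) auto
        then have "inverse (real (Suc (Suc n))) < S z" if "inverse (real (Suc n)) < S z"
          using that by (rule order.strict_trans1)
        then show "indicator {z. S z > inverse (real (Suc n))} z \<le> (indicator {z. S z > inverse (real (Suc (Suc n)))} z :: ennreal)"
          by (auto simp: indicator_def simp del: of_nat_Suc)
      qed simp
    qed measurable
    moreover have "(SUP n. indicator {z. S z > inverse (real (Suc n))} z * g z) = indicator {z. S z > 0} z * g z" for z
    proof (cases "S z > 0")
      case True
      then obtain n where n: "inverse (real (Suc n)) < S z" using reals_Archimedean by blast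
      show ?thesis
      proof (rule antisym)
        show "(SUP n. indicator {z. S z > inverse (real (Suc n))} z * g z) \<le> indicator {z. S z > 0} z * g z"
          using True by (intro SUP_least) (auto simp: indicator_def)
        show "indicator {z. S z > 0} z * g z \<le> (SUP n. indicator {z. S z > inverse (real (Suc n))} z * g z)"
          by (rule SUP_upper2[of n]) (use True n in auto)
      qed
    next
      case False
      have "\<not> inverse (real (Suc n)) < S z" for n
        using False by (meson inverse_positive_iff_positive le_less_trans not_less of_nat_0_less_iff order.strict_implies_order zero_less_Suc)
      then show ?thesis using False by simp
    qed
    ultimately show ?thesis by simp
  qed
  have "(\<integral>\<^sup>+ y. indicator {y. T y > 0} y * (ennreal (K y) * f (T y)) \<partial>lborel)
      = (SUP n. \<integral>\<^sup>+ y. indicator {y. T y > inverse (real (Suc n))} y * (ennreal (K y) * f (T y)) \<partial>lborel)"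
    by (rule sup) measurable
  also have "\<dots> = (SUP n. \<integral>\<^sup>+ t. indicator {t. t > inverse (real (Suc n))} t * (ennreal (c * t powr (- 1 - 2 * s)) * f t) \<partial>lborel)"
    by (subst eps) (auto simp: greaterThan_def)
  also have "\<dots> = (\<integral>\<^sup>+ t. indicator {t. t > 0} t * (ennreal (c * t powr (- 1 - 2 * s)) * f t) \<partial>lborel)"
    by (rule sup[symmetric]) measurable
  finally show ?thesis by (simp add: c_def greaterThan_def)
qed

text \<open>Positive and negative part are treated separately. The condition f 0 = 0 deals with the
  set where T vanishes, which leaves no trace in the integral over t > 0.\<close>

lemma has_bochner_integral_homogeneous:
  fixes K :: "real ^ 'n \<Rightarrow> real" and T :: "real ^ 'n \<Rightarrow> real" and f :: "real \<Rightarrow> real"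
  assumes s: "s > 0"
    and K[measurable]: "K \<in> borel_measurable borel" and K0: "\<And>y. K y \<ge> 0"
    and Kh: "\<And>r y. r > 0 \<Longrightarrow> K (r *\<^sub>R y) = r powr (- real CARD('n) - 2 * s) * K y"
    and T[measurable]: "T \<in> borel_measurable borel" and T0: "\<And>y. T y \<ge> 0"
    and Th: "\<And>r y. r > 0 \<Longrightarrow> T (r *\<^sub>R y) = r * T y"
    and m: "integrable lborel (\<lambda>y. indicator {y. T y > 1} y * K y)"
    and f[measurable]: "f \<in> borel_measurable borel" and f0: "f 0 = 0"
    and I: "has_bochner_integral lborel (\<lambda>t. indicator {0<..} t * (f t * t powr (- 1 - 2 * s))) I"
  shows "has_bochner_integral lborel (\<lambda>y. f (T y) * K y)
    (2 * s * (LBINT y. indicator {y. T y > 1} y * K y) * I)"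
proof -
  define m' where "m' = (LBINT y. indicator {y. T y > 1} y * K y)"
  have m0: "m' \<ge> 0" unfolding m'_def using K0 by (intro Bochner_Integration.integral_nonneg) simp
  have m': "(\<integral>\<^sup>+ y. indicator {y. T y > 1} y * ennreal (K y) \<partial>lborel) = ennreal m'"
  proof -
    have "(\<integral>\<^sup>+ y. indicator {y. T y > 1} y * ennreal (K y) \<partial>lborel) = (\<integral>\<^sup>+ y. ennreal (indicator {y. T y > 1} y * K y) \<partial>lborel)"
      by (intro nn_integral_cong) (auto simp: indicator_def)
    also have "\<dots> = ennreal m'" unfolding m'_def using m K0 by (intro nn_integral_eq_integral) auto
    finally show ?thesis .
  qed
  have nonneg: "has_bochner_integral lborel (\<lambda>y. g (T y) * K y)
      (2 * s * m' * (LBINT t. indicator {0<..} t * (g t * t powr (- 1 - 2 * s))))"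
    if [measurable]: "g \<in> borel_measurable borel" and g0: "g 0 = 0" and g: "\<And>t. g t \<ge> 0"
      and gi: "integrable lborel (\<lambda>t. indicator {0<..} t * (g t * t powr (- 1 - 2 * s)))" for g :: "real \<Rightarrow> real"
  proof (rule has_bochner_integral_nn_integral)
    define J where "J = (LBINT t. indicator {0<..} t * (g t * t powr (- 1 - 2 * s)))"
    have "(\<integral>\<^sup>+ y. ennreal (g (T y) * K y) \<partial>lborel) = (\<integral>\<^sup>+ y. indicator {y. T y > 0} y * (ennreal (K y) * ennreal (g (T y))) \<partial>lborel)"
    proof (intro nn_integral_cong)
      fix y
      have "T y = 0 \<or> T y > 0" using T0[of y] by auto
      then show "ennreal (g (T y) * K y) = indicator {y. T y > 0} y * (ennreal (K y) * ennreal (g (T y)))"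
        using g K0 g0 by (auto simp: ennreal_mult mult.commute)
    qed
    also have "\<dots> = (\<integral>\<^sup>+ t. indicator {0<..} t * (ennreal (2 * s * m' * t powr (- 1 - 2 * s)) * ennreal (g t)) \<partial>lborel)"
      by (rule nn_integral_homogeneous[OF s K K0 Kh T Th m' m0]) auto
    also have "\<dots> = (\<integral>\<^sup>+ t. ennreal (2 * s * m' * (indicator {0<..} t * (g t * t powr (- 1 - 2 * s)))) \<partial>lborel)"
    proof (intro nn_integral_cong)
      fix t :: real
      have "ennreal (2 * s * m' * t powr (- 1 - 2 * s)) * ennreal (g t) = ennreal (2 * s * m' * t powr (- 1 - 2 * s) * g t)"
        using s m0 g by (intro ennreal_mult[symmetric]) auto
      then show "indicator {0<..} t * (ennreal (2 * s * m' * t powr (- 1 - 2 * s)) * ennreal (g t))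
         = ennreal (2 * s * m' * (indicator {0<..} t * (g t * t powr (- 1 - 2 * s))))"
        by (cases "t > 0") (auto simp: mult_ac)
    qed
    also have "\<dots> = ennreal (LBINT t. 2 * s * m' * (indicator {0<..} t * (g t * t powr (- 1 - 2 * s))))"
      using gi s m0 g by (intro nn_integral_eq_integral integrable_mult_right) auto
    also have "\<dots> = ennreal (2 * s * m' * J)" by (simp add: J_def)
    finally show "(\<integral>\<^sup>+ y. ennreal (g (T y) * K y) \<partial>lborel) = ennreal (2 * s * m' * J)" .
    show "0 \<le> 2 * s * m' * J" unfolding J_def using s m0 g
      by (intro mult_nonneg_nonneg Bochner_Integration.integral_nonneg) auto
  qed (use g K0 in auto)
  define fp where "fp = (\<lambda>t. max (f t) 0)"
  define fm where "fm = (\<lambda>t. max (- f t) 0)"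
  have Ii: "integrable lborel (\<lambda>t. indicator {0<..} t * (f t * t powr (- 1 - 2 * s)))"
    using I by (simp add: has_bochner_integral_iff)
  have [measurable]: "fp \<in> borel_measurable borel" "fm \<in> borel_measurable borel" by (auto simp: fp_def fm_def)
  have ip: "integrable lborel (\<lambda>t. indicator {0<..} t * (fp t * t powr (- 1 - 2 * s)))"
    by (rule Bochner_Integration.integrable_bound[OF Ii]) (auto simp: fp_def indicator_def abs_mult intro!: mult_right_mono)
  have im: "integrable lborel (\<lambda>t. indicator {0<..} t * (fm t * t powr (- 1 - 2 * s)))"
    by (rule Bochner_Integration.integrable_bound[OF Ii]) (auto simp: fm_def indicator_def abs_mult intro!: mult_right_mono)
  have "has_bochner_integral lborel (\<lambda>y. fp (T y) * K y - fm (T y) * K y)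
     (2 * s * m' * (LBINT t. indicator {0<..} t * (fp t * t powr (- 1 - 2 * s)))
      - 2 * s * m' * (LBINT t. indicator {0<..} t * (fm t * t powr (- 1 - 2 * s))))"
    by (intro has_bochner_integral_diff nonneg ip im) (auto simp: fp_def fm_def f0)
  moreover have "fp (T y) * K y - fm (T y) * K y = f (T y) * K y" for y
    by (auto simp: fp_def fm_def max_def)
  moreover have "(LBINT t. indicator {0<..} t * (fp t * t powr (- 1 - 2 * s)))
      - (LBINT t. indicator {0<..} t * (fm t * t powr (- 1 - 2 * s))) = I"
  proof -
    have "indicator {0<..} t * (fp t * t powr (- 1 - 2 * s)) - indicator {0<..} t * (fm t * t powr (- 1 - 2 * s))
       = indicator {0<..} t * (f t * t powr (- 1 - 2 * s))" for t
      by (auto simp: fp_def fm_def max_def)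
    then show ?thesis using I Bochner_Integration.integral_diff[OF ip im]
      by (simp add: has_bochner_integral_iff)
  qed
  ultimately show ?thesis
    unfolding m'_def[symmetric] by (simp flip: right_diff_distrib)
qed

text \<open>At the origin the denominator is 0 and the quotient takes the value 0, so bounds and
  scaling hold without an exception there.\<close>

definition kernel_fun :: "real \<Rightarrow> (real ^ 'n \<Rightarrow> real) \<Rightarrow> real ^ 'n \<Rightarrow> real" where
  "kernel_fun s \<mu> y = \<mu> (y /\<^sub>R norm y) / norm y powr (real CARD('n) + 2 * s)"

context
  fixes lam Lam :: real and \<mu> :: "real ^ 'n \<Rightarrow> real" and s :: real
  assumes \<mu>: "\<mu> \<in> kernels lam Lam" and lam: "0 < lam" and s0: "0 < s"
begin

lemma measurable_kernel_fun[measurable]: "kernel_fun s \<mu> \<in> borel_measurable borel"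
proof -
  have m: "\<mu> \<in> borel_measurable (restrict_space borel (sphere 0 1))"
    using \<mu> by (simp add: kernels_def)
  \<comment> \<open>The kernel \<mu> is measurable on the unit sphere only, and normalization maps
    into the sphere only away from the origin.\<close>
  have "(\<lambda>y::real ^ 'n. y /\<^sub>R norm y) \<in> measurable (restrict_space borel (- {0})) (restrict_space borel (sphere 0 1))"
  proof (rule measurable_restrict_space2)
    show "(\<lambda>y::real ^ 'n. y /\<^sub>R norm y) \<in> space (restrict_space borel (- {0})) \<rightarrow> sphere 0 1"
      by (auto simp: space_restrict_space)
    show "(\<lambda>y::real ^ 'n. y /\<^sub>R norm y) \<in> restrict_space borel (- {0}) \<rightarrow>\<^sub>M borel"
      by (rule measurable_restrict_space1) measurable
  qed
  from measurable_compose[OF this m]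
  have "(\<lambda>y. \<mu> (y /\<^sub>R norm y)) \<in> borel_measurable (restrict_space borel (- {0}))" .
  then have [measurable]: "(\<lambda>y. indicator (- {0}) y *\<^sub>R \<mu> (y /\<^sub>R norm y)) \<in> borel_measurable borel"
    by (subst (asm) borel_measurable_restrict_space_iff) auto
  have "kernel_fun s \<mu> = (\<lambda>y. (indicator (- {0}) y *\<^sub>R \<mu> (y /\<^sub>R norm y)) / norm y powr (real CARD('n) + 2 * s))"
    by (auto simp: kernel_fun_def fun_eq_iff indicator_def)
  also have "\<dots> \<in> borel_measurable borel" by measurable
  finally show ?thesis .
qed

lemma kernel_fun_bounds: "0 \<le> kernel_fun s \<mu> y" "kernel_fun s \<mu> y \<le> Lam * norm y powr (- real CARD('n) - 2 * s)"
proof -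
  have "0 \<le> kernel_fun s \<mu> y \<and> kernel_fun s \<mu> y \<le> Lam * norm y powr (- real CARD('n) - 2 * s)"
  proof (cases "y = 0")
    case False
    then have "y /\<^sub>R norm y \<in> sphere 0 1" by simp
    then have m: "lam \<le> \<mu> (y /\<^sub>R norm y)" "\<mu> (y /\<^sub>R norm y) \<le> Lam"
      using \<mu> unfolding kernels_def by blast+
    have "norm y powr (- real CARD('n) - 2 * s) = inverse (norm y powr (real CARD('n) + 2 * s))"
      by (subst powr_minus[symmetric]) (rule arg_cong[of _ _ "\<lambda>e. norm y powr e"], simp)
    then show ?thesis
      using m lam by (simp add: kernel_fun_def divide_inverse mult_right_mono)
  qed (simp add: kernel_fun_def)
  then show "0 \<le> kernel_fun s \<mu> y" "kernel_fun s \<mu> y \<le> Lam * norm y powr (- real CARD('n) - 2 * s)"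
    by auto
qed

lemma kernel_fun_scale:
  assumes r: "r > 0"
  shows "kernel_fun s \<mu> (r *\<^sub>R y) = r powr (- real CARD('n) - 2 * s) * kernel_fun s \<mu> y"
proof -
  have 1: "(r *\<^sub>R y) /\<^sub>R norm (r *\<^sub>R y) = y /\<^sub>R norm y" using r by simp
  have 2: "r powr (- real CARD('n) - 2 * s) = inverse (r powr (real CARD('n) + 2 * s))"
    by (subst powr_minus[symmetric]) (rule arg_cong[of _ _ "\<lambda>e. r powr e"], simp)
  show ?thesis
    unfolding kernel_fun_def 1 2 using r by (simp add: powr_mult divide_inverse)
qed

lemma Lam_nonneg: "Lam \<ge> 0"
proof -
  have "axis undefined 1 \<in> sphere (0 :: real ^ 'n) 1" by simp
  then have "lam \<le> \<mu> (axis undefined 1) \<and> \<mu> (axis undefined 1) \<le> Lam"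
    using \<mu> unfolding kernels_def by blast
  then show ?thesis using lam by simp
qed

text \<open>Under y \<mapsto> \<open>\<bar>y $ k\<bar>\<close> the kernel is pushed forward to a
  multiple of t^(-1-2s) dt, whatever its angular part; the second difference depends on
  \<open>y $ k\<close> only and is even in it. A vanishing one-dimensional value thus remains 0 for
  all kernels.\<close>

lemma has_bochner_integral_kernel_flat:
  assumes F[measurable]: "F \<in> borel_measurable borel" and "has_frac_lap s F a 0"
  shows "has_bochner_integral lborel (\<lambda>y. (second_diff F a (y $ k) / 2) * kernel_fun s \<mu> y) 0"
proof -
  have c[measurable]: "(\<lambda>y::real ^ 'n. y $ k) \<in> borel_measurable borel" by (intro borel_measurable_continuous_onI continuous_intros)
  have tail: "integrable lborel (\<lambda>y. indicator {y. \<bar>y $ k\<bar> > 1} y * kernel_fun s \<mu> y)"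
  proof (rule integrable_nonneg_bound)
    show "integrable lborel (\<lambda>y::real ^ 'n. Lam * (indicator {y. norm y \<ge> 1} y * norm y powr (- real CARD('n) - 2 * s)))"
      using integrable_tail[of "2 * s"] s0 by (intro integrable_mult_right) auto
    show "indicator {y. \<bar>y $ k\<bar> > 1} y * kernel_fun s \<mu> y \<le> Lam * (indicator {y. norm y \<ge> 1} y * norm y powr (- real CARD('n) - 2 * s))" for y
      using kernel_fun_bounds[of y] Lam_nonneg component_le_norm_cart[of y k] by (auto simp: indicator_def)
  qed (auto simp: kernel_fun_bounds)
  have "has_bochner_integral lborel (\<lambda>y. (second_diff F a \<bar>y $ k\<bar> / 2) * kernel_fun s \<mu> y)
      (2 * s * (LBINT y. indicator {y. \<bar>y $ k\<bar> > 1} y * kernel_fun s \<mu> y) * (0 / 2))"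
  proof (rule has_bochner_integral_homogeneous)
    show "has_bochner_integral lborel (\<lambda>t. indicator {0<..} t * (second_diff F a t / 2 * t powr (- 1 - 2 * s))) (0 / 2)"
      using has_bochner_integral_divide_zero[OF assms(2)[unfolded has_frac_lap_def], of 2] by simp
    show "(\<lambda>t. second_diff F a t / 2) \<in> borel_measurable borel" unfolding second_diff_def by measurable
  qed (use s0 tail kernel_fun_scale in \<open>auto simp: kernel_fun_bounds abs_mult second_diff_def\<close>)
  moreover have "second_diff F a \<bar>t\<bar> = second_diff F a t" for t
    by (auto simp: second_diff_def abs_if)
  ultimately show ?thesis by simp
qed

text \<open>The linear factor has no sign, whereas the push-forward requires a nonnegative kernel.
  The positive and negative parts of (p \<bullet> y) sgn (y_k) / |y_k| are homogeneous of degree 0,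
  so each times the kernel is an admissible kernel. The division by |y_k| is undone by the extra
  factor t in the profile f.\<close>

lemma has_bochner_integral_kernel_cross:
  fixes p :: "real ^ 'n"
  assumes F[measurable]: "F \<in> borel_measurable borel"
    and odd: "has_bochner_integral lborel (\<lambda>t. indicator {0<..} t * ((F (a + t) - F (a - t)) * t powr (- 2 * s))) 0"
  shows "has_bochner_integral lborel (\<lambda>y. (p \<bullet> y) * (F (a + y $ k) - F (a - y $ k)) * kernel_fun s \<mu> y) 0"
proof -
  have c[measurable]: "(\<lambda>y::real ^ 'n. y $ k) \<in> borel_measurable borel" by (intro borel_measurable_continuous_onI continuous_intros)
  define f where "f = (\<lambda>t. (F (a + t) - F (a - t)) * t)"
  have fm[measurable]: "f \<in> borel_measurable borel" unfolding f_def by measurable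
  have "indicator {0<..} t * ((F (a + t) - F (a - t)) * t powr (- 2 * s)) = indicator {0<..} t * (f t * t powr (- 1 - 2 * s))" for t
  proof -
    show "indicator {0<..} t * ((F (a + t) - F (a - t)) * t powr (- 2 * s)) = indicator {0<..} t * (f t * t powr (- 1 - 2 * s))"
    proof (cases "t > 0")
      case True
      have "t powr (- 2 * s) = t * t powr (- 1 - 2 * s)"
        using True powr_add[of t 1 "- 1 - 2 * s"] by simp
      then show ?thesis by (simp add: f_def)
    qed simp
  qed
  with odd have fI: "has_bochner_integral lborel (\<lambda>t. indicator {0<..} t * (f t * t powr (- 1 - 2 * s))) 0"
    by (simp only:)
  have half: "has_bochner_integral lborel (\<lambda>y. f \<bar>y $ k\<bar> * (max (q \<bullet> y * sgn (y $ k)) 0 / \<bar>y $ k\<bar> * kernel_fun s \<mu> y)) 0"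
    for q :: "real ^ 'n"
  proof -
    define K where "K = (\<lambda>y. max (q \<bullet> y * sgn (y $ k)) 0 / \<bar>y $ k\<bar> * kernel_fun s \<mu> y)"
    have [measurable]: "K \<in> borel_measurable borel" unfolding K_def by measurable
    have K0: "K y \<ge> 0" for y unfolding K_def using kernel_fun_bounds[of y] by simp
    have tail: "integrable lborel (\<lambda>y. indicator {y. \<bar>y $ k\<bar> > 1} y * K y)"
    proof (rule integrable_nonneg_bound)
      show "integrable lborel (\<lambda>y::real ^ 'n. (norm q * Lam) * (indicator {y. \<bar>y $ k\<bar> > 1} y *
        (norm y / \<bar>y $ k\<bar> * norm y powr (- real CARD('n) - 2 * s))))"
        using integrable_cross_tail[OF s0] by (rule integrable_mult_right)
      show "indicator {y. \<bar>y $ k\<bar> > 1} y * K y \<le> (norm q * Lam) * (indicator {y. \<bar>y $ k\<bar> > 1} y *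
        (norm y / \<bar>y $ k\<bar> * norm y powr (- real CARD('n) - 2 * s)))" for y
      proof (cases "\<bar>y $ k\<bar> > 1")
        case True
        have "q \<bullet> y * sgn (y $ k) \<le> \<bar>q \<bullet> y * sgn (y $ k)\<bar>" by (rule abs_ge_self)
        also have "\<dots> \<le> norm q * norm y"
          using Cauchy_Schwarz_ineq2[of q y] True by (simp add: abs_mult abs_sgn_eq)
        finally have "max (q \<bullet> y * sgn (y $ k)) 0 \<le> norm q * norm y" by simp
        then have "max (q \<bullet> y * sgn (y $ k)) 0 / \<bar>y $ k\<bar> * kernel_fun s \<mu> y
            \<le> (norm q * norm y) / \<bar>y $ k\<bar> * (Lam * norm y powr (- real CARD('n) - 2 * s))"
          using kernel_fun_bounds[of y] by (intro mult_mono divide_right_mono) auto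
        then show ?thesis using True by (simp add: K_def mult_ac)
      qed simp
    qed (use K0 in auto)
    have "has_bochner_integral lborel (\<lambda>y. f \<bar>y $ k\<bar> * K y) (2 * s * (LBINT y. indicator {y. \<bar>y $ k\<bar> > 1} y * K y) * 0)"
    proof (rule has_bochner_integral_homogeneous)
      show "K (r *\<^sub>R y) = r powr (- real CARD('n) - 2 * s) * K y" if "r > 0" for r y
      proof -
        have "max (r * (q \<bullet> y) * sgn (r * y $ k)) 0 = r * max (q \<bullet> y * sgn (y $ k)) 0"
          using that by (simp add: sgn_mult max_def zero_le_mult_iff mult_le_0_iff)
        then show ?thesis unfolding K_def using that by (simp add: kernel_fun_scale abs_mult)
      qed
      show "has_bochner_integral lborel (\<lambda>t. indicator {0<..} t * (f t * t powr (- 1 - 2 * s))) 0" by (rule fI)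
    qed (use s0 tail K0 in \<open>auto simp: abs_mult f_def\<close>)
    then show ?thesis by (simp add: K_def)
  qed
  have "has_bochner_integral lborel (\<lambda>y. f \<bar>y $ k\<bar> * (max (p \<bullet> y * sgn (y $ k)) 0 / \<bar>y $ k\<bar> * kernel_fun s \<mu> y)
     - f \<bar>y $ k\<bar> * (max ((- p) \<bullet> y * sgn (y $ k)) 0 / \<bar>y $ k\<bar> * kernel_fun s \<mu> y)) (0 - 0)"
    by (intro has_bochner_integral_diff half)
  moreover have "f \<bar>t\<bar> * (max (c * sgn t) 0 / \<bar>t\<bar> * \<kappa>) - f \<bar>t\<bar> * (max (- c * sgn t) 0 / \<bar>t\<bar> * \<kappa>)
     = c * (F (a + t) - F (a - t)) * \<kappa>" for t c \<kappa> :: real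
  proof -
    consider "t > 0" | "t < 0" | "t = 0" by linarith
    then show ?thesis
    proof cases
      case 1
      have "max c 0 - max (- c) 0 = c" by (simp add: max_def)
      then have "(F (a + t) - F (a - t)) * \<kappa> * (max c 0 - max (- c) 0) = c * (F (a + t) - F (a - t)) * \<kappa>" by simp
      with 1 show ?thesis by (simp add: f_def algebra_simps)
    next
      case 2
      have "max c 0 - max (- c) 0 = c" by (simp add: max_def)
      then have "(F (a + t) - F (a - t)) * \<kappa> * (max c 0 - max (- c) 0) = c * (F (a + t) - F (a - t)) * \<kappa>" by simp
      with 2 show ?thesis by (simp add: f_def algebra_simps)
    qed simp
  qed
  ultimately show ?thesis by simp
qed

end

section \<open>Arithmetic of the extended integral\<close>

lemma ext_integral_lborel:
  "ext_integral f = enn2ereal (\<integral>\<^sup>+ y. ennreal (f y) \<partial>lborel) - enn2ereal (\<integral>\<^sup>+ y. ennreal (- f y) \<partial>lborel)"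
  by (simp add: ext_integral_def nn_integral_completion)

lemma ext_integral_mono: "(\<And>y. f y \<le> g y) \<Longrightarrow> ext_integral f \<le> ext_integral g"
  unfolding ext_integral_def
  by (intro ereal_minus_mono) (auto simp flip: less_eq_ennreal.rep_eq intro!: nn_integral_mono ennreal_leI)

lemma ereal_mult_diff_pos: "c > 0 \<Longrightarrow> ereal c * (a - b) = ereal c * a - ereal c * b"
  by (cases a; cases b) (auto simp: right_diff_distrib)

lemma ext_integral_cmult:
  assumes [measurable]: "f \<in> borel_measurable borel" and c: "c > 0"
  shows "ext_integral (\<lambda>y. c * f y) = ereal c * ext_integral f"
proof -
  have 1: "(\<integral>\<^sup>+ y. ennreal (c * g y) \<partial>lborel) = ennreal c * (\<integral>\<^sup>+ y. ennreal (g y) \<partial>lborel)"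
    if [measurable]: "g \<in> borel_measurable borel" for g
    using c by (simp add: ennreal_mult' nn_integral_cmult)
  show ?thesis
    unfolding ext_integral_lborel 1[OF assms(1)] using 1[of "\<lambda>y. - f y"] c
    by (simp add: times_ennreal.rep_eq ereal_mult_diff_pos)
qed

lemma ext_integral_scale:
  fixes f :: "real ^ 'n \<Rightarrow> real"
  assumes [measurable]: "f \<in> borel_measurable borel" and r: "r > 0"
  shows "ext_integral f = ereal (r ^ CARD('n)) * ext_integral (\<lambda>y. f (r *\<^sub>R y))"
proof -
  have 1: "(\<integral>\<^sup>+ y. ennreal (g y) \<partial>lborel) = ennreal (r ^ CARD('n)) * (\<integral>\<^sup>+ y. ennreal (g (r *\<^sub>R y)) \<partial>lborel)"
    if [measurable]: "g \<in> borel_measurable borel" for g :: "real ^ 'n \<Rightarrow> real"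
    by (rule nn_integral_lborel_scale[OF _ r]) measurable
  show ?thesis
    unfolding ext_integral_lborel 1[OF assms(1)] using 1[of "\<lambda>y. - f y"] r
    by (simp add: times_ennreal.rep_eq ereal_mult_diff_pos)
qed

lemma ext_integral_eq:
  assumes "has_bochner_integral lborel f I"
  shows "ext_integral f = ereal I"
proof -
  have i: "integrable lborel f" and I: "I = integral\<^sup>L lborel f" using assms by (auto simp: has_bochner_integral_iff)
  have "(\<integral>\<^sup>+ y. ennreal (f y) \<partial>lborel) < \<infinity>" "(\<integral>\<^sup>+ y. ennreal (- f y) \<partial>lborel) < \<infinity>"
    using real_integrable_def[of lborel f] i by (auto simp: less_top)
  then obtain a b where "a \<ge> 0" "(\<integral>\<^sup>+ y. ennreal (f y) \<partial>lborel) = ennreal a" "b \<ge> 0" "(\<integral>\<^sup>+ y. ennreal (- f y) \<partial>lborel) = ennreal b"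
    by (metis ennreal_cases infinity_ennreal_def less_irrefl)
  then show ?thesis
    unfolding ext_integral_lborel I real_lebesgue_integral_def[OF i] by (simp add: enn2ereal_ennreal)
qed

text \<open>No case is excluded: in \<^typ>\<open>ereal\<close> the value \<open>\<infinity> - \<infinity>\<close> is \<open>\<infinity>\<close>, on both sides.\<close>

lemma ext_integral_add:
  fixes f g :: "real ^ 'n \<Rightarrow> real"
  assumes [measurable]: "f \<in> borel_measurable borel" and g: "has_bochner_integral lborel g I"
  shows "ext_integral (\<lambda>y. f y + g y) = ext_integral f + ereal I"
proof -
  have gi: "integrable lborel g" using g by (simp add: has_bochner_integral_iff)
  then have [measurable]: "g \<in> borel_measurable borel" by auto
  have fin: "(\<integral>\<^sup>+ y. ennreal \<bar>g y\<bar> \<partial>lborel) < \<infinity>"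
    using gi by (simp add: integrable_iff_bounded)
  have le: "(\<integral>\<^sup>+ y. ennreal (a y) \<partial>lborel) \<le> (\<integral>\<^sup>+ y. ennreal (b y) \<partial>lborel) + (\<integral>\<^sup>+ y. ennreal \<bar>g y\<bar> \<partial>lborel)"
    if [measurable]: "b \<in> borel_measurable borel" and ab: "\<And>y. a y \<le> b y + \<bar>g y\<bar>" for a b :: "real ^ 'n \<Rightarrow> real"
  proof -
    have "ennreal (a y) \<le> ennreal (b y) + ennreal \<bar>g y\<bar>" for y
    proof -
      have "ennreal (a y) \<le> ennreal (max (b y) 0 + \<bar>g y\<bar>)" using ab[of y] by (intro ennreal_leI) auto
      also have "\<dots> = ennreal (max (b y) 0) + ennreal \<bar>g y\<bar>" by (rule ennreal_plus) auto
      also have "ennreal (max (b y) 0) = ennreal (b y)" by (auto simp: max_def ennreal_neg)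
      finally show ?thesis .
    qed
    then have "(\<integral>\<^sup>+ y. ennreal (a y) \<partial>lborel) \<le> (\<integral>\<^sup>+ y. ennreal (b y) + ennreal \<bar>g y\<bar> \<partial>lborel)"
      by (intro nn_integral_mono)
    also have "\<dots> = (\<integral>\<^sup>+ y. ennreal (b y) \<partial>lborel) + (\<integral>\<^sup>+ y. ennreal \<bar>g y\<bar> \<partial>lborel)"
      by (rule nn_integral_add) auto
    finally show ?thesis .
  qed
  \<comment> \<open>An integrable perturbation cannot change which of the two parts is
    infinite.\<close>
  have iff: "(\<integral>\<^sup>+ y. ennreal (a y) \<partial>lborel) = \<infinity> \<longleftrightarrow> (\<integral>\<^sup>+ y. ennreal (b y) \<partial>lborel) = \<infinity>"
    if [measurable]: "a \<in> borel_measurable borel" "b \<in> borel_measurable borel"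
      and ab: "\<And>y. a y \<le> b y + \<bar>g y\<bar>" "\<And>y. b y \<le> a y + \<bar>g y\<bar>" for a b :: "real ^ 'n \<Rightarrow> real"
    using le[of b a] le[of a b] ab fin by (auto simp: top_unique less_top[symmetric])
  have p: "(\<integral>\<^sup>+ y. ennreal (f y + g y) \<partial>lborel) = \<infinity> \<longleftrightarrow> (\<integral>\<^sup>+ y. ennreal (f y) \<partial>lborel) = \<infinity>"
    by (rule iff) auto
  have m: "(\<integral>\<^sup>+ y. ennreal (- (f y + g y)) \<partial>lborel) = \<infinity> \<longleftrightarrow> (\<integral>\<^sup>+ y. ennreal (- f y) \<partial>lborel) = \<infinity>"
    by (rule iff) auto
  consider "(\<integral>\<^sup>+ y. ennreal (f y) \<partial>lborel) = \<infinity>"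
    | "(\<integral>\<^sup>+ y. ennreal (f y) \<partial>lborel) \<noteq> \<infinity>" "(\<integral>\<^sup>+ y. ennreal (- f y) \<partial>lborel) = \<infinity>"
    | "(\<integral>\<^sup>+ y. ennreal (f y) \<partial>lborel) \<noteq> \<infinity>" "(\<integral>\<^sup>+ y. ennreal (- f y) \<partial>lborel) \<noteq> \<infinity>" by blast
  then show ?thesis
  proof cases
    case 1
    then show ?thesis using p unfolding ext_integral_lborel by simp
  next
    case 2
    from 2 obtain a where "a \<ge> 0" "(\<integral>\<^sup>+ y. ennreal (f y) \<partial>lborel) = ennreal a"
      by (cases "\<integral>\<^sup>+ y. ennreal (f y) \<partial>lborel") auto
    moreover from 2 p obtain b where "b \<ge> 0" "(\<integral>\<^sup>+ y. ennreal (f y + g y) \<partial>lborel) = ennreal b"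
      by (cases "\<integral>\<^sup>+ y. ennreal (f y + g y) \<partial>lborel") auto
    ultimately show ?thesis using 2 m unfolding ext_integral_lborel by (simp add: enn2ereal_ennreal)
  next
    case 3
    then have "integrable lborel f" by (simp add: real_integrable_def)
    then have f: "has_bochner_integral lborel f (integral\<^sup>L lborel f)" by (rule has_bochner_integral_integrable)
    show ?thesis
      using ext_integral_eq[OF has_bochner_integral_add[OF f g]] ext_integral_eq[OF f] by simp
  qed
qed

text \<open>Unlike \<open>C2_closure\<close> nothing is required at the boundary of the set: the
  corrections are smooth inside the half-space but may be singular on its boundary. They are made
  admissible by restriction to sets with closure inside.\<close>

definition c2_on :: "(real ^ 'n) set \<Rightarrow> (real ^ 'n \<Rightarrow> real) \<Rightarrow> bool" where
  "c2_on U P \<longleftrightarrow> (\<exists>(G :: real ^ 'n \<Rightarrow> real ^ 'n) (H :: real ^ 'n \<Rightarrow> real ^ 'n ^ 'n).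
    (\<forall>z\<in>U. (P has_derivative (\<lambda>h. G z \<bullet> h)) (at z)) \<and>
    (\<forall>z\<in>U. (G has_derivative (\<lambda>h. H z *v h)) (at z)) \<and> continuous_on U H)"

lemma c2_on_linear: "c2_on U (\<lambda>z. (p :: real ^ 'n) \<bullet> z)"
  unfolding c2_on_def
proof (intro exI conjI ballI)
  fix z
  show "((\<lambda>z. p \<bullet> z) has_derivative (\<lambda>h. p \<bullet> h)) (at z)" by (auto intro!: derivative_eq_intros)
  show "((\<lambda>z. p) has_derivative (\<lambda>h. (0 :: real ^ 'n ^ 'n) *v h)) (at z)"
    by (simp add: matrix_vector_mult_0)
qed auto

lemma has_derivative_inner_add:
  assumes "(P has_derivative (\<lambda>h. G \<bullet> h)) F" "(Q has_derivative (\<lambda>h. G' \<bullet> h)) F"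
  shows "((\<lambda>z. P z + Q z) has_derivative (\<lambda>h. (G + G') \<bullet> h)) F"
  by (rule has_derivative_eq_rhs[OF has_derivative_add[OF assms]]) (simp add: fun_eq_iff inner_add_left)

lemma has_derivative_matrix_add:
  fixes H H' :: "real ^ 'n ^ 'm"
  assumes "(P has_derivative (\<lambda>h. H *v h)) F" "(Q has_derivative (\<lambda>h. H' *v h)) F"
  shows "((\<lambda>z. P z + Q z) has_derivative (\<lambda>h. (H + H') *v h)) F"
  by (rule has_derivative_eq_rhs[OF has_derivative_add[OF assms]])
     (simp add: fun_eq_iff matrix_vector_mult_add_rdistrib)

lemma c2_on_add: "c2_on U P \<Longrightarrow> c2_on U Q \<Longrightarrow> c2_on U (\<lambda>z. P z + Q z)"
proof -
  assume "c2_on U P" "c2_on U Q"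
  then obtain G H G' H' where D:
    "\<And>z. z \<in> U \<Longrightarrow> (P has_derivative (\<lambda>h. G z \<bullet> h)) (at z)" "\<And>z. z \<in> U \<Longrightarrow> (G has_derivative (\<lambda>h. H z *v h)) (at z)" "continuous_on U H"
    "\<And>z. z \<in> U \<Longrightarrow> (Q has_derivative (\<lambda>h. G' z \<bullet> h)) (at z)" "\<And>z. z \<in> U \<Longrightarrow> (G' has_derivative (\<lambda>h. H' z *v h)) (at z)" "continuous_on U H'"
    unfolding c2_on_def by blast
  show ?thesis
    unfolding c2_on_def
  proof (intro exI conjI ballI)
    show "((\<lambda>z. P z + Q z) has_derivative (\<lambda>h. (G z + G' z) \<bullet> h)) (at z)" if "z \<in> U" for z
      by (intro has_derivative_inner_add D that)
    show "((\<lambda>z. G z + G' z) has_derivative (\<lambda>h. (H z + H' z) *v h)) (at z)" if "z \<in> U" for z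
      by (intro has_derivative_matrix_add D that)
    show "continuous_on U (\<lambda>z. H z + H' z)" by (intro continuous_intros D)
  qed
qed

lemma c2_on_mult: "c2_on U P \<Longrightarrow> c2_on U Q \<Longrightarrow> c2_on U (\<lambda>z. P z * Q z)"
proof -
  assume "c2_on U P" "c2_on U Q"
  then obtain G H G' H' where D:
    "\<And>z. z \<in> U \<Longrightarrow> (P has_derivative (\<lambda>h. G z \<bullet> h)) (at z)" "\<And>z. z \<in> U \<Longrightarrow> (G has_derivative (\<lambda>h. H z *v h)) (at z)" "continuous_on U H"
    "\<And>z. z \<in> U \<Longrightarrow> (Q has_derivative (\<lambda>h. G' z \<bullet> h)) (at z)" "\<And>z. z \<in> U \<Longrightarrow> (G' has_derivative (\<lambda>h. H' z *v h)) (at z)" "continuous_on U H'"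
    unfolding c2_on_def by blast
  define H'' where "H'' = (\<lambda>z. \<chi> i j. P z * H' z $ i $ j + G' z $ i * G z $ j + (Q z * H z $ i $ j + G z $ i * G' z $ j))"
  have c: "continuous_on U P" "continuous_on U Q" "continuous_on U G" "continuous_on U G'"
    using D by (auto intro!: continuous_at_imp_continuous_on has_derivative_continuous)
  show ?thesis
    unfolding c2_on_def
  proof (intro exI conjI ballI)
    fix z assume z: "z \<in> U"
    show "((\<lambda>z. P z * Q z) has_derivative (\<lambda>h. (P z *\<^sub>R G' z + Q z *\<^sub>R G z) \<bullet> h)) (at z)"
      by (rule has_derivative_eq_rhs[OF has_derivative_mult[OF D(1)[OF z] D(4)[OF z]]])
         (auto simp: fun_eq_iff inner_add_left algebra_simps)
    show "((\<lambda>z. P z *\<^sub>R G' z + Q z *\<^sub>R G z) has_derivative (\<lambda>h. H'' z *v h)) (at z)"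
      by (rule has_derivative_eq_rhs[OF has_derivative_add[OF has_derivative_scaleR[OF D(1)[OF z] D(5)[OF z]]
              has_derivative_scaleR[OF D(4)[OF z] D(2)[OF z]]]])
         (auto simp: fun_eq_iff vec_eq_iff H''_def matrix_vector_mult_def inner_vec_def sum.distrib
            sum_distrib_left sum_distrib_right algebra_simps)
  next
    show "continuous_on U H''"
      unfolding H''_def by (intro continuous_intros continuous_on_vec_lambda c D)
  qed
qed

lemma c2_on_component:
  assumes "c2_pos F" and U: "\<And>z. z \<in> U \<Longrightarrow> z $ k > 0"
  shows "c2_on U (\<lambda>z :: real ^ 'n. F (z $ k))"
proof -
  obtain F' F'' where D: "\<And>z. z > 0 \<Longrightarrow> (F has_real_derivative F' z) (at z)"
     "\<And>z. z > 0 \<Longrightarrow> (F' has_real_derivative F'' z) (at z)" "continuous_on {0<..} F''"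
    using assms(1) unfolding c2_pos_def by blast
  have k: "((\<lambda>z :: real ^ 'n. z $ k) has_derivative (\<lambda>h. h $ k)) (at z)" for z
    by (rule bounded_linear_imp_has_derivative) (rule bounded_linear_vec_nth)
  define H where "H = (\<lambda>z :: real ^ 'n. (\<chi> i j. if i = k \<and> j = k then F'' (z $ k) else 0) :: real ^ 'n ^ 'n)"
  have ax: "(c *\<^sub>R axis k 1) \<bullet> h = c * h $ k" for c and h :: "real ^ 'n"
    by (simp add: inner_axis' )
  have Hv: "H z *v h = (h $ k * F'' (z $ k)) *\<^sub>R axis k 1" for z h
  proof -
    have "(\<Sum>j\<in>UNIV. (if i = k \<and> j = k then F'' (z $ k) else 0) * h $ j) = (if i = k then h $ k * F'' (z $ k) else 0)" for i
    proof -
      have "(\<Sum>j\<in>UNIV. (if i = k \<and> j = k then F'' (z $ k) else 0) * h $ j) = (\<Sum>j\<in>UNIV. if j = k then (if i = k then F'' (z $ k) * h $ k else 0) else 0)"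
        by (intro sum.cong) auto
      then show ?thesis by (simp add: mult.commute)
    qed
    then show ?thesis by (simp add: H_def vec_eq_iff matrix_vector_mult_def axis_def)
  qed
  show ?thesis
    unfolding c2_on_def
  proof (intro exI conjI ballI)
    fix z assume z: "z \<in> U"
    have "((\<lambda>z. F (z $ k)) has_derivative (\<lambda>h. F' (z $ k) * h $ k)) (at z)"
      using has_derivative_compose[OF k D(1)[OF U[OF z], unfolded has_field_derivative_def]] by simp
    then show "((\<lambda>z. F (z $ k)) has_derivative (\<lambda>h. (F' (z $ k) *\<^sub>R axis k 1) \<bullet> h)) (at z)"
      unfolding ax .
    have "((\<lambda>z. F' (z $ k)) has_derivative (\<lambda>h. h $ k * F'' (z $ k))) (at z)"
      using has_derivative_compose[OF k D(2)[OF U[OF z], unfolded has_field_derivative_def]] by (simp add: mult.commute)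
    from has_derivative_scaleR_left[OF this, of "axis k 1"]
    show "((\<lambda>z. F' (z $ k) *\<^sub>R axis k 1) has_derivative (\<lambda>h. H z *v h)) (at z)" unfolding Hv .
  next
    have "continuous_on U (\<lambda>z. F'' (z $ k))"
      by (rule continuous_on_compose2[OF D(3)]) (auto intro!: continuous_intros U)
    then show "continuous_on U H"
      unfolding H_def
    proof (intro continuous_on_vec_lambda)
      fix i j
      show "continuous_on U (\<lambda>z. if i = k \<and> j = k then F'' (z $ k) else 0)"
        using \<open>continuous_on U (\<lambda>z. F'' (z $ k))\<close> by (cases "i = k"; cases "j = k") simp_all
    qed
  qed
qed

lemma c2_on_imp_C2_closure:
  assumes "c2_on U P" "closure N \<subseteq> U"
  shows "C2_closure N P"
proof -
  obtain G H where D: "\<And>z. z \<in> U \<Longrightarrow> (P has_derivative (\<lambda>h. G z \<bullet> h)) (at z)"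
    "\<And>z. z \<in> U \<Longrightarrow> (G has_derivative (\<lambda>h. H z *v h)) (at z)" "continuous_on U H"
    using assms(1) unfolding c2_on_def by blast
  have "N \<subseteq> U" using assms(2) closure_subset by blast
  moreover have "continuous_on U P" "continuous_on U G"
    using D by (auto intro!: continuous_at_imp_continuous_on has_derivative_continuous)
  ultimately show ?thesis
    unfolding C2_closure_def using D assms(2)
    by (intro exI[of _ G] exI[of _ H]) (auto intro: continuous_on_subset)
qed

lemma C2_closure_add:
  assumes "C2_closure N P" "C2_closure N Q"
  shows "C2_closure N (\<lambda>z. P z + Q z)"
proof -
  obtain G H G' H' where D:
    "\<And>z. z \<in> N \<Longrightarrow> (P has_derivative (\<lambda>h. G z \<bullet> h)) (at z)" "\<And>z. z \<in> N \<Longrightarrow> (G has_derivative (\<lambda>h. H z *v h)) (at z)"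
    "continuous_on (closure N) P" "continuous_on (closure N) G" "continuous_on (closure N) H"
    "\<And>z. z \<in> N \<Longrightarrow> (Q has_derivative (\<lambda>h. G' z \<bullet> h)) (at z)" "\<And>z. z \<in> N \<Longrightarrow> (G' has_derivative (\<lambda>h. H' z *v h)) (at z)"
    "continuous_on (closure N) Q" "continuous_on (closure N) G'" "continuous_on (closure N) H'"
    using assms unfolding C2_closure_def by blast
  show ?thesis
    unfolding C2_closure_def
  proof (intro exI conjI ballI)
    show "((\<lambda>z. P z + Q z) has_derivative (\<lambda>h. (G z + G' z) \<bullet> h)) (at z)" if "z \<in> N" for z
      by (intro has_derivative_inner_add D that)
    show "((\<lambda>z. G z + G' z) has_derivative (\<lambda>h. (H z + H' z) *v h)) (at z)" if "z \<in> N" for z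
      by (intro has_derivative_matrix_add D that)
    show "continuous_on (closure N) (\<lambda>z. P z + Q z)" "continuous_on (closure N) (\<lambda>z. G z + G' z)"
      "continuous_on (closure N) (\<lambda>z. H z + H' z)" by (intro continuous_intros D)+
  qed
qed

lemma C2_closure_subset:
  assumes "C2_closure N P" "N' \<subseteq> N"
  shows "C2_closure N' P"
proof -
  have "closure N' \<subseteq> closure N" using assms(2) by (rule closure_mono)
  then show ?thesis
    using assms unfolding C2_closure_def by (meson continuous_on_subset subsetD)
qed

lemma C2_closure_scale:
  fixes P :: "real ^ 'n \<Rightarrow> real"
  assumes "C2_closure N P" and r: "r > 0"
  shows "C2_closure ((\<lambda>z. r *\<^sub>R z) ` N) (\<lambda>z. P (z /\<^sub>R r))"
proof -
  obtain G H where D: "\<And>z. z \<in> N \<Longrightarrow> (P has_derivative (\<lambda>h. G z \<bullet> h)) (at z)"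
    "\<And>z. z \<in> N \<Longrightarrow> (G has_derivative (\<lambda>h. H z *v h)) (at z)"
    and c: "continuous_on (closure N) P" "continuous_on (closure N) G" "continuous_on (closure N) H"
    using assms(1) unfolding C2_closure_def by blast
  have cl: "closure ((\<lambda>z. r *\<^sub>R z) ` N) = (\<lambda>z. r *\<^sub>R z) ` closure N" by (rule closure_scaleR[symmetric])
  have sc: "((\<lambda>z. z /\<^sub>R r) has_derivative (\<lambda>h. h /\<^sub>R r)) (at z)" for z :: "real ^ 'n"
    by (auto intro!: derivative_eq_intros)

  have cc: "continuous_on ((\<lambda>z. r *\<^sub>R z) ` closure N) (\<lambda>z. f (z /\<^sub>R r))"
    if "continuous_on (closure N) f" for f :: "real ^ 'n \<Rightarrow> 'b::topological_space"
    by (rule continuous_on_compose2[OF that]) (use r in \<open>auto intro!: continuous_intros\<close>)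
  show ?thesis
    unfolding C2_closure_def cl
  proof (intro exI conjI ballI)
    fix z assume "z \<in> (\<lambda>z. r *\<^sub>R z) ` N"
    then have z: "z /\<^sub>R r \<in> N" using r by auto
    show "((\<lambda>z. P (z /\<^sub>R r)) has_derivative (\<lambda>h. (G (z /\<^sub>R r) /\<^sub>R r) \<bullet> h)) (at z)"
      using has_derivative_compose[OF sc D(1)[OF z]] by (simp add: inner_commute)
    have "((\<lambda>z. G (z /\<^sub>R r)) has_derivative (\<lambda>h. H (z /\<^sub>R r) *v (h /\<^sub>R r))) (at z)"
      by (rule has_derivative_compose[OF sc D(2)[OF z]])
    from has_derivative_scaleR_right[OF this, of "inverse r"]
    show "((\<lambda>z. G (z /\<^sub>R r) /\<^sub>R r) has_derivative (\<lambda>h. ((1 / r\<^sup>2) *\<^sub>R H (z /\<^sub>R r)) *v h)) (at z)"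
      by (rule has_derivative_eq_rhs)
         (use r in \<open>auto simp: fun_eq_iff matrix_vector_mult_scaleR scaleR_matrix_vector_assoc[symmetric] divide_inverse power2_eq_square\<close>)
  next
    show "continuous_on ((\<lambda>z. r *\<^sub>R z) ` closure N) (\<lambda>z. P (z /\<^sub>R r))" by (rule cc[OF c(1)])
    show "continuous_on ((\<lambda>z. r *\<^sub>R z) ` closure N) (\<lambda>z. G (z /\<^sub>R r) /\<^sub>R r)"
      by (intro continuous_intros cc c)
    show "continuous_on ((\<lambda>z. r *\<^sub>R z) ` closure N) (\<lambda>z. (1 / r\<^sup>2) *\<^sub>R H (z /\<^sub>R r))"
      by (intro continuous_intros cc c)
  qed
qed

text \<open>Additivity and scaling of the extended integral are available for measurable integrands
  only, so glued test functions must be known to be measurable.\<close>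

lemma measurable_test_function:
  fixes \<phi> w :: "real ^ 'n \<Rightarrow> real"
  assumes "C2_closure N \<phi>" "open N" and w[measurable]: "w \<in> borel_measurable borel"
  shows "(\<lambda>z. if z \<in> N then \<phi> z else w z) \<in> borel_measurable borel"
proof -
  have [measurable]: "N \<in> sets borel" using assms by auto
  have "continuous_on N \<phi>" using assms(1) closure_subset unfolding C2_closure_def by (meson continuous_on_subset)
  then have [measurable]: "(\<lambda>z. indicator N z *\<^sub>R \<phi> z) \<in> borel_measurable borel"
    by (intro borel_measurable_continuous_on_indicator) auto
  have "(\<lambda>z. if z \<in> N then \<phi> z else w z) = (\<lambda>z. if z \<in> N then indicator N z *\<^sub>R \<phi> z else w z)" by auto
  also have "\<dots> \<in> borel_measurable borel" by measurable
  finally show ?thesis .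
qed

text \<open>Each kernel is required to give 0 separately, with absolute convergence. Adding such a
  function then changes no operator of the class at x, hence neither the supremum nor the
  infimum.\<close>

definition universally_harmonic :: "real \<Rightarrow> real \<Rightarrow> real \<Rightarrow> (real ^ 'n \<Rightarrow> real) \<Rightarrow> real ^ 'n \<Rightarrow> bool" where
  "universally_harmonic s lam Lam P x \<longleftrightarrow> (\<forall>\<mu> \<in> kernels lam Lam.
    has_bochner_integral lborel (\<lambda>y. ((P (x + y) + P (x - y)) / 2 - P x) * kernel_fun s \<mu> y) 0)"

lemma universally_harmonic_add:
  assumes "universally_harmonic s lam Lam P x" "universally_harmonic s lam Lam Q x"
  shows "universally_harmonic s lam Lam (\<lambda>z. P z + Q z) x"
  unfolding universally_harmonic_def
proof
  fix \<mu> :: "real ^ 'a \<Rightarrow> real" assume "\<mu> \<in> kernels lam Lam"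
  then have "has_bochner_integral lborel (\<lambda>y. ((P (x + y) + P (x - y)) / 2 - P x) * kernel_fun s \<mu> y
      + ((Q (x + y) + Q (x - y)) / 2 - Q x) * kernel_fun s \<mu> y) (0 + 0)"
    using assms unfolding universally_harmonic_def by (intro has_bochner_integral_add) auto
  moreover have "((P (x + y) + P (x - y)) / 2 - P x) * kernel_fun s \<mu> y
      + ((Q (x + y) + Q (x - y)) / 2 - Q x) * kernel_fun s \<mu> y
    = ((P (x + y) + Q (x + y) + (P (x - y) + Q (x - y))) / 2 - (P x + Q x)) * kernel_fun s \<mu> y" for y
    by (simp add: field_simps)
  ultimately show "has_bochner_integral lborel (\<lambda>y. ((P (x + y) + Q (x + y) + (P (x - y) + Q (x - y))) / 2 - (P x + Q x)) * kernel_fun s \<mu> y) 0"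
    by simp
qed

lemma universally_harmonic_component:
  assumes "0 < lam" "0 < s" "F \<in> borel_measurable borel" "has_frac_lap s F (x $ k) 0"
  shows "universally_harmonic s lam Lam (\<lambda>z. F (z $ k)) x"
  unfolding universally_harmonic_def
proof
  fix \<mu> :: "real ^ 'a \<Rightarrow> real" assume "\<mu> \<in> kernels lam Lam"
  from has_bochner_integral_kernel_flat[OF this assms]
  have "has_bochner_integral lborel (\<lambda>y. (second_diff F (x $ k) (y $ k) / 2) * kernel_fun s \<mu> y) 0" .
  moreover have "second_diff F (x $ k) (y $ k) / 2 = (F ((x + y) $ k) + F ((x - y) $ k)) / 2 - F (x $ k)" for y
    by (simp add: second_diff_def field_simps)
  ultimately show "has_bochner_integral lborel (\<lambda>y. ((F ((x + y) $ k) + F ((x - y) $ k)) / 2 - F (x $ k)) * kernel_fun s \<mu> y) 0"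
    by simp
qed

text \<open>A discrete product rule: the symmetric difference of (p \<bullet> z) F splits into p
  \<bullet> x times that of F and half of (p \<bullet> y)(F (x_k + y_k) - F (x_k - y_k)). The first
  vanishes by harmonicity of F, the second by the odd integral.\<close>

lemma universally_harmonic_linear_component:
  fixes p x :: "real ^ 'n"
  assumes "0 < lam" "0 < s" "F \<in> borel_measurable borel" "has_frac_lap s F (x $ k) 0"
    and odd: "has_bochner_integral lborel
      (\<lambda>t. indicator {0<..} t * ((F (x $ k + t) - F (x $ k - t)) * t powr (- 2 * s))) 0"
  shows "universally_harmonic s lam Lam (\<lambda>z. (p \<bullet> z) * F (z $ k)) x"
  unfolding universally_harmonic_def
proof
  fix \<mu> :: "real ^ 'n \<Rightarrow> real" assume \<mu>: "\<mu> \<in> kernels lam Lam"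
  have "has_bochner_integral lborel (\<lambda>y. (p \<bullet> x) * ((second_diff F (x $ k) (y $ k) / 2) * kernel_fun s \<mu> y)
      + (1 / 2) * ((p \<bullet> y) * (F (x $ k + y $ k) - F (x $ k - y $ k)) * kernel_fun s \<mu> y)) ((p \<bullet> x) * 0 + (1 / 2) * 0)"
    by (intro has_bochner_integral_add has_bochner_integral_mult_right
        has_bochner_integral_kernel_flat[OF \<mu> assms(1-4)] has_bochner_integral_kernel_cross[OF \<mu> assms(1-3) odd])
  moreover have "(p \<bullet> x) * ((second_diff F (x $ k) (y $ k) / 2) * kernel_fun s \<mu> y)
      + (1 / 2) * ((p \<bullet> y) * (F (x $ k + y $ k) - F (x $ k - y $ k)) * kernel_fun s \<mu> y)
      = ((p \<bullet> (x + y) * F ((x + y) $ k) + p \<bullet> (x - y) * F ((x - y) $ k)) / 2 - p \<bullet> x * F (x $ k)) * kernel_fun s \<mu> y" for y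
    by (simp add: second_diff_def inner_add_right inner_diff_right field_simps)
  ultimately show "has_bochner_integral lborel (\<lambda>y. ((p \<bullet> (x + y) * F ((x + y) $ k) + p \<bullet> (x - y) * F ((x - y) $ k)) / 2
      - p \<bullet> x * F (x $ k)) * kernel_fun s \<mu> y) 0"
    by simp
qed

lemma stable_op_kernel_fun:
  "stable_op s \<mu> u x = ereal (1 - s) * ext_integral (\<lambda>y. ((u (x + y) + u (x - y)) / 2 - u x) * kernel_fun s \<mu> y)"
  by (simp add: stable_op_def kernel_fun_def)

lemma stable_op_mono:
  assumes \<mu>: "\<mu> \<in> kernels lam Lam" and "0 < lam" "0 < s" "s < 1"
    and "\<And>z. u z \<le> v z" "u x = v x"
  shows "stable_op s \<mu> u x \<le> stable_op s \<mu> v x"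
  unfolding stable_op_kernel_fun using assms kernel_fun_bounds(1)[OF \<mu> assms(2,3)]
  by (intro ereal_mult_left_mono ext_integral_mono mult_right_mono) (auto intro!: divide_right_mono add_mono)

lemma stable_op_add:
  fixes u v :: "real ^ 'n \<Rightarrow> real"
  assumes \<mu>: "\<mu> \<in> kernels lam Lam" and "0 < lam" "0 < s" and [measurable]: "u \<in> borel_measurable borel"
    and v: "has_bochner_integral lborel (\<lambda>y. ((v (x + y) + v (x - y)) / 2 - v x) * kernel_fun s \<mu> y) I"
  shows "stable_op s \<mu> (\<lambda>z. u z + v z) x = ereal (1 - s) * (ext_integral (\<lambda>y. ((u (x + y) + u (x - y)) / 2 - u x) * kernel_fun s \<mu> y) + ereal I)"
proof -
  have [measurable]: "kernel_fun s \<mu> \<in> borel_measurable borel" by (rule measurable_kernel_fun[OF \<mu> assms(2,3)])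
  have "ext_integral (\<lambda>y. ((u (x + y) + u (x - y)) / 2 - u x) * kernel_fun s \<mu> y
        + ((v (x + y) + v (x - y)) / 2 - v x) * kernel_fun s \<mu> y)
      = ext_integral (\<lambda>y. ((u (x + y) + u (x - y)) / 2 - u x) * kernel_fun s \<mu> y) + ereal I"
    by (rule ext_integral_add[OF _ v]) measurable
  moreover have "((u (x + y) + u (x - y)) / 2 - u x) * kernel_fun s \<mu> y
        + ((v (x + y) + v (x - y)) / 2 - v x) * kernel_fun s \<mu> y
      = ((u (x + y) + v (x + y) + (u (x - y) + v (x - y))) / 2 - (u x + v x)) * kernel_fun s \<mu> y" for y
    by (simp add: field_simps)
  ultimately show ?thesis by (simp add: stable_op_kernel_fun)
qed

lemma stable_op_add_harmonic:
  assumes "\<mu> \<in> kernels lam Lam" "0 < lam" "0 < s" "u \<in> borel_measurable borel" "universally_harmonic s lam Lam P x"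
  shows "stable_op s \<mu> (\<lambda>z. u z + P z) x = stable_op s \<mu> u x"
  using stable_op_add[OF assms(1-4), of P x 0] assms(1,5)
  by (simp add: universally_harmonic_def stable_op_kernel_fun zero_ereal_def[symmetric])

text \<open>If \<phi> touches w - P from above, then \<phi> + P touches w. The closure of the given
  neighbourhood may reach points where P is not smooth, so the touching is tested on a smaller ball.
  Returning to the original neighbourhood raises the test function away from x, and each operator
  with it.\<close>

lemma visc_M_plus_ge_subtract:
  fixes w P :: "real ^ 'n \<Rightarrow> real"
  assumes visc: "visc_M_plus_ge s lam Lam U w g" and lam: "0 < lam" and s: "0 < s" "s < 1"
    and w[measurable]: "w \<in> borel_measurable borel" and P[measurable]: "P \<in> borel_measurable borel"
    and c2: "c2_on U P" and harm: "\<And>x. x \<in> U \<Longrightarrow> universally_harmonic s lam Lam P x"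
    and wi: "weighted_integrable s (\<lambda>z. w z - P z)" and usc: "usc_on U (\<lambda>z. w z - P z)"
  shows "visc_M_plus_ge s lam Lam U (\<lambda>z. w z - P z) g"
  unfolding visc_M_plus_ge_def
proof (intro conjI allI impI wi usc)
  fix x N \<phi>
  assume "x \<in> U \<and> open N \<and> x \<in> N \<and> N \<subseteq> U \<and> C2_closure N \<phi> \<and>
     \<phi> x = w x - P x \<and> (\<forall>z\<in>N - {x}. w z - P z < \<phi> z)"
  then have x: "x \<in> U" "x \<in> N" and N: "open N" "N \<subseteq> U" "C2_closure N \<phi>"
    and \<phi>: "\<phi> x = w x - P x" "\<And>z. z \<in> N - {x} \<Longrightarrow> w z - P z < \<phi> z" by auto
  obtain r where r: "r > 0" "cball x r \<subseteq> N" using N(1) x(2) open_contains_cball by blast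
  define N' where "N' = ball x r"
  have N': "open N'" "x \<in> N'" "N' \<subseteq> N" "closure N' \<subseteq> U" using r N(2) by (auto simp: N'_def)
  have C2: "C2_closure N' (\<lambda>z. \<phi> z + P z)"
    by (intro C2_closure_add C2_closure_subset[OF N(3) N'(3)] c2_on_imp_C2_closure[OF c2 N'(4)])
  define v where "v = (\<lambda>z. if z \<in> N' then \<phi> z else w z - P z)"
  have [measurable]: "v \<in> borel_measurable borel"
    unfolding v_def by (rule measurable_test_function[OF C2_closure_subset[OF N(3) N'(3)] N'(1)]) measurable
  have "M_plus s lam Lam (\<lambda>z. if z \<in> N' then \<phi> z + P z else w z) x \<ge> ereal (g x)"
  proof -
    have "\<forall>z\<in>N' - {x}. w z < \<phi> z + P z" using \<phi>(2) N'(3) by force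
    moreover have "N' \<subseteq> U" using N'(3) N(2) by blast
    ultimately show ?thesis
      using visc x(1) N'(1,2) C2 \<phi>(1) unfolding visc_M_plus_ge_def
      by (elim conjE allE[of _ x] allE[of _ N'] allE[of _ "\<lambda>z. \<phi> z + P z"]) auto
  qed
  moreover have "M_plus s lam Lam (\<lambda>z. if z \<in> N' then \<phi> z + P z else w z) x
      \<le> M_plus s lam Lam (\<lambda>z. if z \<in> N then \<phi> z else w z - P z) x"
    unfolding M_plus_def L_star_def image_image
  proof (rule SUP_subset_mono[OF order.refl])
    fix \<mu> :: "real ^ 'n \<Rightarrow> real" assume \<mu>: "\<mu> \<in> kernels lam Lam"
    have "(\<lambda>z. if z \<in> N' then \<phi> z + P z else w z) = (\<lambda>z. v z + P z)" by (auto simp: v_def)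
    then have "stable_op s \<mu> (\<lambda>z. if z \<in> N' then \<phi> z + P z else w z) x = stable_op s \<mu> v x"
      using stable_op_add_harmonic[OF \<mu> lam s(1) _ harm[OF x(1)], of v] by simp
    also have "\<dots> \<le> stable_op s \<mu> (\<lambda>z. if z \<in> N then \<phi> z else w z - P z) x"
    proof (rule stable_op_mono[OF \<mu> lam s])
      show "v z \<le> (if z \<in> N then \<phi> z else w z - P z)" for z
        using \<phi>(2)[of z] N'(2,3) by (cases "z = x") (auto simp: v_def)
    qed (use x N' in \<open>auto simp: v_def\<close>)
    finally show "stable_op s \<mu> (\<lambda>z. if z \<in> N' then \<phi> z + P z else w z) x
        \<le> stable_op s \<mu> (\<lambda>z. if z \<in> N then \<phi> z else w z - P z) x" .
  qed
  ultimately show "M_plus s lam Lam (\<lambda>z. if z \<in> N then \<phi> z else w z - P z) x \<ge> ereal (g x)" by (rule order.trans)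
qed

text \<open>The mirror image for touching from below: returning to the full neighbourhood lowers the
  test function, and hence every operator at x.\<close>

lemma visc_M_minus_le_subtract:
  fixes w P :: "real ^ 'n \<Rightarrow> real"
  assumes visc: "visc_M_minus_le s lam Lam U w g" and lam: "0 < lam" and s: "0 < s" "s < 1"
    and w[measurable]: "w \<in> borel_measurable borel" and P[measurable]: "P \<in> borel_measurable borel"
    and c2: "c2_on U P" and harm: "\<And>x. x \<in> U \<Longrightarrow> universally_harmonic s lam Lam P x"
    and wi: "weighted_integrable s (\<lambda>z. w z - P z)" and lsc: "lsc_on U (\<lambda>z. w z - P z)"
  shows "visc_M_minus_le s lam Lam U (\<lambda>z. w z - P z) g"
  unfolding visc_M_minus_le_def
proof (intro conjI allI impI wi lsc)
  fix x N \<phi>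
  assume "x \<in> U \<and> open N \<and> x \<in> N \<and> N \<subseteq> U \<and> C2_closure N \<phi> \<and>
     \<phi> x = w x - P x \<and> (\<forall>z\<in>N - {x}. \<phi> z < w z - P z)"
  then have x: "x \<in> U" "x \<in> N" and N: "open N" "N \<subseteq> U" "C2_closure N \<phi>"
    and \<phi>: "\<phi> x = w x - P x" "\<And>z. z \<in> N - {x} \<Longrightarrow> \<phi> z < w z - P z" by auto
  obtain r where r: "r > 0" "cball x r \<subseteq> N" using N(1) x(2) open_contains_cball by blast
  define N' where "N' = ball x r"
  have N': "open N'" "x \<in> N'" "N' \<subseteq> N" "closure N' \<subseteq> U" using r N(2) by (auto simp: N'_def)
  have C2: "C2_closure N' (\<lambda>z. \<phi> z + P z)"
    by (intro C2_closure_add C2_closure_subset[OF N(3) N'(3)] c2_on_imp_C2_closure[OF c2 N'(4)])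
  define v where "v = (\<lambda>z. if z \<in> N' then \<phi> z else w z - P z)"
  have [measurable]: "v \<in> borel_measurable borel"
    unfolding v_def by (rule measurable_test_function[OF C2_closure_subset[OF N(3) N'(3)] N'(1)]) measurable
  have "M_minus s lam Lam (\<lambda>z. if z \<in> N then \<phi> z else w z - P z) x
      \<le> M_minus s lam Lam (\<lambda>z. if z \<in> N' then \<phi> z + P z else w z) x"
    unfolding M_minus_def L_star_def image_image
  proof (rule INF_superset_mono[OF order.refl])
    fix \<mu> :: "real ^ 'n \<Rightarrow> real" assume \<mu>: "\<mu> \<in> kernels lam Lam"
    have "stable_op s \<mu> (\<lambda>z. if z \<in> N then \<phi> z else w z - P z) x \<le> stable_op s \<mu> v x"
    proof (rule stable_op_mono[OF \<mu> lam s])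
      show "(if z \<in> N then \<phi> z else w z - P z) \<le> v z" for z
        using \<phi>(2)[of z] N'(2,3) by (cases "z = x") (auto simp: v_def)
    qed (use x N' in \<open>auto simp: v_def\<close>)
    also have "(\<lambda>z. if z \<in> N' then \<phi> z + P z else w z) = (\<lambda>z. v z + P z)" by (auto simp: v_def)
    then have "stable_op s \<mu> v x = stable_op s \<mu> (\<lambda>z. if z \<in> N' then \<phi> z + P z else w z) x"
      using stable_op_add_harmonic[OF \<mu> lam s(1) _ harm[OF x(1)], of v] by simp
    finally show "stable_op s \<mu> (\<lambda>z. if z \<in> N then \<phi> z else w z - P z) x
        \<le> stable_op s \<mu> (\<lambda>z. if z \<in> N' then \<phi> z + P z else w z) x" .
  qed
  also have "M_minus s lam Lam (\<lambda>z. if z \<in> N' then \<phi> z + P z else w z) x \<le> ereal (g x)"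
  proof -
    have "\<forall>z\<in>N' - {x}. \<phi> z + P z < w z" using \<phi>(2) N'(3) by force
    moreover have "N' \<subseteq> U" using N'(3) N(2) by blast
    ultimately show ?thesis
      using visc x(1) N'(1,2) C2 \<phi>(1) unfolding visc_M_minus_le_def
      by (elim conjE allE[of _ x] allE[of _ N'] allE[of _ "\<lambda>z. \<phi> z + P z"]) auto
  qed
  finally show "M_minus s lam Lam (\<lambda>z. if z \<in> N then \<phi> z else w z - P z) x \<le> ereal (g x)" .
qed

section \<open>Solutions of slow growth in the half-space\<close>

lemma holder_seminormD:
  assumes "holder_seminorm b S f \<le> ennreal A" "A \<ge> 0" "x \<in> S" "y \<in> S"
  shows "\<bar>f x - f y\<bar> \<le> A * dist x y powr b"
proof (cases "x = y")
  case False
  have "ennreal (\<bar>f x - f y\<bar> / dist x y powr b) \<le> holder_seminorm b S f"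
    unfolding holder_seminorm_def by (rule SUP_upper2[of "(x, y)"]) (use assms False in auto)
  also have "\<dots> \<le> ennreal A" by fact
  finally have "\<bar>f x - f y\<bar> / dist x y powr b \<le> A" using assms(2) by (simp add: ennreal_le_iff)
  then show ?thesis using False by (simp add: field_simps)
qed simp

lemma isCont_imp_usc_on: "(\<And>x. x \<in> U \<Longrightarrow> isCont w x) \<Longrightarrow> usc_on U w"
  unfolding usc_on_def isCont_def
  by (metis order_tendstoD(2) at_le filter_leD subset_UNIV)

lemma isCont_imp_lsc_on: "(\<And>x. x \<in> U \<Longrightarrow> isCont w x) \<Longrightarrow> lsc_on U w"
  unfolding lsc_on_def isCont_def
  by (metis order_tendstoD(1) at_le filter_leD subset_UNIV)

lemma weighted_integrable_growth:
  fixes w :: "real ^ 'n \<Rightarrow> real"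
  assumes [measurable]: "w \<in> borel_measurable borel" and "\<gamma> < 2 * s"
    and w: "\<And>x. \<bar>w x\<bar> \<le> M * (1 + norm x) powr \<gamma>"
  shows "weighted_integrable s w"
proof -
  have "integrable lborel (\<lambda>x. w x * (1 + norm x) powr (- real CARD('n) - 2 * s))"
  proof (rule Bochner_Integration.integrable_bound)
    show "integrable lborel (\<lambda>x :: real ^ 'n. M * (1 + norm x) powr (- real CARD('n) - (2 * s - \<gamma>)))"
      using assms(2) by (intro integrable_mult_right integrable_weight) simp
    show "AE x in lborel. norm (w x * (1 + norm x) powr (- real CARD('n) - 2 * s))
        \<le> norm (M * (1 + norm x) powr (- real CARD('n) - (2 * s - \<gamma>)))"
    proof (intro AE_I2)
      fix x :: "real ^ 'n"
      have e: "- real CARD('n) - (2 * s - \<gamma>) = \<gamma> + (- real CARD('n) - 2 * s)" by simp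
      have "\<bar>w x\<bar> * (1 + norm x) powr (- real CARD('n) - 2 * s)
          \<le> M * (1 + norm x) powr \<gamma> * (1 + norm x) powr (- real CARD('n) - 2 * s)"
        using w by (intro mult_right_mono) auto
      also have "\<dots> = M * (1 + norm x) powr (- real CARD('n) - (2 * s - \<gamma>))"
        unfolding e powr_add by simp
      also have "\<dots> \<le> \<bar>M\<bar> * (1 + norm x) powr (- real CARD('n) - (2 * s - \<gamma>))"
        by (intro mult_right_mono) auto
      finally show "norm (w x * (1 + norm x) powr (- real CARD('n) - 2 * s))
        \<le> norm (M * (1 + norm x) powr (- real CARD('n) - (2 * s - \<gamma>)))"
        by (simp add: abs_mult)
    qed
  qed measurable
  then show ?thesis
    unfolding weighted_integrable_def by (simp add: integrable_completion)
qed

text \<open>Rescaling changes the positive factor in front of E, so only the sign of the supremum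
  can be transferred. If the perturbed supremum were below -e, all values of E would lie below one
  negative constant; inserting a real d strictly in between makes this work for infinite values of E
  as well.\<close>

lemma SUP_perturbed_ge:
  fixes E :: "'a \<Rightarrow> ereal" and I :: "'a \<Rightarrow> real"
  assumes c: "c1 > 0" "c2 > 0" and I: "\<And>\<mu>. \<mu> \<in> A \<Longrightarrow> \<bar>c2 * I \<mu>\<bar> \<le> e"
    and sup: "(SUP \<mu>\<in>A. ereal c1 * E \<mu>) \<ge> 0"
  shows "(SUP \<mu>\<in>A. ereal c2 * (E \<mu> + ereal (I \<mu>))) \<ge> ereal (- e)"
proof (rule ccontr)
  assume "\<not> ?thesis"
  then have "(SUP \<mu>\<in>A. ereal c2 * (E \<mu> + ereal (I \<mu>))) < ereal (- e)" by (simp only: not_le)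
  from ereal_dense2[OF this] obtain d where d: "(SUP \<mu>\<in>A. ereal c2 * (E \<mu> + ereal (I \<mu>))) < ereal d" "d < - e"
    by auto
  have "ereal c1 * E \<mu> \<le> ereal (c1 * ((d + e) / c2))" if \<mu>: "\<mu> \<in> A" for \<mu>
  proof -
    have "ereal c2 * (E \<mu> + ereal (I \<mu>)) < ereal d"
      using d(1) \<mu> by (meson SUP_upper le_less_trans)
    moreover have "- e \<le> c2 * I \<mu>" using I[OF \<mu>] by (simp add: abs_le_iff)
    moreover have "c1 * r \<le> c1 * ((d + e) / c2)" if "c2 * (r + I \<mu>) < d" "- e \<le> c2 * I \<mu>" for r
      using that c by (intro mult_left_mono) (auto simp: pos_le_divide_eq distrib_left mult.commute)
    ultimately show ?thesis
      using c by (cases "E \<mu>") auto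
  qed
  then have "(SUP \<mu>\<in>A. ereal c1 * E \<mu>) \<le> ereal (c1 * ((d + e) / c2))" by (rule SUP_least)
  also have "\<dots> < 0" using c d(2) by (simp add: zero_ereal_def mult_less_0_iff divide_less_0_iff)
  finally show False using sup by simp
qed

lemma INF_perturbed_le:
  fixes E :: "'a \<Rightarrow> ereal" and I :: "'a \<Rightarrow> real"
  assumes c: "c1 > 0" "c2 > 0" and I: "\<And>\<mu>. \<mu> \<in> A \<Longrightarrow> \<bar>c2 * I \<mu>\<bar> \<le> e"
    and inf: "(INF \<mu>\<in>A. ereal c1 * E \<mu>) \<le> 0"
  shows "(INF \<mu>\<in>A. ereal c2 * (E \<mu> + ereal (I \<mu>))) \<le> ereal e"
proof (rule ccontr)
  assume "\<not> ?thesis"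
  then have "ereal e < (INF \<mu>\<in>A. ereal c2 * (E \<mu> + ereal (I \<mu>)))" by (simp only: not_le)
  from ereal_dense2[OF this] obtain d where d: "ereal d < (INF \<mu>\<in>A. ereal c2 * (E \<mu> + ereal (I \<mu>)))" "e < d"
    by auto
  have "ereal (c1 * ((d - e) / c2)) \<le> ereal c1 * E \<mu>" if \<mu>: "\<mu> \<in> A" for \<mu>
  proof -
    have "ereal d < ereal c2 * (E \<mu> + ereal (I \<mu>))"
      using d(1) \<mu> by (meson INF_lower less_le_trans)
    moreover have "c2 * I \<mu> \<le> e" using I[OF \<mu>] by (simp add: abs_le_iff)
    moreover have "c1 * ((d - e) / c2) \<le> c1 * r" if "d < c2 * (r + I \<mu>)" "c2 * I \<mu> \<le> e" for r
      using that c by (intro mult_left_mono) (auto simp: pos_divide_le_eq distrib_left mult.commute)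
    ultimately show ?thesis
      using c by (cases "E \<mu>") auto
  qed
  then have "ereal (c1 * ((d - e) / c2)) \<le> (INF \<mu>\<in>A. ereal c1 * E \<mu>)" by (rule INF_greatest)
  also note inf
  finally show False using c d(2) by (simp add: zero_ereal_def mult_le_0_iff divide_le_0_iff)
qed

text \<open>The rescaled and truncated function solves the equation up to the contribution of the
  removed tail, which is of order \<open>R\<^sup>s\<^sup>+\<^sup>a\<close>.\<close>

locale half_space_solution =
  fixes k :: "'n::finite" and s lam Lam a M :: real and v :: "real ^ 'n \<Rightarrow> real"
  assumes lam: "0 < lam" and s: "0 < s" "s < 1" and a: "0 \<le> a" "a < s"
    and cont: "continuous_on UNIV v"
    and plus: "visc_M_plus_ge s lam Lam (upper_half_space k) v (\<lambda>x. 0)"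
    and minus: "visc_M_minus_le s lam Lam (upper_half_space k) v (\<lambda>x. 0)"
    and zero: "\<And>x. x $ k \<le> 0 \<Longrightarrow> v x = 0"
    and growth: "\<And>x. \<bar>v x\<bar> \<le> M * (1 + norm x) powr (s + a)"
begin

text \<open>For r \<ge> 1 and R \<ge> 1 one has 1 + |R z| \<le> 3 R r whenever |z| \<le> 2 r, and 9
  bounds 3^(s+a). The exponent combines the growth s + a with the kernel decay -n - 2s; it is
  integrable at infinity because a < s.\<close>

definition "tail_const = M * 9 * \<bar>Lam\<bar> * (LBINT y::real ^ 'n. indicator {y. norm y \<ge> 1} y * norm y powr (- real CARD('n) - (s - a)))"

text \<open>With cutoff radius 2 the truncation is felt only at distance at least 1 from points of
  the unit ball, so the singularity of the kernel is avoided. The values are not normalized; the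
  factor R^(s+a) is carried through the estimates.\<close>

definition "rescaled R = (\<lambda>x. if norm x < 2 then v (R *\<^sub>R x) else 0)"

definition "removed_tail R = (\<lambda>x. if norm x < 2 then 0 else - v (R *\<^sub>R x))"

lemma M_nonneg: "M \<ge> 0"
  using growth[of 0] by (simp add: order.trans[OF abs_ge_zero])

lemma measurable_v[measurable]: "v \<in> borel_measurable borel"
  using cont by (rule borel_measurable_continuous_onI)

lemma tail_integrand_integrable:
  "integrable lborel (\<lambda>y::real ^ 'n. indicator {y. norm y \<ge> 1} y * norm y powr (- real CARD('n) - (s - a)))"
  using a by (intro integrable_tail) simp

lemma tail_const_nonneg: "tail_const \<ge> 0"
  unfolding tail_const_def using M_nonneg
  by (intro mult_nonneg_nonneg Bochner_Integration.integral_nonneg) auto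

lemma growth_scaled:
  assumes "R \<ge> 1" "r \<ge> 1" "norm x \<le> 2 * r"
  shows "\<bar>v (R *\<^sub>R x)\<bar> \<le> M * 9 * R powr (s + a) * r powr (s + a)"
proof -
  have "norm (R *\<^sub>R x) \<le> R * (2 * r)" using assms by (simp add: mult_left_mono)
  moreover have "1 \<le> R * r" using mult_mono[of 1 R 1 r] assms by simp
  ultimately have "1 + norm (R *\<^sub>R x) \<le> 3 * (R * r)" by linarith
  then have "(1 + norm (R *\<^sub>R x)) powr (s + a) \<le> (3 * (R * r)) powr (s + a)"
    using s a by (intro powr_mono2) auto
  also have "\<dots> = 3 powr (s + a) * (R powr (s + a) * r powr (s + a))"
    using assms by (simp add: powr_mult)
  also have "\<dots> \<le> 9 * (R powr (s + a) * r powr (s + a))"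
  proof (rule mult_right_mono)
    have "(3::real) powr (s + a) \<le> 3 powr 2" using s a by (intro powr_mono) auto
    then show "(3::real) powr (s + a) \<le> 9" by simp
  qed simp
  finally have "M * (1 + norm (R *\<^sub>R x)) powr (s + a) \<le> M * (9 * (R powr (s + a) * r powr (s + a)))"
    using M_nonneg by (rule mult_left_mono)
  with growth[of "R *\<^sub>R x"] show ?thesis by (simp add: mult.assoc)
qed

text \<open>For |x| < 1 the removed part vanishes at x and at x + y, x - y with |y| < 1. For larger
  y both points have norm at most 2 |y|, so growth times kernel is the integrand of
  \<open>tail_const\<close>.\<close>

lemma removed_tail_integral:
  assumes R: "R \<ge> 1" and x: "norm x < 1" and \<mu>: "\<mu> \<in> kernels lam Lam"
  obtains I where "has_bochner_integral lborel
      (\<lambda>y. ((removed_tail R (x + y) + removed_tail R (x - y)) / 2 - removed_tail R x) * kernel_fun s \<mu> y) I"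
    "\<bar>I\<bar> \<le> tail_const * R powr (s + a)"
proof -
  define T where "T = removed_tail R"
  have [measurable]: "T \<in> borel_measurable borel"
    unfolding T_def removed_tail_def by measurable
  note km[measurable] = measurable_kernel_fun[OF \<mu> lam s(1)]
  note kb = kernel_fun_bounds[OF \<mu> lam s(1)]
  define q where "q = (\<lambda>y::real ^ 'n. indicator {y. norm y \<ge> 1} y * norm y powr (- real CARD('n) - (s - a)))"
  define c where "c = M * 9 * R powr (s + a) * \<bar>Lam\<bar>"
  have Tx: "T x = 0" using x by (simp add: T_def removed_tail_def)
  have bd: "\<bar>((T (x + y) + T (x - y)) / 2 - T x) * kernel_fun s \<mu> y\<bar> \<le> c * q y" for y
  proof (cases "norm y \<ge> 1")
    case True
    have t: "\<bar>T z\<bar> \<le> M * 9 * R powr (s + a) * norm y powr (s + a)" if "norm z \<le> 2 * norm y" for z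
      using growth_scaled[OF R True that] M_nonneg by (auto simp: T_def removed_tail_def)
    have "norm (x + y) \<le> 2 * norm y" "norm (x - y) \<le> 2 * norm y"
      using norm_triangle_ineq[of x y] norm_triangle_ineq4[of x y] x True by linarith+
    from t[OF this(1)] t[OF this(2)]
    have "\<bar>(T (x + y) + T (x - y)) / 2\<bar> \<le> M * 9 * R powr (s + a) * norm y powr (s + a)"
      by (simp add: abs_le_iff)
    moreover have "kernel_fun s \<mu> y \<le> \<bar>Lam\<bar> * norm y powr (- real CARD('n) - 2 * s)"
      using kb(2)[of y] by (rule order.trans) (intro mult_right_mono, auto)
    ultimately have "\<bar>(T (x + y) + T (x - y)) / 2\<bar> * kernel_fun s \<mu> y
        \<le> (M * 9 * R powr (s + a) * norm y powr (s + a)) * (\<bar>Lam\<bar> * norm y powr (- real CARD('n) - 2 * s))"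
      using kb(1)[of y] M_nonneg by (intro mult_mono) auto
    also have "\<dots> = c * (norm y powr (s + a) * norm y powr (- real CARD('n) - 2 * s))"
      by (simp add: c_def)
    also have "norm y powr (s + a) * norm y powr (- real CARD('n) - 2 * s) = norm y powr (- real CARD('n) - (s - a))"
      by (subst powr_add[symmetric]) (rule arg_cong[of _ _ "\<lambda>e. norm y powr e"], simp)
    finally show ?thesis using True Tx kb(1)[of y] by (simp add: abs_mult q_def)
  next
    case False
    have "norm (x + y) < 2" "norm (x - y) < 2"
      using norm_triangle_ineq[of x y] norm_triangle_ineq4[of x y] x False by linarith+
    then show ?thesis using False Tx by (simp add: T_def removed_tail_def q_def)
  qed
  have qi: "integrable lborel (\<lambda>y. c * q y)"
    using tail_integrand_integrable by (simp add: q_def)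
  have i: "integrable lborel (\<lambda>y. ((T (x + y) + T (x - y)) / 2 - T x) * kernel_fun s \<mu> y)"
  proof (rule Bochner_Integration.integrable_bound[OF qi])
    have "norm (((T (x + y) + T (x - y)) / 2 - T x) * kernel_fun s \<mu> y) \<le> norm (c * q y)" for y
      unfolding real_norm_def using bd[of y] by (rule order.trans[OF _ abs_ge_self])
    then show "AE y in lborel. norm (((T (x + y) + T (x - y)) / 2 - T x) * kernel_fun s \<mu> y) \<le> norm (c * q y)"
      by simp
  qed measurable
  show ?thesis
  proof (rule that[OF has_bochner_integral_integrable[OF i[unfolded T_def]]])
    have "\<bar>LBINT y. ((T (x + y) + T (x - y)) / 2 - T x) * kernel_fun s \<mu> y\<bar>
        \<le> (LBINT y. \<bar>((T (x + y) + T (x - y)) / 2 - T x) * kernel_fun s \<mu> y\<bar>)"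
      by (rule integral_abs_bound)
    also have "\<dots> \<le> (LBINT y. c * q y)"
      using i qi bd by (intro integral_mono integrable_abs) auto
    also have "\<dots> = tail_const * R powr (s + a)"
      by (simp add: c_def q_def tail_const_def)
    finally show "\<bar>LBINT y. ((removed_tail R (x + y) + removed_tail R (x - y)) / 2 - removed_tail R x) * kernel_fun s \<mu> y\<bar>
        \<le> tail_const * R powr (s + a)" unfolding T_def .
  qed
qed

text \<open>The volume element gives R^n and the kernel R^(-n-2s), which leaves R^(-2s). Both scales
  are expressed by the same E, so they can be compared kernel by kernel before passing to supremum
  or infimum.\<close>

lemma stable_op_rescaled:
  assumes R: "R \<ge> 1" and x: "norm x < 1" and \<mu>: "\<mu> \<in> kernels lam Lam"
    and w[measurable]: "w \<in> borel_measurable borel"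
  defines "E \<equiv> ext_integral (\<lambda>y. ((w (R *\<^sub>R (x + y)) + w (R *\<^sub>R (x - y))) / 2 - w (R *\<^sub>R x)) * kernel_fun s \<mu> y)"
  shows "stable_op s \<mu> w (R *\<^sub>R x) = ereal ((1 - s) * R powr (- 2 * s)) * E"
    "\<exists>I. \<bar>I\<bar> \<le> tail_const * R powr (s + a) \<and>
      stable_op s \<mu> (\<lambda>z. w (R *\<^sub>R z) + removed_tail R z) x = ereal (1 - s) * (E + ereal I)"
proof -
  have R0: "R > 0" using R by simp
  note km[measurable] = measurable_kernel_fun[OF \<mu> lam s(1)]
  have "ext_integral (\<lambda>y. ((w (R *\<^sub>R x + y) + w (R *\<^sub>R x - y)) / 2 - w (R *\<^sub>R x)) * kernel_fun s \<mu> y)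
      = ereal (R ^ CARD('n)) * ext_integral (\<lambda>y. ((w (R *\<^sub>R x + R *\<^sub>R y) + w (R *\<^sub>R x - R *\<^sub>R y)) / 2 - w (R *\<^sub>R x)) * kernel_fun s \<mu> (R *\<^sub>R y))"
    by (rule ext_integral_scale[OF _ R0]) measurable
  also have "(\<lambda>y. ((w (R *\<^sub>R x + R *\<^sub>R y) + w (R *\<^sub>R x - R *\<^sub>R y)) / 2 - w (R *\<^sub>R x)) * kernel_fun s \<mu> (R *\<^sub>R y))
      = (\<lambda>y. R powr (- real CARD('n) - 2 * s) * (((w (R *\<^sub>R (x + y)) + w (R *\<^sub>R (x - y))) / 2 - w (R *\<^sub>R x)) * kernel_fun s \<mu> y))"
    by (simp add: fun_eq_iff kernel_fun_scale[OF \<mu> lam s(1) R0] scaleR_add_right scaleR_diff_right)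
  also have "ext_integral \<dots> = ereal (R powr (- real CARD('n) - 2 * s)) * E"
    unfolding E_def using R0 by (intro ext_integral_cmult) auto
  also have "ereal (R ^ CARD('n)) * (ereal (R powr (- real CARD('n) - 2 * s)) * E) = ereal (R powr (- 2 * s)) * E"
  proof -
    have "R ^ CARD('n) * R powr (- real CARD('n) - 2 * s) = R powr real CARD('n) * R powr (- real CARD('n) - 2 * s)"
      using R0 by (simp add: powr_realpow)
    also have "\<dots> = R powr (- 2 * s)"
      by (subst powr_add[symmetric]) (rule arg_cong[of _ _ "\<lambda>e. R powr e"], simp)
    finally show ?thesis by (simp only: mult.assoc[symmetric] times_ereal.simps(1))
  qed
  finally show "stable_op s \<mu> w (R *\<^sub>R x) = ereal ((1 - s) * R powr (- 2 * s)) * E"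
    by (simp only: stable_op_kernel_fun mult.assoc[symmetric] times_ereal.simps(1))
  obtain I where I: "has_bochner_integral lborel
      (\<lambda>y. ((removed_tail R (x + y) + removed_tail R (x - y)) / 2 - removed_tail R x) * kernel_fun s \<mu> y) I"
    "\<bar>I\<bar> \<le> tail_const * R powr (s + a)"
    by (rule removed_tail_integral[OF R x \<mu>])
  have "stable_op s \<mu> (\<lambda>z. w (R *\<^sub>R z) + removed_tail R z) x = ereal (1 - s) * (E + ereal I)"
    unfolding E_def by (rule stable_op_add[OF \<mu> lam s(1) _ I(1)]) measurable
  with I(2) show "\<exists>I. \<bar>I\<bar> \<le> tail_const * R powr (s + a) \<and>
      stable_op s \<mu> (\<lambda>z. w (R *\<^sub>R z) + removed_tail R z) x = ereal (1 - s) * (E + ereal I)" by blast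
qed

lemma M_plus_rescaled:
  assumes R: "R \<ge> 1" and x: "norm x < 1" and w[measurable]: "w \<in> borel_measurable borel"
  shows "M_plus s lam Lam w (R *\<^sub>R x) \<ge> 0 \<Longrightarrow>
      M_plus s lam Lam (\<lambda>z. w (R *\<^sub>R z) + removed_tail R z) x \<ge> ereal (- (tail_const * R powr (s + a)))"
    and "M_minus s lam Lam w (R *\<^sub>R x) \<le> 0 \<Longrightarrow>
      M_minus s lam Lam (\<lambda>z. w (R *\<^sub>R z) + removed_tail R z) x \<le> ereal (tail_const * R powr (s + a))"
proof -
  define E where "E = (\<lambda>\<mu>. ext_integral (\<lambda>y. ((w (R *\<^sub>R (x + y)) + w (R *\<^sub>R (x - y))) / 2 - w (R *\<^sub>R x)) * kernel_fun s \<mu> y))"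
  have "\<forall>\<mu>. \<exists>I. \<mu> \<in> kernels lam Lam \<longrightarrow> \<bar>I\<bar> \<le> tail_const * R powr (s + a) \<and>
      stable_op s \<mu> (\<lambda>z. w (R *\<^sub>R z) + removed_tail R z) x = ereal (1 - s) * (E \<mu> + ereal I)"
    using stable_op_rescaled(2)[OF R x _ w] unfolding E_def by blast
  then obtain I where I: "\<And>\<mu>. \<mu> \<in> kernels lam Lam \<Longrightarrow> \<bar>I \<mu>\<bar> \<le> tail_const * R powr (s + a)"
    "\<And>\<mu>. \<mu> \<in> kernels lam Lam \<Longrightarrow>
      stable_op s \<mu> (\<lambda>z. w (R *\<^sub>R z) + removed_tail R z) x = ereal (1 - s) * (E \<mu> + ereal (I \<mu>))"
    by metis
  have I': "\<bar>(1 - s) * I \<mu>\<bar> \<le> tail_const * R powr (s + a)" if "\<mu> \<in> kernels lam Lam" for \<mu>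
  proof -
    have "\<bar>(1 - s) * I \<mu>\<bar> \<le> 1 * \<bar>I \<mu>\<bar>" unfolding abs_mult using s by (intro mult_right_mono) auto
    with I(1)[OF that] show ?thesis by simp
  qed
  have c: "(1 - s) * R powr (- 2 * s) > 0" "1 - s > 0" using s R by auto
  have 1: "M_plus s lam Lam w (R *\<^sub>R x) = (SUP \<mu>\<in>kernels lam Lam. ereal ((1 - s) * R powr (- 2 * s)) * E \<mu>)"
    "M_minus s lam Lam w (R *\<^sub>R x) = (INF \<mu>\<in>kernels lam Lam. ereal ((1 - s) * R powr (- 2 * s)) * E \<mu>)"
    unfolding M_plus_def M_minus_def L_star_def image_image E_def
    using stable_op_rescaled(1)[OF R x _ w] by (auto intro!: SUP_cong INF_cong)
  have 2: "M_plus s lam Lam (\<lambda>z. w (R *\<^sub>R z) + removed_tail R z) x = (SUP \<mu>\<in>kernels lam Lam. ereal (1 - s) * (E \<mu> + ereal (I \<mu>)))"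
    "M_minus s lam Lam (\<lambda>z. w (R *\<^sub>R z) + removed_tail R z) x = (INF \<mu>\<in>kernels lam Lam. ereal (1 - s) * (E \<mu> + ereal (I \<mu>)))"
    unfolding M_plus_def M_minus_def L_star_def image_image
    using I(2) by (auto intro!: SUP_cong INF_cong)
  show "M_plus s lam Lam w (R *\<^sub>R x) \<ge> 0 \<Longrightarrow>
      M_plus s lam Lam (\<lambda>z. w (R *\<^sub>R z) + removed_tail R z) x \<ge> ereal (- (tail_const * R powr (s + a)))"
    unfolding 1 2 by (rule SUP_perturbed_ge[OF c I'])
  show "M_minus s lam Lam w (R *\<^sub>R x) \<le> 0 \<Longrightarrow>
      M_minus s lam Lam (\<lambda>z. w (R *\<^sub>R z) + removed_tail R z) x \<le> ereal (tail_const * R powr (s + a))"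
    unfolding 1 2 by (rule INF_perturbed_le[OF c I'])
qed

text \<open>N lies inside the unit ball, where nothing has been truncated; a test function at unit
  scale is therefore a dilated test function for v plus the removed tail.\<close>

lemma rescaled_test:
  assumes R: "R \<ge> 1" and N: "N \<subseteq> upper_half_ball k 1"
  shows "(\<lambda>z. if z \<in> N then \<phi> z else rescaled R z)
    = (\<lambda>z. (if R *\<^sub>R z \<in> (\<lambda>z. R *\<^sub>R z) ` N then \<phi> ((R *\<^sub>R z) /\<^sub>R R) else v (R *\<^sub>R z)) + removed_tail R z)"
proof
  fix z
  have "R *\<^sub>R z \<in> (\<lambda>z. R *\<^sub>R z) ` N \<longleftrightarrow> z \<in> N" using R by auto
  moreover have "norm z < 2" if "z \<in> N" using that N by (auto simp: upper_half_ball_def)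
  ultimately show "(if z \<in> N then \<phi> z else rescaled R z)
    = (if R *\<^sub>R z \<in> (\<lambda>z. R *\<^sub>R z) ` N then \<phi> ((R *\<^sub>R z) /\<^sub>R R) else v (R *\<^sub>R z)) + removed_tail R z"
    using R by (auto simp: rescaled_def removed_tail_def)
qed

lemma isCont_rescaled: "norm x < 2 \<Longrightarrow> isCont (rescaled R) x"
proof -
  assume x: "norm x < 2"
  have "continuous_on UNIV (\<lambda>x. v (R *\<^sub>R x))"
    by (rule continuous_on_compose2[OF cont]) (auto intro!: continuous_intros)
  then have "isCont (\<lambda>x. v (R *\<^sub>R x)) x" by (simp add: continuous_on_eq_continuous_at)
  moreover have "eventually (\<lambda>y. y \<in> ball 0 2) (nhds x)"
    using x by (intro eventually_nhds_in_open) auto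
  then have "eventually (\<lambda>y. rescaled R y = v (R *\<^sub>R y)) (nhds x)"
    by eventually_elim (simp add: rescaled_def)
  from isCont_cong[OF this] calculation show ?thesis by simp
qed

lemma rescaled_bound: "R \<ge> 1 \<Longrightarrow> \<bar>rescaled R x\<bar> \<le> M * 9 * R powr (s + a)"
  using growth_scaled[of R 1 x] M_nonneg by (auto simp: rescaled_def)

lemma measurable_rescaled[measurable]: "rescaled R \<in> borel_measurable borel"
  unfolding rescaled_def by measurable

lemma weighted_integrable_rescaled: "R \<ge> 1 \<Longrightarrow> weighted_integrable s (rescaled R)"
  by (rule weighted_integrable_growth[of _ 0 _ "M * 9 * R powr (s + a)"])
     (use s rescaled_bound in \<open>auto simp: add_nonneg_eq_0_iff\<close>)

lemma in_upper_half_space_scaled: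
  "R \<ge> 1 \<Longrightarrow> N \<subseteq> upper_half_ball k 1 \<Longrightarrow> (\<lambda>z. R *\<^sub>R z) ` N \<subseteq> upper_half_space k"
  by (auto simp: upper_half_ball_def upper_half_space_def subset_iff)

text \<open>A test function touching on N is dilated to one touching v on R N, which lies in the
  half-space where the equation holds; the tail then enters as a bounded right-hand side.\<close>

lemma visc_M_plus_ge_rescaled:
  assumes R: "R \<ge> 1"
  shows "visc_M_plus_ge s lam Lam (upper_half_ball k 1) (rescaled R) (\<lambda>x. - (tail_const * R powr (s + a)))"
  unfolding visc_M_plus_ge_def
proof (intro conjI allI impI)
  show "weighted_integrable s (rescaled R)" by (rule weighted_integrable_rescaled[OF R])
  show "usc_on (upper_half_ball k 1) (rescaled R)"
    by (intro isCont_imp_usc_on isCont_rescaled) (auto simp: upper_half_ball_def)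
  fix x N \<phi>
  assume "x \<in> upper_half_ball k 1 \<and> open N \<and> x \<in> N \<and> N \<subseteq> upper_half_ball k 1 \<and> C2_closure N \<phi> \<and>
     \<phi> x = rescaled R x \<and> (\<forall>z\<in>N - {x}. rescaled R z < \<phi> z)"
  then have x: "x \<in> upper_half_ball k 1" "x \<in> N" and N: "open N" "N \<subseteq> upper_half_ball k 1" "C2_closure N \<phi>"
    and \<phi>: "\<phi> x = rescaled R x" "\<And>z. z \<in> N - {x} \<Longrightarrow> rescaled R z < \<phi> z" by auto
  have R0: "R > 0" using R by simp
  define N' where "N' = (\<lambda>z. R *\<^sub>R z) ` N"
  define w where "w = (\<lambda>z. if z \<in> N' then \<phi> (z /\<^sub>R R) else v z)"
  have N': "open N'" "N' \<subseteq> upper_half_space k" "C2_closure N' (\<lambda>z. \<phi> (z /\<^sub>R R))" "R *\<^sub>R x \<in> N'"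
    unfolding N'_def using N x R0 open_scaling[of R N] C2_closure_scale[OF N(3) R0] in_upper_half_space_scaled[OF R N(2)] by auto
  have nN: "norm z < 1" if "z \<in> N" for z using that N(2) by (auto simp: upper_half_ball_def)
  have "M_plus s lam Lam w (R *\<^sub>R x) \<ge> ereal 0"
  proof -
    have "\<phi> ((R *\<^sub>R x) /\<^sub>R R) = v (R *\<^sub>R x)" using \<phi>(1) nN[OF x(2)] R0 by (simp add: rescaled_def)
    moreover have "\<forall>z\<in>N' - {R *\<^sub>R x}. \<phi> (z /\<^sub>R R) > v z"
    proof
      fix z assume "z \<in> N' - {R *\<^sub>R x}"
      then obtain y where y: "y \<in> N - {x}" "z = R *\<^sub>R y" by (auto simp: N'_def)
      then show "\<phi> (z /\<^sub>R R) > v z" using \<phi>(2)[OF y(1)] nN[of y] R0 by (simp add: rescaled_def)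
    qed
    ultimately show ?thesis
      using plus N' unfolding visc_M_plus_ge_def w_def
      by (elim conjE allE[of _ "R *\<^sub>R x"] allE[of _ N'] allE[of _ "\<lambda>z. \<phi> (z /\<^sub>R R)"]) auto
  qed
  moreover have "w \<in> borel_measurable borel"
    unfolding w_def by (rule measurable_test_function[OF N'(3,1)]) measurable
  moreover have "norm x < 1" by (rule nN[OF x(2)])
  ultimately have "M_plus s lam Lam (\<lambda>z. w (R *\<^sub>R z) + removed_tail R z) x \<ge> ereal (- (tail_const * R powr (s + a)))"
    using M_plus_rescaled(1)[OF R] by (simp add: zero_ereal_def)
  then show "M_plus s lam Lam (\<lambda>z. if z \<in> N then \<phi> z else rescaled R z) x \<ge> ereal (- (tail_const * R powr (s + a)))"
    unfolding rescaled_test[OF R N(2)] w_def N'_def .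
qed

lemma visc_M_minus_le_rescaled:
  assumes R: "R \<ge> 1"
  shows "visc_M_minus_le s lam Lam (upper_half_ball k 1) (rescaled R) (\<lambda>x. tail_const * R powr (s + a))"
  unfolding visc_M_minus_le_def
proof (intro conjI allI impI)
  show "weighted_integrable s (rescaled R)" by (rule weighted_integrable_rescaled[OF R])
  show "lsc_on (upper_half_ball k 1) (rescaled R)"
    by (intro isCont_imp_lsc_on isCont_rescaled) (auto simp: upper_half_ball_def)
  fix x N \<phi>
  assume "x \<in> upper_half_ball k 1 \<and> open N \<and> x \<in> N \<and> N \<subseteq> upper_half_ball k 1 \<and> C2_closure N \<phi> \<and>
     \<phi> x = rescaled R x \<and> (\<forall>z\<in>N - {x}. \<phi> z < rescaled R z)"
  then have x: "x \<in> upper_half_ball k 1" "x \<in> N" and N: "open N" "N \<subseteq> upper_half_ball k 1" "C2_closure N \<phi>"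
    and \<phi>: "\<phi> x = rescaled R x" "\<And>z. z \<in> N - {x} \<Longrightarrow> \<phi> z < rescaled R z" by auto
  have R0: "R > 0" using R by simp
  define N' where "N' = (\<lambda>z. R *\<^sub>R z) ` N"
  define w where "w = (\<lambda>z. if z \<in> N' then \<phi> (z /\<^sub>R R) else v z)"
  have N': "open N'" "N' \<subseteq> upper_half_space k" "C2_closure N' (\<lambda>z. \<phi> (z /\<^sub>R R))" "R *\<^sub>R x \<in> N'"
    unfolding N'_def using N x R0 open_scaling[of R N] C2_closure_scale[OF N(3) R0] in_upper_half_space_scaled[OF R N(2)] by auto
  have nN: "norm z < 1" if "z \<in> N" for z using that N(2) by (auto simp: upper_half_ball_def)
  have "M_minus s lam Lam w (R *\<^sub>R x) \<le> ereal 0"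
  proof -
    have "\<phi> ((R *\<^sub>R x) /\<^sub>R R) = v (R *\<^sub>R x)" using \<phi>(1) nN[OF x(2)] R0 by (simp add: rescaled_def)
    moreover have "\<forall>z\<in>N' - {R *\<^sub>R x}. \<phi> (z /\<^sub>R R) < v z"
    proof
      fix z assume "z \<in> N' - {R *\<^sub>R x}"
      then obtain y where y: "y \<in> N - {x}" "z = R *\<^sub>R y" by (auto simp: N'_def)
      then show "\<phi> (z /\<^sub>R R) < v z" using \<phi>(2)[OF y(1)] nN[of y] R0 by (simp add: rescaled_def)
    qed
    ultimately show ?thesis
      using minus N' unfolding visc_M_minus_le_def w_def
      by (elim conjE allE[of _ "R *\<^sub>R x"] allE[of _ N'] allE[of _ "\<lambda>z. \<phi> (z /\<^sub>R R)"]) auto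
  qed
  moreover have "w \<in> borel_measurable borel"
    unfolding w_def by (rule measurable_test_function[OF N'(3,1)]) measurable
  moreover have "norm x < 1" by (rule nN[OF x(2)])
  ultimately have "M_minus s lam Lam (\<lambda>z. w (R *\<^sub>R z) + removed_tail R z) x \<le> ereal (tail_const * R powr (s + a))"
    using M_plus_rescaled(2)[OF R] by (simp add: zero_ereal_def)
  then show "M_minus s lam Lam (\<lambda>z. if z \<in> N then \<phi> z else rescaled R z) x \<le> ereal (tail_const * R powr (s + a))"
    unfolding rescaled_test[OF R N(2)] w_def N'_def .
qed

text \<open>The boundary estimate bounds the Hoelder seminorm of the rescaled quotient by D R^(s+a)
  with D independent of R. In the original variables this reads |q x - q y| \<le> D |x - y|^abar
  R^(a-abar), and R \<rightarrow> \<infinity> makes q constant.\<close>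

lemma half_space_liouville:
  assumes s0: "s \<in> {s0..<1}" and be: "boundary_exponent k s0 lam Lam abar" and a_abar: "a < abar"
  obtains c where "\<And>x. v x = c * pos_powr s (x $ k)"
proof -
  obtain C where abar: "0 < abar" and C: "C \<ge> 0" and est: "\<And>C0 u. C0 \<ge> 0 \<Longrightarrow>
      continuous_on (ball 0 1) u \<Longrightarrow> in_Linf u \<Longrightarrow>
      visc_M_plus_ge s lam Lam (upper_half_ball k 1) u (\<lambda>x. - C0) \<Longrightarrow>
      visc_M_minus_le s lam Lam (upper_half_ball k 1) u (\<lambda>x. C0) \<Longrightarrow>
      (\<forall>x \<in> lower_half_ball k 1. u x = 0) \<Longrightarrow>
      holder_norm abar (upper_half_ball k (1/2)) (\<lambda>x. u x / (x $ k) powr s) \<le> ennreal C * (ennreal C0 + Linf_norm u)"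
    using be s0 unfolding boundary_exponent_def by blast
  define D where "D = C * (tail_const + M * 9)"
  have D: "D \<ge> 0" using C tail_const_nonneg M_nonneg by (simp add: D_def)
  have hol: "\<bar>rescaled R x / (x $ k) powr s - rescaled R y / (y $ k) powr s\<bar> \<le> D * R powr (s + a) * dist x y powr abar"
    if R: "R \<ge> 1" and xy: "x \<in> upper_half_ball k (1/2)" "y \<in> upper_half_ball k (1/2)" for R x y
  proof (rule holder_seminormD[OF _ _ xy])
    have L: "Linf_norm (rescaled R) \<le> ennreal (M * 9 * R powr (s + a))"
      unfolding Linf_norm_def
      by (rule esssup_I) (use rescaled_bound[OF R] in \<open>auto intro!: ennreal_leI measurable_completion\<close>)
    have "holder_seminorm abar (upper_half_ball k (1/2)) (\<lambda>x. rescaled R x / (x $ k) powr s)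
        \<le> holder_norm abar (upper_half_ball k (1/2)) (\<lambda>x. rescaled R x / (x $ k) powr s)"
      by (simp add: holder_norm_def)
    also have "\<dots> \<le> ennreal C * (ennreal (tail_const * R powr (s + a)) + Linf_norm (rescaled R))"
    proof (rule est)
      show "continuous_on (ball 0 1) (rescaled R)"
        by (intro continuous_at_imp_continuous_on ballI isCont_rescaled) auto
      show "in_Linf (rescaled R)"
        unfolding in_Linf_def using L by (auto intro!: measurable_completion simp: less_top[symmetric] top_unique)
      show "\<forall>x\<in>lower_half_ball k 1. rescaled R x = 0"
        using R by (auto simp: rescaled_def lower_half_ball_def lower_half_space_def mult_le_0_iff intro!: zero)
    qed (use tail_const_nonneg visc_M_plus_ge_rescaled[OF R] visc_M_minus_le_rescaled[OF R] in auto)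
    also have "\<dots> \<le> ennreal C * (ennreal (tail_const * R powr (s + a)) + ennreal (M * 9 * R powr (s + a)))"
      by (intro mult_left_mono add_left_mono L) auto
    also have "\<dots> = ennreal (D * R powr (s + a))"
    proof -
      have "ennreal (tail_const * R powr (s + a)) + ennreal (M * 9 * R powr (s + a)) = ennreal ((tail_const + M * 9) * R powr (s + a))"
        using tail_const_nonneg M_nonneg by (subst ennreal_plus[symmetric]) (auto simp: distrib_right)
      then show ?thesis
        using C tail_const_nonneg M_nonneg by (simp add: D_def mult.assoc ennreal_mult)
    qed
    finally show "holder_seminorm abar (upper_half_ball k (1/2)) (\<lambda>x. rescaled R x / (x $ k) powr s) \<le> ennreal (D * R powr (s + a))" .
  qed (use D in auto)
  have const: "v x / (x $ k) powr s = v y / (y $ k) powr s" if x: "x $ k > 0" and y: "y $ k > 0" for x y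
  proof -
    define q where "q = (\<lambda>x. v x / (x $ k) powr s)"
    have bound: "\<bar>q x - q y\<bar> \<le> D * dist x y powr abar * R powr (a - abar)" if R: "R \<ge> 1" "R > 2 * norm x" "R > 2 * norm y" for R
    proof -
      have R0: "R > 0" using R by simp
      \<comment> \<open>Dividing by x_k^s at unit scale instead of at scale R produces the factor
        R^s, which cancels the s in R^(s+a).\<close>
      have z: "z /\<^sub>R R \<in> upper_half_ball k (1/2) \<and> rescaled R (z /\<^sub>R R) / ((z /\<^sub>R R) $ k) powr s = R powr s * q z"
        if "z $ k > 0" "R > 2 * norm z" for z
      proof
        have n: "norm (z /\<^sub>R R) < 1 / 2" using that R0 by (simp add: field_simps)
        then show "z /\<^sub>R R \<in> upper_half_ball k (1/2)"
          using that R0 by (simp add: upper_half_ball_def upper_half_space_def)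
        have "(z /\<^sub>R R) $ k = z $ k / R" by (simp add: divide_inverse mult.commute)
        then have "((z /\<^sub>R R) $ k) powr s = (z $ k) powr s / R powr s"
          using that R0 by (simp add: powr_divide)
        moreover have "rescaled R (z /\<^sub>R R) = v z" using n R0 by (simp add: rescaled_def)
        ultimately show "rescaled R (z /\<^sub>R R) / ((z /\<^sub>R R) $ k) powr s = R powr s * q z"
          by (simp add: q_def)
      qed
      have d: "dist (x /\<^sub>R R) (y /\<^sub>R R) = dist x y / R"
        using R0 by (simp add: dist_norm flip: scaleR_diff_right) (simp add: divide_inverse mult.commute)
      have "\<bar>R powr s * q x - R powr s * q y\<bar> \<le> D * R powr (s + a) * (dist x y / R) powr abar"
        using hol[OF R(1), of "x /\<^sub>R R" "y /\<^sub>R R"] z[OF x R(2)] z[OF y R(3)] d by simp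
      also have "\<dots> = R powr s * (D * dist x y powr abar * R powr (a - abar))"
        using R0 by (simp add: powr_divide powr_add powr_diff)
      also have "R powr s * q x - R powr s * q y = R powr s * (q x - q y)" by (simp add: right_diff_distrib)
      finally show ?thesis using R0 by (simp add: abs_mult)
    qed
    have "((\<lambda>R. D * dist x y powr abar * R powr (a - abar)) \<longlongrightarrow> 0) at_top"
      using a_abar by (intro tendsto_mult_right_zero tendsto_neg_powr filterlim_ident) auto
    then have "\<bar>q x - q y\<bar> \<le> 0"
    proof (rule tendsto_lowerbound)
      show "\<forall>\<^sub>F R in at_top. \<bar>q x - q y\<bar> \<le> D * dist x y powr abar * R powr (a - abar)"
        using eventually_ge_at_top[of 1] eventually_gt_at_top[of "2 * norm x"] eventually_gt_at_top[of "2 * norm y"]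
        by eventually_elim (rule bound)
    qed simp
    then show ?thesis by (simp add: q_def)
  qed
  define c where "c = v (axis k 1)"
  show ?thesis
  proof (rule that)
    fix x
    show "v x = c * pos_powr s (x $ k)"
    proof (cases "x $ k > 0")
      case True
      then show ?thesis using const[of x "axis k 1"] by (simp add: c_def pos_powr_pos field_simps)
    next
      case False
      then show ?thesis using zero[of x] by (simp add: pos_powr_neg)
    qed
  qed
qed

end

section \<open>Tangential and normal increments\<close>

text \<open>Cauchy's functional equation under local boundedness: write N t as an integer plus a
  fractional part r. Linearity is exact on the integer, and the bounded error at r is divided by
  N.\<close>

lemma additive_bounded_imp_linear_real:
  fixes f :: "real \<Rightarrow> real"
  assumes add: "\<And>x y. f (x + y) = f x + f y" and B: "\<And>r. 0 \<le> r \<Longrightarrow> r < 1 \<Longrightarrow> \<bar>f r\<bar> \<le> B"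
  shows "f t = t * f 1"
proof -
  have f0: "f 0 = 0" using add[of 0 0] by simp
  have minus: "f (- x) = - f x" for x using add[of x "- x"] f0 by simp
  have nat: "f (real n * x) = real n * f x" for n x
    by (induction n) (auto simp: f0 add distrib_right)
  have int: "f (of_int m) = of_int m * f 1" for m :: int
  proof (cases "m \<ge> 0")
    case True
    then show ?thesis using nat[of "nat m" 1] by simp
  next
    case False
    then show ?thesis using nat[of "nat (- m)" 1] minus[of "of_int (- m)"] by simp
  qed
  have "\<bar>f t - t * f 1\<bar> \<le> (\<bar>f 1\<bar> + B) / real (Suc n)" for n
  proof -
    define N where "N = real (Suc n)"
    define m where "m = \<lfloor>N * t\<rfloor>"
    define r where "r = N * t - of_int m"
    have r: "0 \<le> r" "r < 1" unfolding r_def m_def by linarith+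
    have N: "N > 0" by (simp add: N_def)
    have "N * f t = f (N * t)" using nat[of "Suc n" t] by (simp add: N_def)
    also have "\<dots> = f (of_int m + r)" by (simp add: r_def)
    also have "\<dots> = of_int m * f 1 + f r" by (simp add: add int)
    finally have "N * (f t - t * f 1) = f r - r * f 1" by (simp add: r_def algebra_simps)
    then have "N * \<bar>f t - t * f 1\<bar> = \<bar>f r - r * f 1\<bar>" using N by (metis abs_mult abs_of_pos)
    also have "\<dots> \<le> \<bar>f r\<bar> + r * \<bar>f 1\<bar>" using r by (metis abs_mult abs_of_nonneg abs_triangle_ineq4)
    also have "\<dots> \<le> B + 1 * \<bar>f 1\<bar>" using r by (intro add_mono B mult_right_mono) auto
    finally show ?thesis unfolding N_def[symmetric] using N by (simp add: pos_le_divide_eq mult.commute add.commute)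
  qed
  moreover have "(\<lambda>n. (\<bar>f 1\<bar> + B) / real (Suc n)) \<longlonglongrightarrow> 0"
    using tendsto_mult[OF tendsto_const[of "\<bar>f 1\<bar> + B"] LIMSEQ_inverse_real_of_nat] by (simp add: divide_inverse)
  ultimately have "\<bar>f t - t * f 1\<bar> \<le> 0"
    by (intro LIMSEQ_le_const) auto
  then show ?thesis by simp
qed

text \<open>The model solution t^(s+1) has increments proportional to t^s up to O(h^2), so
  subtracting a multiple of it preserves a hypothesis with error h^(1+\<beta>).\<close>

lemma power_increments:
  fixes s t h :: real
  assumes s: "0 < s" "s < 1" and t: "t > 0" and h: "h > 0"
  shows "\<bar>(t + h) powr (s + 1) / (s + 1) - t powr (s + 1) / (s + 1) - h * t powr s\<bar> \<le> h\<^sup>2 * t powr (s - 1)"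
proof -
  have D: "((\<lambda>z. z powr (s + 1) / (s + 1)) has_real_derivative z powr s) (at z)" if "z > 0" for z
  proof -
    have "((\<lambda>z. z powr (s + 1)) has_real_derivative (s + 1) * z powr (s + 1 - 1)) (at z)"
      using that by (rule has_real_derivative_powr)
    from DERIV_cdivide[OF this, of "s + 1"] show ?thesis using s by simp
  qed
  have "\<exists>\<xi>>t. \<xi> < t + h \<and> (t + h) powr (s + 1) / (s + 1) - t powr (s + 1) / (s + 1) = (t + h - t) * \<xi> powr s"
    by (rule MVT2) (use t h in \<open>auto intro!: D\<close>)
  then obtain \<xi> where \<xi>: "t < \<xi>" "\<xi> < t + h"
    "(t + h) powr (s + 1) / (s + 1) - t powr (s + 1) / (s + 1) = h * \<xi> powr s" by auto
  have "\<exists>\<eta>>t. \<eta> < \<xi> \<and> \<xi> powr s - t powr s = (\<xi> - t) * (s * \<eta> powr (s - 1))"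
    by (rule MVT2) (use t \<xi> in \<open>auto intro!: has_real_derivative_powr\<close>)
  then obtain \<eta> where \<eta>: "t < \<eta>" "\<xi> powr s - t powr s = (\<xi> - t) * (s * \<eta> powr (s - 1))" by auto
  have "\<eta> powr (s - 1) \<le> t powr (s - 1)" using \<eta> t s by (intro powr_mono2') auto
  then have le: "s * \<eta> powr (s - 1) \<le> 1 * t powr (s - 1)" using s by (intro mult_mono) auto
  have "(\<xi> - t) * (s * \<eta> powr (s - 1)) \<le> h * (1 * t powr (s - 1))"
    by (rule mult_mono) (use le \<xi> h s in auto)
  then have "0 \<le> \<xi> powr s - t powr s" "\<xi> powr s - t powr s \<le> h * t powr (s - 1)"
    using \<eta>(2) \<xi> s by auto
  then have "\<bar>\<xi> powr s - t powr s\<bar> \<le> h * t powr (s - 1)" by simp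
  then have "h * \<bar>\<xi> powr s - t powr s\<bar> \<le> h * (h * t powr (s - 1))" using h by (intro mult_left_mono) auto
  moreover have "h * \<xi> powr s - h * t powr s = h * (\<xi> powr s - t powr s)" by (simp add: right_diff_distrib)
  ultimately show ?thesis unfolding \<xi>(3) using h by (simp add: abs_mult power2_eq_square mult.assoc)
qed

text \<open>After subtracting a multiple of \<open>t\<^sup>s\<^sup>+\<^sup>1\<close> we may assume \<open>\<phi> 2 = \<phi> 1\<close>. Summing the
  increments over \<open>[1, 2]\<close> then bounds their coefficient by \<open>h\<^sup>1\<^sup>+\<^sup>\<beta>\<close>, and summing over any
  other interval of rational length shows that \<open>\<phi>\<close> is constant.\<close>

lemma increments_imp_power:
  fixes \<phi> :: "real \<Rightarrow> real"
  assumes s: "0 < s" "s < 1" and \<beta>: "0 < \<beta>" "\<beta> < 1" and cont: "\<And>t. t > 0 \<Longrightarrow> isCont \<phi> t"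
    and inc: "\<And>h. 0 < h \<Longrightarrow> h < 1 \<Longrightarrow> \<exists>c. \<forall>t>0. \<bar>\<phi> (t + h) - \<phi> t - c * t powr s\<bar> \<le> E * h powr (1 + \<beta>) * t powr (s - 1)"
  obtains K d where "\<And>t. t > 0 \<Longrightarrow> \<phi> t = K * t powr (s + 1) + d"
proof -
  define G where "G = (\<lambda>t::real. t powr (s + 1) / (s + 1))"
  have "(1::real) < 2 powr (s + 1)" using s by simp
  then have G12: "G 2 - G 1 \<noteq> 0" using s by (simp add: G_def)
  define K where "K = (\<phi> 2 - \<phi> 1) / (G 2 - G 1)"
  define \<psi> where "\<psi> = (\<lambda>t. \<phi> t - K * G t)"
  have \<psi>12: "\<psi> 2 = \<psi> 1" using G12 by (simp add: \<psi>_def K_def field_simps)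
  define E' where "E' = \<bar>E\<bar> + \<bar>K\<bar>"
  have E': "E' \<ge> 0" by (simp add: E'_def)
  have inc\<psi>: "\<exists>c. \<forall>t>0. \<bar>\<psi> (t + h) - \<psi> t - c * t powr s\<bar> \<le> E' * h powr (1 + \<beta>) * t powr (s - 1)"
    if h: "0 < h" "h < 1" for h
  proof -
    obtain c where c: "\<And>t. t > 0 \<Longrightarrow> \<bar>\<phi> (t + h) - \<phi> t - c * t powr s\<bar> \<le> E * h powr (1 + \<beta>) * t powr (s - 1)"
      using inc[OF h] by blast
    \<comment> \<open>For h < 1 this is where \<beta> < 1 enters.\<close>
    have h2: "h\<^sup>2 \<le> h powr (1 + \<beta>)"
    proof -
      have "h powr 2 \<le> h powr (1 + \<beta>)" using h \<beta> by (intro powr_mono') auto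
      then show ?thesis using h by simp
    qed
    show ?thesis
    proof (intro exI[of _ "c - K * h"] allI impI)
      fix t :: real assume t: "t > 0"
      have "\<bar>K * (G (t + h) - G t - h * t powr s)\<bar> \<le> \<bar>K\<bar> * (h\<^sup>2 * t powr (s - 1))"
        unfolding abs_mult G_def by (intro mult_left_mono power_increments s t h) auto
      also have "\<dots> \<le> \<bar>K\<bar> * (h powr (1 + \<beta>) * t powr (s - 1))"
        using h2 by (intro mult_left_mono mult_right_mono) auto
      finally have 1: "\<bar>K * (G (t + h) - G t - h * t powr s)\<bar> \<le> \<bar>K\<bar> * (h powr (1 + \<beta>) * t powr (s - 1))" .
      have "E * (h powr (1 + \<beta>) * t powr (s - 1)) \<le> \<bar>E\<bar> * (h powr (1 + \<beta>) * t powr (s - 1))"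
        by (intro mult_right_mono) auto
      with c[OF t] have 2: "\<bar>\<phi> (t + h) - \<phi> t - c * t powr s\<bar> \<le> \<bar>E\<bar> * (h powr (1 + \<beta>) * t powr (s - 1))"
        by (simp add: mult.assoc)
      have "\<psi> (t + h) - \<psi> t - (c - K * h) * t powr s
          = (\<phi> (t + h) - \<phi> t - c * t powr s) - K * (G (t + h) - G t - h * t powr s)"
        by (simp add: \<psi>_def algebra_simps)
      then have "\<bar>\<psi> (t + h) - \<psi> t - (c - K * h) * t powr s\<bar>
          \<le> \<bar>E\<bar> * (h powr (1 + \<beta>) * t powr (s - 1)) + \<bar>K\<bar> * (h powr (1 + \<beta>) * t powr (s - 1))"
        using 1 2 abs_triangle_ineq4[of "\<phi> (t + h) - \<phi> t - c * t powr s" "K * (G (t + h) - G t - h * t powr s)"] by linarith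
      also have "\<dots> = E' * h powr (1 + \<beta>) * t powr (s - 1)" by (simp add: E'_def distrib_right mult.assoc)
      finally show "\<bar>\<psi> (t + h) - \<psi> t - (c - K * h) * t powr s\<bar> \<le> E' * h powr (1 + \<beta>) * t powr (s - 1)" .
    qed
  qed
  have step: "\<bar>\<psi> (t + 1 / real N) - \<psi> t\<bar> \<le> E' * (1 / real N) powr (1 + \<beta>) * (t powr s + t powr (s - 1))"
    if N: "N \<ge> 2" and t: "t > 0" for N :: nat and t
  proof -
    define h where "h = 1 / real N"
    have h: "0 < h" "h < 1" "real N * h = 1" using N by (auto simp: h_def)
    obtain c where c: "\<And>t. t > 0 \<Longrightarrow> \<bar>\<psi> (t + h) - \<psi> t - c * t powr s\<bar> \<le> E' * h powr (1 + \<beta>) * t powr (s - 1)"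
      using inc\<psi>[OF h(1,2)] by blast
    \<comment> \<open>On [1, 2] the weights x_j^s are at least 1 and the factors x_j^(s-1) at most
      1. The N increments add up to 0, so N |c| is at most the sum of N errors.\<close>
    have cb: "\<bar>c\<bar> \<le> E' * h powr (1 + \<beta>)"
    proof -
      define x where "x = (\<lambda>j. 1 + real j * h)"
      have x: "x j \<ge> 1" for j using h by (simp add: x_def)
      have "(\<Sum>j<N. \<psi> (x (Suc j)) - \<psi> (x j)) = \<psi> (x N) - \<psi> (x 0)"
        by (rule sum_lessThan_telescope)
      also have "\<dots> = 0" using \<psi>12 h by (simp add: x_def)
      finally have tel: "(\<Sum>j<N. \<psi> (x (Suc j)) - \<psi> (x j)) = 0" .
      have "\<bar>c\<bar> * real N \<le> \<bar>c\<bar> * (\<Sum>j<N. x j powr s)"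
      proof (intro mult_left_mono)
        have "(\<Sum>j<N. (1::real)) \<le> (\<Sum>j<N. x j powr s)"
          using x s by (intro sum_mono ge_one_powr_ge_zero) auto
        then show "real N \<le> (\<Sum>j<N. x j powr s)" by simp
      qed simp
      also have "\<bar>c\<bar> * (\<Sum>j<N. x j powr s) = \<bar>\<Sum>j<N. c * x j powr s\<bar>"
        by (simp add: sum_distrib_left[symmetric] abs_mult sum_nonneg)
      also have "(\<Sum>j<N. c * x j powr s) = - (\<Sum>j<N. \<psi> (x (Suc j)) - \<psi> (x j) - c * x j powr s)"
        using tel by (simp add: sum_subtractf)
      also have "\<bar>- (\<Sum>j<N. \<psi> (x (Suc j)) - \<psi> (x j) - c * x j powr s)\<bar> \<le> (\<Sum>j<N. \<bar>\<psi> (x (Suc j)) - \<psi> (x j) - c * x j powr s\<bar>)"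
        unfolding abs_minus_cancel by (rule sum_abs)
      also have "\<dots> \<le> (\<Sum>j<N. E' * h powr (1 + \<beta>))"
      proof (rule sum_mono)
        fix j
        have xs: "x (Suc j) = x j + h" by (simp add: x_def algebra_simps)
        have "x j powr (s - 1) \<le> 1 powr (s - 1)" using x[of j] s by (intro powr_mono2') auto
        then have "E' * h powr (1 + \<beta>) * x j powr (s - 1) \<le> E' * h powr (1 + \<beta>) * 1"
          using E' by (intro mult_left_mono) auto
        with c[of "x j"] x[of j] show "\<bar>\<psi> (x (Suc j)) - \<psi> (x j) - c * x j powr s\<bar> \<le> E' * h powr (1 + \<beta>)"
          unfolding xs by simp
      qed
      also have "\<dots> = E' * h powr (1 + \<beta>) * real N" by simp
      finally show ?thesis using N by simp
    qed
    have "\<bar>\<psi> (t + h) - \<psi> t\<bar> \<le> \<bar>\<psi> (t + h) - \<psi> t - c * t powr s\<bar> + \<bar>c\<bar> * t powr s"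
      using abs_triangle_ineq[of "\<psi> (t + h) - \<psi> t - c * t powr s" "c * t powr s"] by (simp add: abs_mult)
    also have "\<dots> \<le> E' * h powr (1 + \<beta>) * t powr (s - 1) + E' * h powr (1 + \<beta>) * t powr s"
      using c[OF t] cb by (intro add_mono mult_right_mono) auto
    finally show ?thesis by (simp add: h_def distrib_left add.commute)
  qed
  \<comment> \<open>Steps have length 1 / N with N an integer, which is why only rational distances
    are reached directly. With N = n L, the distance m / n takes m L steps of error N^(-1-\<beta>)
    each, in total a multiple of N^(-\<beta>); L \<rightarrow> \<infinity> removes it.\<close>
  have rat: "\<psi> (a + real m / real n) = \<psi> a" if a: "a > 0" and n: "n > 0" for a and m n :: nat
  proof -
    define B where "B = (a + real m / real n) powr s + a powr (s - 1)"
    have "\<bar>\<psi> (a + real m / real n) - \<psi> a\<bar> \<le> E' * B * (real m / real n) * (1 / real (n * L)) powr \<beta>" if L: "L \<ge> 2" for L :: nat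
    proof -
      define N where "N = n * L"
      have "2 * 1 \<le> L * n" using L n by (intro mult_le_mono) auto
      then have "N \<ge> 2" by (simp add: N_def mult.commute)
      then have N: "N \<ge> 2" "real N > 0" by simp_all
      define x where "x = (\<lambda>j. a + real j / real N)"
      have mL: "real (m * L) / real N = real m / real n" using L n by (simp add: N_def)
      have "\<psi> (a + real m / real n) - \<psi> a = \<psi> (x (m * L)) - \<psi> (x 0)"
        unfolding x_def mL by simp
      also have "\<dots> = (\<Sum>j<m * L. \<psi> (x (Suc j)) - \<psi> (x j))" by (rule sum_lessThan_telescope[symmetric])
      also have "\<bar>\<dots>\<bar> \<le> (\<Sum>j<m * L. \<bar>\<psi> (x (Suc j)) - \<psi> (x j)\<bar>)" by (rule sum_abs)
      also have "\<dots> \<le> (\<Sum>j<m * L. E' * (1 / real N) powr (1 + \<beta>) * B)"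
      proof (rule sum_mono)
        fix j assume "j \<in> {..<m * L}"
        then have "real j \<le> real (m * L)" by (simp only: of_nat_le_iff lessThan_iff less_imp_le)
        then have "real j / real N \<le> real (m * L) / real N" by (rule divide_right_mono) simp
        then have xj: "a \<le> x j" "x j \<le> a + real m / real n" unfolding mL x_def by auto
        have xs: "x (Suc j) = x j + 1 / real N" by (simp add: x_def add_divide_distrib)
        have "x j powr s + x j powr (s - 1) \<le> B"
          unfolding B_def using xj a s by (intro add_mono powr_mono2 powr_mono2') auto
        then have "E' * (1 / real N) powr (1 + \<beta>) * (x j powr s + x j powr (s - 1)) \<le> E' * (1 / real N) powr (1 + \<beta>) * B"
          using E' by (intro mult_left_mono) auto
        then show "\<bar>\<psi> (x (Suc j)) - \<psi> (x j)\<bar> \<le> E' * (1 / real N) powr (1 + \<beta>) * B"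
          unfolding xs using step[OF N(1), of "x j"] xj a by linarith
      qed
      also have "\<dots> = E' * B * (real (m * L) * (1 / real N)) * (1 / real N) powr \<beta>"
        using N by (simp add: powr_add)
      also have "real (m * L) * (1 / real N) = real m / real n" using mL by simp
      finally show ?thesis by (simp add: N_def)
    qed
    then have "\<forall>L\<ge>2. \<bar>\<psi> (a + real m / real n) - \<psi> a\<bar> \<le> E' * B * (real m / real n) * (1 / real (n * L)) powr \<beta>" by blast
    moreover have "(\<lambda>L. E' * B * (real m / real n) * (1 / real (n * L)) powr \<beta>) \<longlonglongrightarrow> 0"
    proof (rule tendsto_mult_right_zero)
      have "(\<lambda>L. 1 / real n * (1 / real L)) \<longlonglongrightarrow> 0"
        by (rule tendsto_mult_right_zero) (rule lim_1_over_n)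
      then have "(\<lambda>L. 1 / real (n * L)) \<longlonglongrightarrow> 0" by simp
      then show "(\<lambda>L. (1 / real (n * L)) powr \<beta>) \<longlonglongrightarrow> 0"
        using \<beta> by (intro tendsto_zero_powrI[where b = \<beta>]) auto
    qed
    ultimately have "\<bar>\<psi> (a + real m / real n) - \<psi> a\<bar> \<le> 0" by (intro LIMSEQ_le_const) auto
    then show ?thesis by simp
  qed
  have const: "\<psi> b = \<psi> a" if ab: "0 < a" "a < b" for a b
  proof -
    define r where "r = (\<lambda>i. real (nat \<lfloor>real (Suc i) * (b - a)\<rfloor>) / real (Suc i))"
    have "r \<longlonglongrightarrow> b - a"
    proof (rule LIMSEQ_I)
      have bd: "\<bar>r i - (b - a)\<bar> \<le> inverse (real (Suc i))" for i
      proof -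
        have "0 \<le> real (Suc i) * (b - a)" using ab by simp
        then have e: "real (nat \<lfloor>real (Suc i) * (b - a)\<rfloor>) = of_int \<lfloor>real (Suc i) * (b - a)\<rfloor>" by simp
        have "\<bar>of_int \<lfloor>real (Suc i) * (b - a)\<rfloor> - real (Suc i) * (b - a)\<bar> \<le> 1" by linarith
        then have "\<bar>of_int \<lfloor>real (Suc i) * (b - a)\<rfloor> - real (Suc i) * (b - a)\<bar> / real (Suc i) \<le> 1 / real (Suc i)"
          by (intro divide_right_mono) auto
        moreover have "r i - (b - a) = (of_int \<lfloor>real (Suc i) * (b - a)\<rfloor> - real (Suc i) * (b - a)) / real (Suc i)"
          unfolding r_def e by (simp add: diff_divide_distrib del: of_nat_Suc)
        ultimately show ?thesis by (simp add: inverse_eq_divide del: of_nat_Suc)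
      qed
      fix \<epsilon> :: real assume "\<epsilon> > 0"
      then obtain i0 where i0: "inverse (real (Suc i0)) < \<epsilon>" using reals_Archimedean by blast
      show "\<exists>n0. \<forall>n\<ge>n0. norm (r n - (b - a)) < \<epsilon>"
      proof (intro exI allI impI)
        fix n assume "i0 \<le> n"
        then have "inverse (real (Suc n)) \<le> inverse (real (Suc i0))" by (intro le_imp_inverse_le) auto
        with bd[of n] i0 show "norm (r n - (b - a)) < \<epsilon>" unfolding real_norm_def by linarith
      qed
    qed
    then have "(\<lambda>i. a + r i) \<longlonglongrightarrow> a + (b - a)" by (intro tendsto_intros)
    then have lim: "(\<lambda>i. a + r i) \<longlonglongrightarrow> b" by simp
    have "isCont G b"
      unfolding G_def using ab s by (intro continuous_intros) auto
    then have "isCont \<psi> b" unfolding \<psi>_def using cont[of b] ab by (intro continuous_intros) auto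
    from isCont_tendsto_compose[OF this lim] have "(\<lambda>i. \<psi> (a + r i)) \<longlonglongrightarrow> \<psi> b" .
    moreover have "\<psi> (a + r i) = \<psi> a" for i unfolding r_def using ab by (intro rat) auto
    ultimately have "(\<lambda>i. \<psi> a) \<longlonglongrightarrow> \<psi> b" by simp
    then show ?thesis by (simp add: LIMSEQ_const_iff)
  qed
  show ?thesis
  proof (rule that)
    fix t :: real assume t: "t > 0"
    consider "t < 1" | "t = 1" | "1 < t" by linarith
    then have "\<psi> t = \<psi> 1"
    proof cases
      case 1
      from const[OF t 1] show ?thesis by (rule sym)
    next
      case 3
      show ?thesis by (rule const[OF zero_less_one 3])
    qed simp
    then show "\<phi> t = (K / (s + 1)) * t powr (s + 1) + \<psi> 1" by (simp add: \<psi>_def G_def)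
  qed
qed

section \<open>Tangential increments and the linear part of the solution\<close>

locale liouville_setting =
  fixes k :: "'n::finite" and u :: "real ^ 'n \<Rightarrow> real" and s s0 lam Lam abar \<alpha> \<beta> C :: real
  assumes lam: "0 < lam" and s0: "s0 \<in> {0<..<1}" and ss: "s \<in> {s0..<1}"
    and be: "boundary_exponent k s0 lam Lam abar"
    and cont: "continuous_on UNIV u"
    and plus: "\<And>h. h $ k \<ge> 0 \<Longrightarrow>
      visc_M_plus_ge s lam Lam (upper_half_space k) (\<lambda>x. u (x + h) - u x) (\<lambda>x. 0)"
    and minus: "\<And>h. h $ k \<ge> 0 \<Longrightarrow>
      visc_M_minus_le s lam Lam (upper_half_space k) (\<lambda>x. u (x + h) - u x) (\<lambda>x. 0)"
    and zero: "\<And>x. x \<in> lower_half_space k \<Longrightarrow> u x = 0"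
    and \<beta>: "\<beta> \<in> {0<..<1}" and \<alpha>: "\<alpha> \<in> {0<..<abar}" and C: "C \<ge> 0"
    and holder: "\<And>R. R \<ge> 1 \<Longrightarrow>
      holder_seminorm \<beta> (upper_half_ball k R) (\<lambda>x. u x / (max (x $ k) 0) powr s) \<le> ennreal (C * R powr \<alpha>)"
begin

definition "e = (axis k 1 :: real ^ 'n)"

definition "q = (\<lambda>x. u x / pos_powr s (x $ k))"

lemma s: "0 < s" "s < 1" and \<alpha>s: "0 < \<alpha>" "\<alpha> < s" "\<alpha> < 1"
  using s0 ss \<alpha> be by (auto simp: boundary_exponent_def)

lemma e_k[simp]: "e $ k = 1" and norm_e[simp]: "norm e = 1"
  by (simp_all add: e_def)

lemma u_nonpos:
  assumes "x $ k \<le> 0"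
  shows "u x = 0"
proof -
  have "(\<lambda>i. x - inverse (real (Suc i)) *\<^sub>R e) \<longlonglongrightarrow> x - 0 *\<^sub>R e"
    by (intro tendsto_intros LIMSEQ_inverse_real_of_nat)
  then have lim: "(\<lambda>i. x - inverse (real (Suc i)) *\<^sub>R e) \<longlonglongrightarrow> x" by simp
  have "isCont u x" using cont by (simp add: continuous_on_eq_continuous_at)
  from isCont_tendsto_compose[OF this lim]
  have "(\<lambda>i. u (x - inverse (real (Suc i)) *\<^sub>R e)) \<longlonglongrightarrow> u x" .
  moreover have "u (x - inverse (real (Suc i)) *\<^sub>R e) = 0" for i
  proof (rule zero)
    have "0 < inverse (real (Suc i))" by simp
    from order.strict_trans1[OF assms this]
    show "x - inverse (real (Suc i)) *\<^sub>R e \<in> lower_half_space k"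
      by (simp add: lower_half_space_def del: of_nat_Suc)
  qed
  ultimately have "(\<lambda>i. 0 :: real) \<longlonglongrightarrow> u x" by simp
  then show ?thesis by (simp add: LIMSEQ_const_iff)
qed

lemma u_q: "x $ k > 0 \<Longrightarrow> u x = pos_powr s (x $ k) * q x"
  by (simp add: q_def pos_powr_pos)

lemma q_holder:
  assumes "R \<ge> 1" "x $ k > 0" "norm x < R" "y $ k > 0" "norm y < R"
  shows "\<bar>q x - q y\<bar> \<le> C * R powr \<alpha> * dist x y powr \<beta>"
proof -
  have "\<bar>u x / (max (x $ k) 0) powr s - u y / (max (y $ k) 0) powr s\<bar> \<le> C * R powr \<alpha> * dist x y powr \<beta>"
    by (rule holder_seminormD[OF holder[OF assms(1)]])
       (use assms C in \<open>auto simp: upper_half_ball_def upper_half_space_def\<close>)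
  then show ?thesis by (simp add: q_def pos_powr_def)
qed

text \<open>Since h_k = 0 both points carry the same factor x_k^s, so the increment is x_k^s (q (x +
  h) - q x). The radius (1 + |h|)(1 + |x|) contains both points, and the Hoelder bound gives growth
  of order s + \<alpha>.\<close>

lemma tangential_increment:
  assumes h: "h $ k = 0"
  obtains c where "\<And>x. u (x + h) - u x = c * pos_powr s (x $ k)"
proof -
  interpret half_space_solution k s lam Lam \<alpha> "C * (1 + norm h) powr \<alpha> * norm h powr \<beta>" "\<lambda>x. u (x + h) - u x"
  proof
    show "continuous_on UNIV (\<lambda>x. u (x + h) - u x)"
      by (intro continuous_intros continuous_on_compose2[OF cont]) auto
    show "u (x + h) - u x = 0" if "x $ k \<le> 0" for x
      using that h by (simp add: u_nonpos)
    show "\<bar>u (x + h) - u x\<bar> \<le> C * (1 + norm h) powr \<alpha> * norm h powr \<beta> * (1 + norm x) powr (s + \<alpha>)" for x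
    proof (cases "x $ k > 0")
      case False
      then show ?thesis using h C by (simp add: u_nonpos)
    next
      case True
      define R where "R = (1 + norm h) * (1 + norm x)"
      have R: "R \<ge> 1" "norm x < R" "norm (x + h) < R"
      proof -
        have "1 + norm x + norm h \<le> R" by (simp add: R_def algebra_simps)
        then show "R \<ge> 1" "norm x < R" "norm (x + h) < R"
          using norm_triangle_ineq[of x h] norm_ge_zero[of x] norm_ge_zero[of h] by linarith+
      qed
      have "u (x + h) - u x = pos_powr s (x $ k) * (q (x + h) - q x)"
        using True h by (simp add: u_q right_diff_distrib)
      then have "\<bar>u (x + h) - u x\<bar> = pos_powr s (x $ k) * \<bar>q (x + h) - q x\<bar>"
        by (simp add: abs_mult pos_powr_nonneg)
      also have "\<dots> \<le> (1 + norm x) powr s * (C * R powr \<alpha> * norm h powr \<beta>)"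
      proof (rule mult_mono)
        show "pos_powr s (x $ k) \<le> (1 + norm x) powr s"
          using True s component_le_norm_cart[of x k] by (simp add: pos_powr_pos powr_mono2)
        show "\<bar>q (x + h) - q x\<bar> \<le> C * R powr \<alpha> * norm h powr \<beta>"
          using q_holder[OF R(1), of "x + h" x] True h R by (simp add: dist_norm)
      qed auto
      also have "\<dots> = C * (1 + norm h) powr \<alpha> * norm h powr \<beta> * (1 + norm x) powr (s + \<alpha>)"
        unfolding R_def by (simp add: powr_mult powr_add)
      finally show ?thesis .
    qed
    show "visc_M_plus_ge s lam Lam (upper_half_space k) (\<lambda>x. u (x + h) - u x) (\<lambda>x. 0)"
      "visc_M_minus_le s lam Lam (upper_half_space k) (\<lambda>x. u (x + h) - u x) (\<lambda>x. 0)"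
      using h by (auto intro: plus minus)
  qed (use lam s \<alpha>s in auto)
  show ?thesis
    using half_space_liouville[OF ss be] \<alpha> that by auto
qed

text \<open>Projecting out the normal component first defines the slope in every direction, as a
  linear functional on the whole space that vanishes on \<open>e\<close>.\<close>

definition "tang z = z - (z $ k) *\<^sub>R e"

definition "slope z = u (e + tang z) - u e"

lemma tang_k[simp]: "tang z $ k = 0" and tang_add: "tang (z + w) = tang z + tang w"
  and tang_scale: "tang (c *\<^sub>R z) = c *\<^sub>R tang z"
  by (simp_all add: tang_def algebra_simps)

lemma tangential_slope: "u (x + tang z) - u x = slope z * pos_powr s (x $ k)"
proof -
  obtain c where c: "\<And>x. u (x + tang z) - u x = c * pos_powr s (x $ k)"
    by (rule tangential_increment[of "tang z"]) auto
  from c[of e] have "slope z = c" by (simp add: slope_def pos_powr_pos)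
  with c show ?thesis by simp
qed

text \<open>The increment along a sum is taken in two stages; the second starts at e + tang z, where
  the normal coordinate is still 1, so the coefficient can be read off there.\<close>

lemma slope_add: "slope (z + w) = slope z + slope w"
  using tangential_slope[of e z] tangential_slope[of "e + tang z" w]
  by (simp add: slope_def tang_add pos_powr_pos add.assoc)

lemma slope_scale: "slope (t *\<^sub>R z) = t * slope z"
proof -
  define n where "n = norm (tang z)"
  have "slope (t *\<^sub>R z) = t * slope (1 *\<^sub>R z)"
  proof (rule additive_bounded_imp_linear_real)
    show "slope ((x + y) *\<^sub>R z) = slope (x *\<^sub>R z) + slope (y *\<^sub>R z)" for x y
      by (simp add: scaleR_add_left slope_add)
    \<comment> \<open>At height 1 the slope is an increment of q, so the Hoelder bound makes it
      locally bounded. The radius 3 + n leaves room for points of norm at most 1 + n.\<close>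
    show "\<bar>slope (r *\<^sub>R z)\<bar> \<le> C * (3 + n) powr \<alpha> * n powr \<beta>" if r: "0 \<le> r" "r < 1" for r
    proof -
      have nr: "norm (r *\<^sub>R tang z) \<le> n" using r by (simp add: n_def mult_left_le_one_le)
      have "norm (e + r *\<^sub>R tang z) < 3 + n"
        using norm_triangle_ineq[of e "r *\<^sub>R tang z"] nr by simp
      then have "\<bar>q (e + r *\<^sub>R tang z) - q e\<bar> \<le> C * (3 + n) powr \<alpha> * dist (e + r *\<^sub>R tang z) e powr \<beta>"
        by (intro q_holder) (auto simp: n_def add_pos_nonneg intro: order.strict_trans2[of _ 3])
      also have "\<dots> \<le> C * (3 + n) powr \<alpha> * n powr \<beta>"
        using nr C \<beta> by (intro mult_left_mono powr_mono2) (auto simp: dist_norm)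
      also have "q (e + r *\<^sub>R tang z) - q e = slope (r *\<^sub>R z)"
        by (simp add: slope_def tang_scale u_q pos_powr_pos)
      finally show ?thesis .
    qed
  qed
  then show ?thesis by simp
qed

lemma slope_inner: obtains p where "p $ k = 0" "\<And>z. slope z = p \<bullet> z"
proof -
  have lin: "linear slope" by (intro linearI slope_add) (simp add: slope_scale)
  define p where "p = adjoint slope 1"
  have p: "slope z = p \<bullet> z" for z
    using adjoint_works[OF lin, of z 1] by (simp add: p_def inner_commute)
  have "p $ k = slope e" unfolding p by (simp add: e_def inner_axis)
  also have "\<dots> = 0" by (simp add: slope_def tang_def)
  finally show ?thesis using p that by blast
qed

definition "q0 t = q (t *\<^sub>R e)"

lemma q0_holder:
  assumes "R \<ge> 1" "0 < t" "t < R" "0 < t'" "t' < R"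
  shows "\<bar>q0 t - q0 t'\<bar> \<le> C * R powr \<alpha> * \<bar>t - t'\<bar> powr \<beta>"
proof -
  have "dist (t *\<^sub>R e) (t' *\<^sub>R e) = \<bar>t - t'\<bar>"
    by (simp add: dist_norm flip: scaleR_diff_left)
  then show ?thesis
    unfolding q0_def using q_holder[OF assms(1), of "t *\<^sub>R e" "t' *\<^sub>R e"] assms by simp
qed

lemma q0_limit: obtains b where "\<And>t R. R \<ge> 1 \<Longrightarrow> 0 < t \<Longrightarrow> t < R \<Longrightarrow> \<bar>q0 t - b\<bar> \<le> C * R powr \<alpha> * t powr \<beta>"
proof -
  \<comment> \<open>Starting at 1/2 keeps all points strictly inside the unit ball. The boundary
    value b is a cluster value of q0 along this sequence, and the Hoelder bound then passes to the
    limit.\<close>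
  define X where "X = (\<lambda>i. inverse (real (Suc (Suc i))))"
  have X: "0 < X i" "X i < 1" for i
    unfolding X_def by (simp_all add: inverse_less_1_iff del: of_nat_Suc)
  have X0: "X \<longlonglongrightarrow> 0" unfolding X_def by (rule LIMSEQ_Suc[OF LIMSEQ_inverse_real_of_nat])
  have "bounded (range (\<lambda>i. q0 (X i)))"
  proof (rule boundedI)
    fix z assume "z \<in> range (\<lambda>i. q0 (X i))"
    then obtain i where z: "z = q0 (X i)" by auto
    have "\<bar>q0 (X i) - q0 (X 0)\<bar> \<le> C * 1 powr \<alpha> * \<bar>X i - X 0\<bar> powr \<beta>"
      using X by (intro q0_holder) auto
    also have "\<dots> \<le> C * 1 powr \<alpha> * 1 powr \<beta>"
      using X[of i] X[of 0] C \<beta> by (intro mult_left_mono powr_mono2) auto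
    finally show "norm z \<le> \<bar>q0 (X 0)\<bar> + C" unfolding z by simp
  qed
  from bounded_imp_convergent_subsequence[OF this]
  obtain b r where br: "strict_mono (r :: nat \<Rightarrow> nat)" "((\<lambda>i. q0 (X i)) \<circ> r) \<longlonglongrightarrow> b" by blast
  have Xr: "(\<lambda>i. X (r i)) \<longlonglongrightarrow> 0" using LIMSEQ_subseq_LIMSEQ[OF X0 br(1)] by (simp add: o_def)
  show ?thesis
  proof (rule that)
    fix t R :: real assume R: "R \<ge> 1" "0 < t" "t < R"
    have l1: "(\<lambda>i. \<bar>q0 t - q0 (X (r i))\<bar>) \<longlonglongrightarrow> \<bar>q0 t - b\<bar>"
      using br(2) by (intro tendsto_intros) (simp add: o_def)
    have l2: "(\<lambda>i. C * R powr \<alpha> * \<bar>t - X (r i)\<bar> powr \<beta>) \<longlonglongrightarrow> C * R powr \<alpha> * \<bar>t - 0\<bar> powr \<beta>"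
      using R by (intro tendsto_intros Xr) auto
    have "\<bar>q0 t - b\<bar> \<le> C * R powr \<alpha> * \<bar>t - 0\<bar> powr \<beta>"
    proof (rule LIMSEQ_le[OF l1 l2])
      have "\<bar>q0 t - q0 (X (r i))\<bar> \<le> C * R powr \<alpha> * \<bar>t - X (r i)\<bar> powr \<beta>" for i
        using R X[of "r i"] by (intro q0_holder) auto
      then show "\<exists>N. \<forall>n\<ge>N. \<bar>q0 t - q0 (X (r n))\<bar> \<le> C * R powr \<alpha> * \<bar>t - X (r n)\<bar> powr \<beta>" by blast
    qed
    then show "\<bar>q0 t - b\<bar> \<le> C * R powr \<alpha> * t powr \<beta>" using R by simp
  qed
qed

end

section \<open>The normal profile and its increments\<close>

locale liouville_reduced = liouville_setting k u s s0 lam Lam abar \<alpha> \<beta> C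
  for k :: "'n::finite" and u s s0 lam Lam abar \<alpha> \<beta> C +
  fixes p :: "real ^ 'n" and b :: real
  assumes p_k: "p $ k = 0" and slope: "\<And>z. slope z = p \<bullet> z"
    and b: "\<And>t R. R \<ge> 1 \<Longrightarrow> 0 < t \<Longrightarrow> t < R \<Longrightarrow> \<bar>q0 t - b\<bar> \<le> C * R powr \<alpha> * t powr \<beta>"
begin

text \<open>Subtracting the leading boundary term gains the exponent \<beta> at 0: for t > 0 this is
  t^s (q0 t - b).\<close>

definition "\<phi> t = u (t *\<^sub>R e) - b * pos_powr s t"

lemma p_e: "p \<bullet> e = 0"
  using p_k by (simp add: e_def inner_axis)

lemma u_decomposition: "u x = (p \<bullet> x + b) * pos_powr s (x $ k) + \<phi> (x $ k)"
proof -
  have "x = (x $ k) *\<^sub>R e + tang x" by (simp add: tang_def)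
  then have "u x - u ((x $ k) *\<^sub>R e) = slope x * pos_powr s (x $ k)"
    using tangential_slope[of "(x $ k) *\<^sub>R e" x] by simp
  then show ?thesis by (simp add: \<phi>_def slope algebra_simps)
qed

lemma \<phi>_nonpos: "t \<le> 0 \<Longrightarrow> \<phi> t = 0"
  by (simp add: \<phi>_def u_nonpos pos_powr_neg)

lemma continuous_\<phi>: "continuous_on UNIV \<phi>"
  unfolding \<phi>_def
  by (intro continuous_intros continuous_on_compose2[OF cont] continuous_on_compose2[OF continuous_pos_powr[OF s(1)]]) auto

lemma \<phi>_pos: "t > 0 \<Longrightarrow> \<phi> t = t powr s * (q0 t - b)"
  using u_q[of "t *\<^sub>R e"] by (simp add: \<phi>_def q0_def pos_powr_pos algebra_simps)

lemma \<phi>_small: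
  assumes "0 < t" "t < 1"
  shows "\<bar>\<phi> t\<bar> \<le> C * t powr (s + \<beta>)"
proof -
  have "\<bar>\<phi> t\<bar> = t powr s * \<bar>q0 t - b\<bar>" using assms by (simp add: \<phi>_pos abs_mult)
  also have "\<dots> \<le> t powr s * (C * 1 powr \<alpha> * t powr \<beta>)" using assms b[of 1 t] by (intro mult_left_mono) auto
  finally show ?thesis by (simp add: powr_add mult_ac)
qed

text \<open>Increment of a product. The increment of q0 over h < 1 is O(t^\<alpha>). The factor q0 t
  - b may grow like t^(\<alpha>+\<beta>), but for t \<ge> 1 it is multiplied by an increment of t^s
  of order t^(s-1), and \<beta> < 1 brings the product back to t^(s+\<alpha>).\<close>

lemma \<phi>_increment_growth:
  assumes h: "0 < h" "h < 1" and t: "t > 0"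
  shows "\<bar>\<phi> (t + h) - \<phi> t\<bar> \<le> 3 * C * (1 + t) powr (s + \<alpha>)"
proof -
  have 1: "\<bar>(t + h) powr s * (q0 (t + h) - q0 t)\<bar> \<le> (1 + t) powr s * (2 * (C * (1 + t) powr \<alpha>))"
    unfolding abs_mult
  proof (rule mult_mono)
    show "\<bar>(t + h) powr s\<bar> \<le> (1 + t) powr s" using h t s by (simp add: powr_mono2)
    have "\<bar>q0 (t + h) - q0 t\<bar> \<le> C * (2 * (1 + t)) powr \<alpha> * \<bar>t + h - t\<bar> powr \<beta>"
      using h t by (intro q0_holder) auto
    also have "\<dots> \<le> C * (2 * (1 + t) powr \<alpha>) * 1"
    proof (intro mult_mono)
      have "(2::real) powr \<alpha> \<le> 2" using \<alpha>s powr_mono[of \<alpha> 1 2] by simp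
      then show "(2 * (1 + t)) powr \<alpha> \<le> 2 * (1 + t) powr \<alpha>"
        unfolding powr_mult by (rule mult_right_mono) simp
      have "h powr \<beta> \<le> 1 powr \<beta>" using h \<beta> by (intro powr_mono2) auto
      then show "\<bar>t + h - t\<bar> powr \<beta> \<le> 1" using h by simp
    qed (use C in auto)
    finally show "\<bar>q0 (t + h) - q0 t\<bar> \<le> 2 * (C * (1 + t) powr \<alpha>)" by simp
  qed auto
  have 2: "\<bar>(q0 t - b) * ((t + h) powr s - t powr s)\<bar> \<le> C * (1 + t) powr \<alpha> * (1 + t) powr s"
  proof -
    have d: "0 \<le> (t + h) powr s - t powr s" using h t s by (simp add: powr_mono2)
    have "t powr \<beta> * ((t + h) powr s - t powr s) \<le> (1 + t) powr s"
    proof (cases "t \<ge> 1")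
      case True
      have "pos_powr_diff s h t \<le> h * t powr (s - 1)" by (rule pos_powr_diff_bounds(2)[OF s h(1) t])
      also have "\<dots> \<le> 1 * t powr (s - 1)" using h by (intro mult_right_mono) auto
      finally have "(t + h) powr s - t powr s \<le> t powr (s - 1)"
        using h t by (simp add: pos_powr_diff_def pos_powr_pos)
      then have "t powr \<beta> * ((t + h) powr s - t powr s) \<le> t powr 1 * t powr (s - 1)"
        using True \<beta> d by (intro mult_mono powr_mono) auto
      also have "\<dots> = t powr s" using t by (simp add: powr_diff)
      also have "\<dots> \<le> (1 + t) powr s" using t s by (intro powr_mono2) auto
      finally show ?thesis .
    next
      case False
      have "t powr \<beta> \<le> 1 powr \<beta>" using False t \<beta> by (intro powr_mono2) auto
      then have "t powr \<beta> * ((t + h) powr s - t powr s) \<le> 1 * (t + h) powr s"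
        using d by (intro mult_mono) auto
      also have "1 * (t + h) powr s \<le> (1 + t) powr s" using h t s by (simp add: powr_mono2)
      finally show ?thesis .
    qed
    then have "C * (1 + t) powr \<alpha> * (t powr \<beta> * ((t + h) powr s - t powr s)) \<le> C * (1 + t) powr \<alpha> * (1 + t) powr s"
      using C by (intro mult_left_mono) auto
    moreover have "\<bar>q0 t - b\<bar> * ((t + h) powr s - t powr s) \<le> (C * (1 + t) powr \<alpha> * t powr \<beta>) * ((t + h) powr s - t powr s)"
      using b[of "1 + t" t] t d by (intro mult_right_mono) auto
    ultimately show ?thesis using d by (simp add: abs_mult mult.assoc)
  qed
  have "\<phi> (t + h) - \<phi> t = (t + h) powr s * (q0 (t + h) - q0 t) + (q0 t - b) * ((t + h) powr s - t powr s)"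
    using h t by (simp add: \<phi>_pos algebra_simps)
  then have "\<bar>\<phi> (t + h) - \<phi> t\<bar> \<le> (1 + t) powr s * (2 * (C * (1 + t) powr \<alpha>)) + C * (1 + t) powr \<alpha> * (1 + t) powr s"
    using 1 2 by linarith
  also have "\<dots> = 3 * C * (1 + t) powr (s + \<alpha>)" by (simp add: powr_add)
  finally show ?thesis .
qed

definition "poisson_\<phi> h = poisson_int s h (\<lambda>y. \<phi> (h - y))"

text \<open>For t \<le> 0 the increment of \<phi> is \<phi> (t + h), and \<open>extension\<close>
  keeps these values. Their difference, the correction, thus vanishes outside the half-line, as the
  half-space theorem demands.\<close>

definition "correction h t = (if t \<le> 0 then 0 else \<phi> (t + h) - \<phi> t - poisson_\<phi> h t)"

definition "extension h t = (if t \<le> 0 then \<phi> (t + h) else poisson_\<phi> h t)"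

lemma extension_correction: "h > 0 \<Longrightarrow> extension h t = \<phi> (t + h) - \<phi> t - correction h t"
  by (simp add: extension_def correction_def \<phi>_nonpos)

lemma poisson_assms:
  assumes "0 < h" "h < 1"
  shows "(\<lambda>y. \<phi> (h - y)) \<in> borel_measurable borel"
    "\<And>y. 0 < y \<Longrightarrow> y < h \<Longrightarrow> \<bar>\<phi> (h - y)\<bar> \<le> C * h powr (s + \<beta>)"
proof -
  have [measurable]: "\<phi> \<in> borel_measurable borel" using continuous_\<phi> by (rule borel_measurable_continuous_onI)
  show "(\<lambda>y. \<phi> (h - y)) \<in> borel_measurable borel" by measurable
  show "\<bar>\<phi> (h - y)\<bar> \<le> C * h powr (s + \<beta>)" if "0 < y" "y < h" for y
  proof -
    have "\<bar>\<phi> (h - y)\<bar> \<le> C * (h - y) powr (s + \<beta>)" using that assms by (intro \<phi>_small) auto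
    also have "\<dots> \<le> C * h powr (s + \<beta>)" using that C s \<beta> by (intro mult_left_mono powr_mono2) auto
    finally show ?thesis .
  qed
qed

lemma c2_pos_poisson_\<phi>: "0 < h \<Longrightarrow> h < 1 \<Longrightarrow> c2_pos (poisson_\<phi> h)"
  unfolding poisson_\<phi>_def by (rule c2_pos_poisson_int[OF s _ poisson_assms]) auto

text \<open>Only t = 0 is delicate: the Poisson integral attains its datum there, so the limit from
  the right is \<phi> h - \<phi> 0 - \<phi> h = 0.\<close>

lemma isCont_correction:
  assumes h: "0 < h" "h < 1"
  shows "isCont (correction h) t"
proof -
  have c\<phi>: "isCont \<phi> z" for z using continuous_\<phi> by (simp add: continuous_on_eq_continuous_at)
  have c\<phi>h: "isCont (\<lambda>t. \<phi> (t + h)) z" for z by (intro isCont_o2[OF _ c\<phi>] continuous_intros)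
  consider "t < 0" | "t = 0" | "t > 0" by linarith
  then show ?thesis
  proof cases
    case 1
    have "\<forall>\<^sub>F z in nhds t. z \<in> {..<0}" using 1 by (intro eventually_nhds_in_open) auto
    then have "\<forall>\<^sub>F z in nhds t. correction h z = 0" by eventually_elim (simp add: correction_def)
    from isCont_cong[OF this] show ?thesis by simp
  next
    case 2
    have c0: "correction h 0 = 0" by (simp add: correction_def)
    have "(poisson_\<phi> h \<longlongrightarrow> \<phi> (h - 0)) (at_right 0)"
      unfolding poisson_\<phi>_def
    proof (rule poisson_int_limit[OF s h(1) poisson_assms[OF h]])
      have "isCont (\<lambda>y. \<phi> (h - y)) 0" by (intro isCont_o2[OF _ c\<phi>] continuous_intros)
      then show "((\<lambda>y. \<phi> (h - y)) \<longlongrightarrow> \<phi> (h - 0)) (at_right 0)"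
        unfolding isCont_def by (simp add: filterlim_at_split)
    qed
    moreover have "((\<lambda>t. \<phi> (t + h)) \<longlongrightarrow> \<phi> (0 + h)) (at_right 0)" "(\<phi> \<longlongrightarrow> \<phi> 0) (at_right 0)"
      using c\<phi>h[of 0] c\<phi>[of 0] unfolding isCont_def by (simp_all add: filterlim_at_split)
    ultimately have "((\<lambda>t. \<phi> (t + h) - \<phi> t - poisson_\<phi> h t) \<longlongrightarrow> \<phi> (0 + h) - \<phi> 0 - \<phi> (h - 0)) (at_right 0)"
      by (intro tendsto_intros)
    then have l: "((\<lambda>t. \<phi> (t + h) - \<phi> t - poisson_\<phi> h t) \<longlongrightarrow> 0) (at_right 0)" by (simp add: \<phi>_nonpos)
    have "\<forall>\<^sub>F t in at_right 0. \<phi> (t + h) - \<phi> t - poisson_\<phi> h t = correction h t"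
      by (intro eventually_at_rightI[of 0 1]) (auto simp: correction_def)
    from Lim_transform_eventually[OF l this] have "(correction h \<longlongrightarrow> 0) (at_right 0)" .
    moreover have "\<forall>\<^sub>F t in at_left 0. 0 = correction h t"
      by (intro eventually_at_leftI[of "-1"]) (auto simp: correction_def)
    from Lim_transform_eventually[OF tendsto_const this] have "(correction h \<longlongrightarrow> 0) (at_left 0)" .
    ultimately show ?thesis unfolding 2 isCont_def c0 by (simp add: filterlim_at_split)
  next
    case 3
    have "isCont (poisson_\<phi> h) t"
      using c2_pos_poisson_\<phi>[OF h] 3 unfolding c2_pos_def by (blast intro: DERIV_isCont)
    then have c: "isCont (\<lambda>t. \<phi> (t + h) - \<phi> t - poisson_\<phi> h t) t"
      by (intro continuous_intros c\<phi> c\<phi>h)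
    have "\<forall>\<^sub>F z in nhds t. z \<in> {0<..}" using 3 by (intro eventually_nhds_in_open) auto
    then have "\<forall>\<^sub>F z in nhds t. correction h z = \<phi> (z + h) - \<phi> z - poisson_\<phi> h z"
      by eventually_elim (simp add: correction_def)
    from isCont_cong[OF this] c show ?thesis by simp
  qed
qed

definition "poisson_bound = C / (poisson_const s * (1 - s))"

text \<open>The datum is bounded by C h^(s+\<beta>) and the weight integrates to a multiple of
  h^(1-s). That the resulting exponent exceeds 1 is what the summation argument uses.\<close>

lemma poisson_\<phi>_bound:
  assumes h: "0 < h" "h < 1" and t: "t > 0"
  shows "\<bar>poisson_\<phi> h t\<bar> \<le> poisson_bound * h powr (1 + \<beta>) * t powr (s - 1)"
proof -
  have "\<bar>poisson_\<phi> h t\<bar> \<le> C * h powr (s + \<beta>) * h powr (1 - s) / (poisson_const s * (1 - s)) * t powr (s - 1)"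
    unfolding poisson_\<phi>_def by (rule poisson_int_bound[OF s h(1) poisson_assms[OF h] t])
  also have "\<dots> = C * (h powr (s + \<beta>) * h powr (1 - s)) / (poisson_const s * (1 - s)) * t powr (s - 1)" by simp
  also have "h powr (s + \<beta>) * h powr (1 - s) = h powr (1 + \<beta>)"
    by (subst powr_add[symmetric]) (rule arg_cong[of _ _ "\<lambda>e. h powr e"], simp)
  finally show ?thesis by (simp add: poisson_bound_def)
qed

text \<open>The Poisson bound t^(s-1) blows up at 0, so on [0, 1] continuity of the correction is
  used instead; beyond 1 the Poisson term is bounded and the increment of \<phi> governs.\<close>

lemma correction_growth:
  assumes h: "0 < h" "h < 1"
  obtains B where "\<And>t. \<bar>correction h t\<bar> \<le> B * (1 + \<bar>t\<bar>) powr (s + \<alpha>)"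
proof -
  have "compact (correction h ` {0..1})"
    using isCont_correction[OF h] by (intro compact_continuous_image) (auto intro: continuous_at_imp_continuous_on)
  then obtain B1 where B1: "\<And>t. 0 \<le> t \<Longrightarrow> t \<le> 1 \<Longrightarrow> \<bar>correction h t\<bar> \<le> B1"
    by (metis atLeastAtMost_iff bounded_iff compact_imp_bounded imageI real_norm_def)
  define B2 where "B2 = \<bar>poisson_bound * h powr (1 + \<beta>)\<bar>"
  define B where "B = \<bar>B1\<bar> + 3 * C + B2"
  have one: "1 \<le> (1 + \<bar>t\<bar>) powr (s + \<alpha>)" for t :: real
    using s \<alpha>s by (intro ge_one_powr_ge_zero) auto
  have B: "B \<ge> 0" using C by (simp add: B_def B2_def)
  show ?thesis
  proof (rule that)
    fix t :: real
    consider "t \<le> 0" | "0 < t" "t \<le> 1" | "t > 1" by linarith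
    then show "\<bar>correction h t\<bar> \<le> B * (1 + \<bar>t\<bar>) powr (s + \<alpha>)"
    proof cases
      case 1
      then show ?thesis using B by (simp add: correction_def)
    next
      case 2
      then have "\<bar>correction h t\<bar> \<le> B * 1" using B1[of t] C by (simp add: B_def B2_def)
      also have "\<dots> \<le> B * (1 + \<bar>t\<bar>) powr (s + \<alpha>)" using B one by (intro mult_left_mono) auto
      finally show ?thesis .
    next
      case 3
      have "t powr (s - 1) \<le> 1 powr (s - 1)" using 3 s by (intro powr_mono2') auto
      then have "\<bar>poisson_bound * h powr (1 + \<beta>)\<bar> * t powr (s - 1) \<le> B2 * 1"
        unfolding B2_def by (intro mult_left_mono) auto
      moreover have "poisson_bound * h powr (1 + \<beta>) * t powr (s - 1) \<le> \<bar>poisson_bound * h powr (1 + \<beta>)\<bar> * t powr (s - 1)"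
        by (intro mult_right_mono) auto
      ultimately have "\<bar>poisson_\<phi> h t\<bar> \<le> B2" using poisson_\<phi>_bound[OF h, of t] 3 by linarith
      moreover have "B2 \<le> B2 * (1 + \<bar>t\<bar>) powr (s + \<alpha>)"
        using mult_left_mono[OF one[of t], of B2] by (simp add: B2_def)
      moreover have "\<bar>\<phi> (t + h) - \<phi> t\<bar> \<le> 3 * C * (1 + \<bar>t\<bar>) powr (s + \<alpha>)"
        using \<phi>_increment_growth[OF h, of t] 3 by simp
      moreover have "0 \<le> \<bar>B1\<bar> * (1 + \<bar>t\<bar>) powr (s + \<alpha>)" by simp
      ultimately have "\<bar>\<phi> (t + h) - \<phi> t - poisson_\<phi> h t\<bar>
          \<le> \<bar>B1\<bar> * (1 + \<bar>t\<bar>) powr (s + \<alpha>) + 3 * C * (1 + \<bar>t\<bar>) powr (s + \<alpha>) + B2 * (1 + \<bar>t\<bar>) powr (s + \<alpha>)"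
        by linarith
      then show ?thesis using 3 by (simp add: correction_def B_def distrib_right)
    qed
  qed
qed

lemma u_increment: "u (x + h *\<^sub>R e) - u x
   = (p \<bullet> x) * pos_powr_diff s h (x $ k) + (b * pos_powr_diff s h (x $ k) + (\<phi> (x $ k + h) - \<phi> (x $ k)))"
  unfolding u_decomposition[of "x + h *\<^sub>R e"] u_decomposition[of x]
  by (simp add: inner_add_right p_e pos_powr_diff_def algebra_simps)

text \<open>The term with p \<bullet> x has to be removed along with the exterior values: near the
  boundary it may grow linearly in |x|, which can exceed the order s + \<alpha> allowed in the
  half-space theorem.\<close>

definition "harmonic_part h x = (p \<bullet> x) * pos_powr_diff s h (x $ k) + (b * pos_powr_diff s h (x $ k) + extension h (x $ k))"

lemma u_increment_correction:
  "h > 0 \<Longrightarrow> u (x + h *\<^sub>R e) - u x - harmonic_part h x = correction h (x $ k)"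
  by (simp add: u_increment harmonic_part_def extension_correction)

lemma continuous_correction_k:
  assumes h: "0 < h" "h < 1"
  shows "continuous_on UNIV (\<lambda>x :: real ^ 'n. correction h (x $ k))"
proof (rule continuous_on_compose2[of UNIV "correction h"])
  show "continuous_on UNIV (correction h)"
    using isCont_correction[OF h] by (intro continuous_at_imp_continuous_on) auto
qed (auto intro!: continuous_intros)

lemma measurable_extension:
  assumes h: "0 < h" "h < 1"
  shows "extension h \<in> borel_measurable borel"
proof -
  have [measurable]: "\<phi> \<in> borel_measurable borel" using continuous_\<phi> by (rule borel_measurable_continuous_onI)
  have "continuous_on UNIV (correction h)"
    using isCont_correction[OF h] by (intro continuous_at_imp_continuous_on) auto
  then have [measurable]: "correction h \<in> borel_measurable borel" by (rule borel_measurable_continuous_onI)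
  have "extension h = (\<lambda>t. \<phi> (t + h) - \<phi> t - correction h t)"
    using extension_correction[OF h(1)] by blast
  also have "\<dots> \<in> borel_measurable borel" by measurable
  finally show ?thesis .
qed

lemma harmonic_part_harmonic:
  assumes h: "0 < h" "h < 1" and x: "x $ k > 0"
  shows "universally_harmonic s lam Lam (harmonic_part h) x"
  unfolding harmonic_part_def
proof (rule universally_harmonic_add)
  show "universally_harmonic s lam Lam (\<lambda>x. (p \<bullet> x) * pos_powr_diff s h (x $ k)) x"
    using lam s h x
    by (intro universally_harmonic_linear_component has_frac_lap_pos_powr_diff odd_integral_pos_powr_diff) auto
  have ext: "has_frac_lap s (extension h) (x $ k) 0"
    unfolding extension_def poisson_\<phi>_def
    by (rule has_frac_lap_poisson_extension[OF s h(1) continuous_\<phi> \<phi>_nonpos x])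
  note [measurable] = measurable_extension[OF h]
  have "has_frac_lap s (\<lambda>t. b * pos_powr_diff s h t + extension h t) (x $ k) (b * 0 + 0)"
    using s h x by (intro has_frac_lap_add has_frac_lap_cmult has_frac_lap_pos_powr_diff ext) auto
  then show "universally_harmonic s lam Lam (\<lambda>x. b * pos_powr_diff s h (x $ k) + extension h (x $ k)) x"
    using universally_harmonic_component[of lam s "\<lambda>t. b * pos_powr_diff s h t + extension h t" x k Lam] lam s by simp
qed

lemma c2_on_harmonic_part:
  assumes h: "0 < h" "h < 1"
  shows "c2_on (upper_half_space k) (harmonic_part h)"
proof -
  have "c2_pos (extension h)"
    by (rule c2_pos_cong[OF c2_pos_poisson_\<phi>[OF h]]) (simp add: extension_def)
  then have "c2_pos (\<lambda>t. b * pos_powr_diff s h t + extension h t)"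
    using h by (intro c2_pos_add c2_pos_mult c2_pos_const c2_pos_pos_powr_diff) auto
  from c2_on_component[OF this, of "upper_half_space k" k]
  have flat: "c2_on (upper_half_space k) (\<lambda>x. b * pos_powr_diff s h (x $ k) + extension h (x $ k))"
    by (simp add: upper_half_space_def)
  have "c2_on (upper_half_space k) (\<lambda>x. pos_powr_diff s h (x $ k))"
    using h by (intro c2_on_component c2_pos_pos_powr_diff) (auto simp: upper_half_space_def)
  from c2_on_add[OF c2_on_mult[OF c2_on_linear this] flat] show ?thesis
    unfolding harmonic_part_def .
qed

text \<open>The full increment of u satisfies the viscosity inequalities, and subtracting the
  harmonic part leaves a function of x_k alone, still a solution, with zero exterior values and
  growth s + \<alpha>. The half-space theorem then forces it to be c t^s.\<close>

lemma normal_increment: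
  assumes h: "0 < h" "h < 1"
  obtains c where "\<And>t. t > 0 \<Longrightarrow> \<phi> (t + h) - \<phi> t = c * t powr s + poisson_\<phi> h t"
proof -
  obtain B where B: "\<And>t. \<bar>correction h t\<bar> \<le> B * (1 + \<bar>t\<bar>) powr (s + \<alpha>)"
    by (rule correction_growth[OF h]) blast
  define w where "w = (\<lambda>x. u (x + h *\<^sub>R e) - u x)"
  have wP: "(\<lambda>x. w x - harmonic_part h x) = (\<lambda>x. correction h (x $ k))"
    using u_increment_correction[OF h(1)] by (simp add: w_def)
  have cw: "continuous_on UNIV w"
    unfolding w_def by (intro continuous_intros continuous_on_compose2[OF cont]) auto
  have [measurable]: "w \<in> borel_measurable borel" using cw by (rule borel_measurable_continuous_onI)
  note cc = continuous_correction_k[OF h]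
  have [measurable]: "(\<lambda>x :: real ^ 'n. correction h (x $ k)) \<in> borel_measurable borel"
    using cc by (rule borel_measurable_continuous_onI)
  have "harmonic_part h = (\<lambda>x. w x - correction h (x $ k))" using wP by (auto simp: fun_eq_iff algebra_simps)
  then have Pm: "harmonic_part h \<in> borel_measurable borel" by simp
  have growth: "\<bar>correction h (x $ k)\<bar> \<le> B * (1 + norm x) powr (s + \<alpha>)" for x :: "real ^ 'n"
  proof -
    have "B \<ge> 0" using B[of 0] by (simp add: order.trans[OF abs_ge_zero])
    then have "B * (1 + \<bar>x $ k\<bar>) powr (s + \<alpha>) \<le> B * (1 + norm x) powr (s + \<alpha>)"
      using component_le_norm_cart[of x k] s \<alpha>s by (intro mult_left_mono powr_mono2) auto
    with B[of "x $ k"] show ?thesis by linarith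
  qed
  have wi: "weighted_integrable s (\<lambda>x. w x - harmonic_part h x)"
    unfolding wP by (rule weighted_integrable_growth[where \<gamma> = "s + \<alpha>", OF _ _ growth]) (use \<alpha>s in auto)
  have cc': "isCont (\<lambda>x :: real ^ 'n. correction h (x $ k)) x" for x
    using cc by (simp add: continuous_on_eq_continuous_at)
  have hk: "(h *\<^sub>R e) $ k \<ge> 0" using h by simp
  interpret half_space_solution k s lam Lam \<alpha> B "\<lambda>x. correction h (x $ k)"
  proof
    show "visc_M_plus_ge s lam Lam (upper_half_space k) (\<lambda>x. correction h (x $ k)) (\<lambda>x. 0)"
      unfolding wP[symmetric]
    proof (rule visc_M_plus_ge_subtract[OF plus[OF hk, folded w_def] lam s _ Pm c2_on_harmonic_part[OF h] _ wi])
      show "usc_on (upper_half_space k) (\<lambda>x. w x - harmonic_part h x)"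
        unfolding wP by (intro isCont_imp_usc_on cc')
    qed (auto simp: upper_half_space_def intro: harmonic_part_harmonic[OF h])
    show "visc_M_minus_le s lam Lam (upper_half_space k) (\<lambda>x. correction h (x $ k)) (\<lambda>x. 0)"
      unfolding wP[symmetric]
    proof (rule visc_M_minus_le_subtract[OF minus[OF hk, folded w_def] lam s _ Pm c2_on_harmonic_part[OF h] _ wi])
      show "lsc_on (upper_half_space k) (\<lambda>x. w x - harmonic_part h x)"
        unfolding wP by (intro isCont_imp_lsc_on cc')
    qed (auto simp: upper_half_space_def intro: harmonic_part_harmonic[OF h])
  qed (use lam s \<alpha>s cc growth in \<open>auto simp: correction_def\<close>)
  obtain c where c: "\<And>x. correction h (x $ k) = c * pos_powr s (x $ k)"
    using half_space_liouville[OF ss be] \<alpha> by auto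
  show ?thesis
  proof (rule that)
    fix t :: real assume "t > 0"
    then show "\<phi> (t + h) - \<phi> t = c * t powr s + poisson_\<phi> h t"
      using c[of "t *\<^sub>R e"] by (simp add: correction_def pos_powr_pos)
  qed
qed

lemma \<phi>_power: obtains K where "\<And>t. \<phi> t = K * t * pos_powr s t"
proof -
  have c\<phi>: "isCont \<phi> z" for z using continuous_\<phi> by (simp add: continuous_on_eq_continuous_at)
  have inc: "\<exists>c. \<forall>t>0. \<bar>\<phi> (t + h) - \<phi> t - c * t powr s\<bar> \<le> poisson_bound * h powr (1 + \<beta>) * t powr (s - 1)"
    if h: "0 < h" "h < 1" for h
    using normal_increment[OF h] poisson_\<phi>_bound[OF h] by (metis add_diff_cancel_left')
  have \<beta>01: "0 < \<beta>" "\<beta> < 1" using \<beta> by auto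
  obtain K d where Kd: "\<And>t. t > 0 \<Longrightarrow> \<phi> t = K * t powr (s + 1) + d"
    by (rule increments_imp_power[OF s \<beta>01 c\<phi> inc]) blast+
  have "((\<lambda>t. K * t powr (s + 1) + d) \<longlongrightarrow> K * 0 + d) (at_right 0)"
  proof (intro tendsto_intros)
    show "((\<lambda>t. t powr (s + 1)) \<longlongrightarrow> 0) (at_right 0)" using s by real_asymp
  qed
  moreover have "\<forall>\<^sub>F t in at_right 0. K * t powr (s + 1) + d = \<phi> t"
    by (intro eventually_at_rightI[of 0 1]) (auto simp: Kd)
  ultimately have "(\<phi> \<longlongrightarrow> d) (at_right 0)" using Lim_transform_eventually by fastforce
  moreover have "(\<phi> \<longlongrightarrow> \<phi> 0) (at_right 0)"
    using c\<phi>[of 0] unfolding isCont_def by (simp add: filterlim_at_split)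
  \<comment> \<open>The increments of \<phi> do not see additive constants; continuity at the
    boundary point fixes this one.\<close>
  ultimately have "d = 0" using tendsto_unique[of "at_right (0::real)" \<phi> d "\<phi> 0"] by (simp add: \<phi>_nonpos)
  show ?thesis
  proof (rule that)
    fix t
    show "\<phi> t = K * t * pos_powr s t"
      using Kd[of t] \<open>d = 0\<close> by (cases "t > 0") (auto simp: \<phi>_nonpos pos_powr_neg pos_powr_pos powr_add)
  qed
qed

lemma solution_form: "\<exists>(p :: real ^ 'n) b. \<forall>x. u x = (max (x $ k) 0) powr s * (p \<bullet> x + b)"
proof -
  obtain K where K: "\<And>t. \<phi> t = K * t * pos_powr s t" by (rule \<phi>_power) blast
  \<comment> \<open>The tangential vector p has normal component 0; the coefficient K of t^(s+1)
    supplies it.\<close>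
  have "u x = (max (x $ k) 0) powr s * ((p + K *\<^sub>R e) \<bullet> x + b)" for x
    unfolding u_decomposition[of x] K
    by (simp add: inner_add_left e_def inner_axis' pos_powr_def algebra_simps)
  then show ?thesis by blast
qed

end

theorem theorem1p4:
  fixes k :: "'n::finite" and u :: "real ^ 'n \<Rightarrow> real"
    and s s0 lam Lam abar \<alpha> \<beta> C :: real
  assumes "0 < lam" and "lam \<le> Lam"
    and "s0 \<in> {0<..<1}" and "s \<in> {s0..<1}"
    and "boundary_exponent k s0 lam Lam abar"
    and "continuous_on UNIV u"
    and "\<And>h. h $ k \<ge> 0 \<Longrightarrow>
      visc_M_plus_ge s lam Lam (upper_half_space k) (\<lambda>x. u (x + h) - u x) (\<lambda>x. 0)"
    and "\<And>h. h $ k \<ge> 0 \<Longrightarrow>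
      visc_M_minus_le s lam Lam (upper_half_space k) (\<lambda>x. u (x + h) - u x) (\<lambda>x. 0)"
    and "\<And>x. x \<in> lower_half_space k \<Longrightarrow> u x = 0"
    and "\<beta> \<in> {0<..<1}" and "\<alpha> \<in> {0<..<abar}"
    and "\<And>R. R \<ge> 1 \<Longrightarrow>
      holder_seminorm \<beta> (upper_half_ball k R) (\<lambda>x. u x / (max (x $ k) 0) powr s)
        \<le> ennreal (C * R powr \<alpha>)"
  shows "\<exists>(p :: real ^ 'n) (b :: real). \<forall>x. u x = (max (x $ k) 0) powr s * (p \<bullet> x + b)"
proof -
  \<comment> \<open>\<open>ennreal\<close> maps negative numbers to 0, so a bound with negative C
    also holds with 0 in its place.\<close>
  interpret liouville_setting k u s s0 lam Lam abar \<alpha> \<beta> "max C 0"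
  proof
    show "holder_seminorm \<beta> (upper_half_ball k R) (\<lambda>x. u x / (max (x $ k) 0) powr s)
        \<le> ennreal (max C 0 * R powr \<alpha>)" if "R \<ge> 1" for R
      using assms(12)[OF that] by (rule order.trans) (intro ennreal_leI mult_right_mono, auto)
  qed (use assms in auto)
  obtain p where p: "p $ k = 0" "\<And>z. slope z = p \<bullet> z" by (rule slope_inner) blast
  obtain b where b: "\<And>t R. R \<ge> 1 \<Longrightarrow> 0 < t \<Longrightarrow> t < R \<Longrightarrow> \<bar>q0 t - b\<bar> \<le> max C 0 * R powr \<alpha> * t powr \<beta>"
    by (rule q0_limit) blast
  interpret liouville_reduced k u s s0 lam Lam abar \<alpha> \<beta> "max C 0" p b
    by unfold_locales (use p b in auto)
  show ?thesis by (rule solution_form)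
qed

end
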